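(* For every $n\ge3$, let $b_n\in\mathcal{B}_n$ be the equivalence class of the word of length $2n$ composed of a $1$, followed by a $0$, then $n-1$ letters $1$ and finally $n-1$ letters $0$. Then $$\mathbb{P}(b_n)=\frac{n}{3\cdot 2^{2n-6}}.$$
   Context: Let $n\ge 3$ and let $P_1,\ldots,P_n$ be $n$ distinct points on the unit circle of the complex plane in counterclockwise cyclic order; let $L_i$ be the perpendicular bisector of $[P_i,P_{i+1}]$ (indices modulo $n$). Assume generic position: the lines $L_i$ are pairwise distinct, no $P_j$ lies on any $L_i$, and the point $1$ lies on no $L_i$. The lines divide the plane into $2n$ regions, numbered counterclockwise starting with the region containing $1$; the occupancy word is $(v_1,\ldots,v_{2n})\in\{0,1\}^{2n}$ where $v_i$ is the number of points $P_j$ in the $i$th region. A word is realizable if it is the occupancy word of some such generic collection. A bracelet is an equivalence class of words up to cyclic shifts and reversal; $\mathcal{B}_n$ is the set of realizable bracelets, i.e. classes of realizable words of length $2n$. Random model: select $n$ i.i.d. points uniformly at random on the unit circle (almost surely in generic position), label them in cyclic order, and consider the realizable word obtained. For $b\in\mathcal{B}_n$, $\mathbb{P}(b)$ is the probability that the equivalence class of this word is $b$. *)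

theory Defs
  imports "HOL-Probability.Probability"
begin

text \<open>Points and regions are indexed from 0, so that the index i + 1 modulo n makes sense.\<close>

definition ccw_ordered :: "nat \<Rightarrow> (nat \<Rightarrow> complex) \<Rightarrow> bool" where
  "ccw_ordered m P \<longleftrightarrow>
     (\<exists>\<theta> :: nat \<Rightarrow> real. strict_mono_on {..<m} \<theta> \<and> \<theta> (m - 1) < \<theta> 0 + 2 * pi \<and>
        (\<forall>i<m. P i = cis (\<theta> i)))"

definition perp_bisector :: "complex \<Rightarrow> complex \<Rightarrow> complex set" where
  "perp_bisector p q = {z. orthogonal (z - midpoint p q) (q - p)}"

definition bisector :: "nat \<Rightarrow> (nat \<Rightarrow> complex) \<Rightarrow> nat \<Rightarrow> complex set" where
  "bisector n P i = perp_bisector (P i) (P ((i + 1) mod n))"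

definition generic :: "nat \<Rightarrow> (nat \<Rightarrow> complex) \<Rightarrow> bool" where
  "generic n P \<longleftrightarrow>
     inj_on (bisector n P) {..<n} \<and>
     (\<forall>i<n. \<forall>j<n. P j \<notin> bisector n P i) \<and>
     (\<forall>i<n. 1 \<notin> bisector n P i)"

definition regions :: "nat \<Rightarrow> (nat \<Rightarrow> complex) \<Rightarrow> complex set set" where
  "regions n P = components (- (\<Union>i<n. bisector n P i))"

text \<open>All bisectors pass through 0, so the regions are open sectors with apex 0. Hence the cyclic
  order of the regions is that of any points of the unit circle chosen one in each region, and
  a numbering as below is unique on the indices less than \<open>2 * n\<close>.\<close>

definition region_numbering :: "nat \<Rightarrow> (nat \<Rightarrow> complex) \<Rightarrow> (nat \<Rightarrow> complex set) \<Rightarrow> bool" where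
  "region_numbering n P R \<longleftrightarrow>
     bij_betw R {..<2 * n} (regions n P) \<and> 1 \<in> R 0 \<and>
     (\<exists>q. ccw_ordered (2 * n) q \<and> (\<forall>i<2 * n. q i \<in> R i))"

definition occupancy_word :: "nat \<Rightarrow> (nat \<Rightarrow> complex) \<Rightarrow> nat list \<Rightarrow> bool" where
  "occupancy_word n P w \<longleftrightarrow>
     (\<exists>R. region_numbering n P R \<and> w = map (\<lambda>i. card {j. j < n \<and> P j \<in> R i}) [0..<2 * n])"

definition realizable :: "nat \<Rightarrow> nat list \<Rightarrow> bool" where
  "realizable n w \<longleftrightarrow> (\<exists>P. ccw_ordered n P \<and> generic n P \<and> occupancy_word n P w)"

definition bracelet_rel :: "(nat list \<times> nat list) set" where
  "bracelet_rel = {(u, w). \<exists>k. w = rotate k u \<or> w = rotate k (rev u)}"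

lemma equiv_bracelet_rel: "equiv UNIV bracelet_rel"
proof (rule equivI)
  have unrot: "\<exists>k'. rotate k' (rotate k u) = u" for u :: "nat list" and k
  proof (cases "u = []")
    case False
    then have "1 \<le> length u" by (cases u) auto
    then have "length u * k - k + k = length u * k"
      by simp
    then have "rotate (length u * k - k) (rotate k u) = u"
      by (simp add: rotate_rotate rotate_id)
    then show ?thesis by blast
  qed simp
  have rev_rot: "\<exists>k'. rev (rotate k u) = rotate k' (rev u)" for u :: "nat list" and k
  proof (cases "u = [] \<or> k mod length u = 0")
    case True
    then have "rev (rotate k u) = rotate 0 (rev u)" by auto
    then show ?thesis by blast
  next
    case False
    define m where "m = k mod length u"
    have m: "0 < m" "m < length u" using False by (auto simp: m_def)
    then have "rotate (length u - m) (rev u) = rev (rotate m u)"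
      by (simp add: rotate_rev)
    then show ?thesis by (metis m_def rotate_conv_mod)
  qed
  show "bracelet_rel \<subseteq> UNIV \<times> UNIV" by simp
  show "refl bracelet_rel"
    by (auto simp: refl_on_def bracelet_rel_def intro: exI[of _ 0])
  show "sym bracelet_rel"
  proof (rule symI)
    fix u w assume "(u, w) \<in> bracelet_rel"
    then obtain k where "w = rotate k u \<or> w = rotate k (rev u)"
      by (auto simp: bracelet_rel_def)
    then have "\<exists>k'. u = rotate k' w \<or> u = rotate k' (rev w)"
    proof
      assume "w = rotate k u"
      then show ?thesis using unrot[of k u] by metis
    next
      assume w: "w = rotate k (rev u)"
      obtain l where "rev w = rotate l u" using rev_rot[of k "rev u"] w by auto
      then show ?thesis using unrot[of l u] by metis
    qed
    then show "(w, u) \<in> bracelet_rel"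
      by (simp add: bracelet_rel_def)
  qed
  show "trans bracelet_rel"
  proof (rule transI)
    fix u v w assume "(u, v) \<in> bracelet_rel" "(v, w) \<in> bracelet_rel"
    then obtain k l where v: "v = rotate k u \<or> v = rotate k (rev u)"
      and w: "w = rotate l v \<or> w = rotate l (rev v)"
      by (auto simp: bracelet_rel_def)
    obtain k' where "rev v = rotate k' u \<or> rev v = rotate k' (rev u)"
      using v rev_rot[of k u] rev_rot[of k "rev u"] by auto
    then have "\<exists>m. w = rotate m u \<or> w = rotate m (rev u)"
      using v w by (metis rotate_rotate)
    then show "(u, w) \<in> bracelet_rel"
      by (simp add: bracelet_rel_def)
  qed
qed

definition bracelet :: "nat list \<Rightarrow> nat list set" where
  "bracelet w = bracelet_rel `` {w}"

definition realizable_bracelets :: "nat \<Rightarrow> nat list set set" where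
  "realizable_bracelets n = {w. realizable n w} // bracelet_rel"

definition uniform_circle :: "complex measure" where
  "uniform_circle = distr (uniform_measure lborel {0..<2 * pi}) borel cis"

text \<open>The labelling of a set of n points in cyclic order is determined up to a cyclic shift of
  the labels, which permutes the bisectors and does not change the occupancy word. Unlabelled
  points that are not in generic position have no word, hence yield no bracelet.\<close>

definition yields_bracelet :: "nat \<Rightarrow> complex set \<Rightarrow> nat list set \<Rightarrow> bool" where
  "yields_bracelet n S b \<longleftrightarrow>
     (\<exists>P w. P ` {..<n} = S \<and> ccw_ordered n P \<and> generic n P \<and> occupancy_word n P w \<and>
        bracelet w = b)"

definition bracelet_word :: "nat \<Rightarrow> nat list" where
  "bracelet_word n = [1, 0] @ replicate (n - 1) 1 @ replicate (n - 1) 0"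

end

theory Submission
  imports Defs
begin

text \<open>Put the point of the isolated letter 1 at angle 0 and the others at angles
  \<open>b\<^sub>1 < \<dots> < b\<^bsub>n-1\<^esub>\<close> in \<open>(0, 2 * pi)\<close>. Consecutive points are separated by one half of their bisector, so the
  empty regions are cut off by the opposite halves; counting these between neighbouring points
  shows that, up to reflection, the word is the given one exactly when \<open>b\<^bsub>n-1\<^esub> < 2 * b\<^sub>1\<close> and
  \<open>b\<^bsub>n-2\<^esub> + b\<^bsub>n-1\<^esub> < 2 * pi\<close>. These n inequalities define a simplex of dimension \<open>n - 1\<close>. In the
  unimodular coordinates \<open>2 * b\<^sub>1 - b\<^bsub>n-1\<^esub>\<close> and \<open>b\<^sub>j - b\<^bsub>j-1\<^esub>\<close> it is given by positivity and a bound on a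
  linear form with coefficients 2, 4 (\<open>n - 3\<close> times) and 3, so it has the normalised volume
  \<open>1 / (6 * 4 ^ (n - 3) * (n - 1)!)\<close>. The orientation and the labelling contribute the
  factor \<open>2 * n!\<close>; the corresponding events are disjoint because a simplex condition makes the two
  gaps next to the isolated point the two largest ones, in a known order.\<close>

section \<open>Lifts of the points to the line\<close>

text \<open>The angles are lifted to a sequence over the integers with
  \<open>\<theta> (i + int n) = \<theta> i + 2 * pi\<close>, so that relabelling and reflection
  become substitutions of the index. With \<open>\<theta> 0 = 0\<close> and b_j for
  \<open>\<theta> j\<close>, the inequality b_(n-1) < 2 * b_1 puts the far half of the bisector
  between the last point and point 0, at angle b_(n-1) / 2, before b_1; together with the near half
  at b_1 / 2 it encloses the isolated empty region. The inequality b_(n-2) + b_(n-1) < 2 * pi puts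
  all other far halves before 2 * pi, and both inequalities together put them after b_(n-1), where
  they cut off the run of n - 1 empty regions. The same inequalities imply general position except
  for the bisectors through 1. That condition depends on the absolute angles and not on their
  differences, so it is carried along separately until it is discarded as a null event.\<close>

definition mid_angle :: "(int \<Rightarrow> real) \<Rightarrow> int \<Rightarrow> real" where
  "mid_angle \<theta> i = (\<theta> i + \<theta> (i + 1)) / 2"

text \<open>The bisectors consist of the rays of angles \<open>mid_angle \<theta> i + k * pi\<close>, and the sum of floors
  increases by 1 at each of them. Two angles lie in the same region if and only if
  their counts agree modulo \<open>2 * n\<close>, so the count numbers the regions without sorting the rays.\<close>

definition ray_count :: "nat \<Rightarrow> (int \<Rightarrow> real) \<Rightarrow> real \<Rightarrow> int" where
  "ray_count n \<theta> t = (\<Sum>i<n. \<lfloor>(t - mid_angle \<theta> (int i)) / pi\<rfloor>)"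

text \<open>Quantifying over all integers makes the condition invariant under shifts and reflection
  of the index. Mid angles in one residue class differ by full turns, so the last clause compares
  residue classes only.\<close>

definition generic_lift :: "nat \<Rightarrow> (int \<Rightarrow> real) \<Rightarrow> bool" where
  "generic_lift n \<theta> \<longleftrightarrow> (\<forall>i j. sin (\<theta> j - mid_angle \<theta> i) \<noteq> 0) \<and> (\<forall>i. sin (mid_angle \<theta> i) \<noteq> 0) \<and>
     (\<forall>i j. i mod int n \<noteq> j mod int n \<longrightarrow> sin (mid_angle \<theta> i - mid_angle \<theta> j) \<noteq> 0)"

text \<open>Among generic points these inequalities characterise the word \<open>bracelet_word n\<close> up to rotation,
  \<open>\<theta> 0\<close> being the point in the region of the initial 1.\<close>

definition good_lift :: "nat \<Rightarrow> (int \<Rightarrow> real) \<Rightarrow> bool" where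
  "good_lift n \<theta> \<longleftrightarrow> \<theta> (int n - 1) - \<theta> 0 < 2 * (\<theta> 1 - \<theta> 0) \<and>
     (\<theta> (int n - 1) - \<theta> 0) + (\<theta> (int n - 2) - \<theta> 0) < 2 * pi"

locale circle_lift =
  fixes n :: nat and \<theta> :: "int \<Rightarrow> real"
  assumes n3: "3 \<le> n"
    and step: "\<theta> i < \<theta> (i + 1)"
    and period: "\<theta> (i + int n) = \<theta> i + 2 * pi"
begin

lemma period_mult: "\<theta> (i + int n * k) = \<theta> i + 2 * pi * of_int k"
proof (induction k rule: int_induct[where k = 0])
  case (step1 k)
  then show ?case using period[of "i + int n * k"] by (simp add: algebra_simps)
next
  case (step2 k)
  then show ?case using period[of "i + int n * (k - 1)"] by (simp add: algebra_simps)
qed simp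

lemma mono: "i < j \<Longrightarrow> \<theta> i < \<theta> j"
proof (induction j rule: int_gr_induct)
  case base then show ?case using step by simp
next
  case (step j) then show ?case using circle_lift.step[OF circle_lift_axioms, of j] by linarith
qed

lemma mono_le: "i \<le> j \<Longrightarrow> \<theta> i \<le> \<theta> j"
  using mono[of i j] by (cases "i = j") auto

lemma mono_iff: "\<theta> i < \<theta> j \<longleftrightarrow> i < j"
  using mono mono_le by (meson not_less)

lemma mid_angle_mult: "mid_angle \<theta> (i + int n * k) = mid_angle \<theta> i + 2 * pi * of_int k"
proof -
  have "i + int n * k + 1 = (i + 1) + int n * k" by simp
  then show ?thesis
    using period_mult[of i k] period_mult[of "i+1" k] by (simp add: mid_angle_def field_simps)
qed

lemma mid_angle_bounds: "\<theta> i < mid_angle \<theta> i" "mid_angle \<theta> i < \<theta> (i + 1)"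
  using step[of i] by (auto simp: mid_angle_def)

lemma mid_angle_mono: "i < j \<Longrightarrow> mid_angle \<theta> i < mid_angle \<theta> j"
  using mono[of i j] mono[of "i+1" "j+1"] by (simp add: mid_angle_def)

lemma ray_count_mono: "s \<le> t \<Longrightarrow> ray_count n \<theta> s \<le> ray_count n \<theta> t"
  unfolding ray_count_def by (intro sum_mono floor_mono divide_right_mono) auto

text \<open>A full turn crosses both halves of each of the \<open>n\<close> lines; a point of the
  circle therefore determines its count only modulo \<open>2 * n\<close>.\<close>

lemma ray_count_shift: "ray_count n \<theta> (t + 2 * pi * of_int k) = ray_count n \<theta> t + 2 * int n * k"
proof -
  have "\<lfloor>(t + 2 * pi * of_int k - mid_angle \<theta> (int i)) / pi\<rfloor> = \<lfloor>(t - mid_angle \<theta> (int i)) / pi\<rfloor> + 2 * k" for i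
  proof -
    have "(t + 2 * pi * of_int k - mid_angle \<theta> (int i)) / pi = (t - mid_angle \<theta> (int i)) / pi + of_int (2 * k)"
      by (simp add: field_simps)
    then show ?thesis by (simp only: floor_add_int)
  qed
  then show ?thesis by (simp add: ray_count_def sum.distrib)
qed

lemma ray_count_index_shift: "ray_count n \<theta> (\<theta> (i + int n * k)) = ray_count n \<theta> (\<theta> i) + 2 * int n * k"
  by (simp add: period_mult ray_count_shift)

end

lemma sin_floor_bounds:
  assumes "sin y \<noteq> 0"
  shows "of_int \<lfloor>y / pi\<rfloor> * pi < y" "y < (of_int \<lfloor>y / pi\<rfloor> + 1) * pi"
proof -
  have "of_int \<lfloor>y / pi\<rfloor> * pi \<noteq> y"
    using assms by (metis sin_npi_int mult.commute)
  moreover have "of_int \<lfloor>y / pi\<rfloor> * pi \<le> y"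
    by (metis of_int_floor_le pi_gt_zero pos_le_divide_eq)
  ultimately show "of_int \<lfloor>y / pi\<rfloor> * pi < y" by simp
  show "y < (of_int \<lfloor>y / pi\<rfloor> + 1) * pi"
    by (metis pi_gt_zero pos_divide_less_eq real_of_int_floor_add_one_gt)
qed

text \<open>Subtracting \<open>\<lfloor>y / pi\<rfloor> * pi\<close> brings \<open>y\<close> between
  0 and \<open>pi\<close> and multiplies the sine by the parity sign. The parity of a floor thus
  tells the side of a line.\<close>

lemma sin_pos_iff_even_floor:
  assumes "sin y \<noteq> 0"
  shows "0 < sin y \<longleftrightarrow> even \<lfloor>y / pi\<rfloor>"
proof -
  define k where "k = \<lfloor>y / pi\<rfloor>"
  have "0 < sin (y - of_int k * pi)"
    using sin_floor_bounds[OF assms] by (intro sin_gt_zero) (auto simp: k_def algebra_simps)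
  moreover have "sin (y - of_int k * pi) = sin y * cos (of_int k * pi)"
    by (simp add: sin_diff mult.commute)
  moreover have "cos (of_int k * pi) = (if even k then 1 else -1)"
    by (simp add: cos_npi_int mult.commute)
  ultimately show ?thesis by (auto simp: k_def split: if_splits)
qed

lemma sin_same_sign_iff:
  assumes "sin y \<noteq> 0" "sin z \<noteq> 0"
  shows "0 < sin y * sin z \<longleftrightarrow> (even \<lfloor>y / pi\<rfloor> \<longleftrightarrow> even \<lfloor>z / pi\<rfloor>)"
  using sin_pos_iff_even_floor[OF assms(1)] sin_pos_iff_even_floor[OF assms(2)] assms
  by (auto simp: zero_less_mult_iff)

lemma floor_div_pi_eqI: "of_int k * pi \<le> y \<Longrightarrow> y < (of_int k + 1) * pi \<Longrightarrow> \<lfloor>y / pi\<rfloor> = k"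
  by (intro floor_unique) (auto simp: field_simps)

lemma sin_neq_0I: "of_int k * pi < y \<Longrightarrow> y < (of_int k + 1) * pi \<Longrightarrow> sin y \<noteq> 0"
proof
  assume *: "of_int k * pi < y" "y < (of_int k + 1) * pi" "sin y = 0"
  then obtain j where "y = of_int j * pi" using sin_zero_iff_int2 by auto
  with * have "real_of_int k < of_int j" "real_of_int j < of_int (k + 1)"
    using mult_less_cancel_right_pos[OF pi_gt_zero] by auto
  then have "k < j" "j < k + 1" by (simp_all only: of_int_less_iff)
  then show False by simp
qed

context circle_lift begin

text \<open>The products test whether both angles lie on the same side of each line. Once
  \<open>t\<close> is moved into the turn starting at \<open>s\<close>, each floor grows by 0, 1 or
  2, and a line separates the angles exactly if its floor grows by 1. The total growth is at most
  \<open>2 * n\<close>, so it is divisible by \<open>2 * n\<close> only if all growths are 0 or all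
  are 2.\<close>

lemma same_region_iff:
  assumes s: "\<And>i. i < n \<Longrightarrow> sin (s - mid_angle \<theta> (int i)) \<noteq> 0"
    and t: "\<And>i. i < n \<Longrightarrow> sin (t - mid_angle \<theta> (int i)) \<noteq> 0"
  shows "ray_count n \<theta> s mod (2 * int n) = ray_count n \<theta> t mod (2 * int n) \<longleftrightarrow>
    (\<forall>i<n. 0 < sin (s - mid_angle \<theta> (int i)) * sin (t - mid_angle \<theta> (int i)))"
proof -
  have main: "ray_count n \<theta> s mod (2 * int n) = ray_count n \<theta> u mod (2 * int n) \<longleftrightarrow>
    (\<forall>i<n. 0 < sin (s - mid_angle \<theta> (int i)) * sin (u - mid_angle \<theta> (int i)))"
    if u: "\<And>i. i < n \<Longrightarrow> sin (u - mid_angle \<theta> (int i)) \<noteq> 0" and su: "s \<le> u" "u < s + 2 * pi" for u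
  proof -
    define d where "d i = \<lfloor>(u - mid_angle \<theta> (int i)) / pi\<rfloor> - \<lfloor>(s - mid_angle \<theta> (int i)) / pi\<rfloor>" for i
    have d: "0 \<le> d i" "d i \<le> 2" for i
    proof -
      show "0 \<le> d i" unfolding d_def using su by (simp add: floor_mono divide_right_mono)
      have "(u - mid_angle \<theta> (int i)) / pi \<le> (s - mid_angle \<theta> (int i)) / pi + of_int 2"
        using su by (simp add: field_simps)
      then show "d i \<le> 2" unfolding d_def using floor_mono floor_add_int by (smt (verit))
    qed
    have sum: "ray_count n \<theta> u = ray_count n \<theta> s + (\<Sum>i<n. d i)"
      by (simp add: ray_count_def d_def sum_subtractf)
    have sgn: "0 < sin (s - mid_angle \<theta> (int i)) * sin (u - mid_angle \<theta> (int i)) \<longleftrightarrow> even (d i)" if "i < n" for i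
      using sin_same_sign_iff[OF s u, OF that that] by (auto simp: d_def)
    have bnd: "0 \<le> (\<Sum>i<n. d i)" "(\<Sum>i<n. d i) \<le> 2 * int n"
      using d sum_nonneg[of "{..<n}" d] sum_mono[of "{..<n}" d "\<lambda>_. 2"] by auto
    have modeq: "ray_count n \<theta> s mod (2 * int n) = ray_count n \<theta> u mod (2 * int n) \<longleftrightarrow> 2 * int n dvd (\<Sum>i<n. d i)"
      unfolding sum by (metis add_diff_cancel_left' mod_eq_dvd_iff)
    show ?thesis
    proof
      assume "ray_count n \<theta> s mod (2 * int n) = ray_count n \<theta> u mod (2 * int n)"
      then obtain k where k: "(\<Sum>i<n. d i) = 2 * int n * k" using modeq by auto
      with bnd n3 have "0 \<le> k" "k \<le> 1" by (auto simp: zero_le_mult_iff)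
      then have "k = 0 \<or> k = 1" by auto
      with k consider "(\<Sum>i<n. d i) = 0" | "(\<Sum>i<n. d i) = 2 * int n" by auto
      then show "\<forall>i<n. 0 < sin (s - mid_angle \<theta> (int i)) * sin (u - mid_angle \<theta> (int i))"
      proof cases
        case 1
        then have "\<forall>i<n. d i = 0" using d by (simp add: sum_nonneg_eq_0_iff)
        then show ?thesis using sgn by simp
      next
        case 2
        then have "(\<Sum>i<n. 2 - d i) = 0" by (simp add: sum_subtractf)
        then have "\<forall>i<n. 2 - d i = 0" using d by (subst (asm) sum_nonneg_eq_0_iff) auto
        then show ?thesis using sgn by simp
      qed
    next
      assume "\<forall>i<n. 0 < sin (s - mid_angle \<theta> (int i)) * sin (u - mid_angle \<theta> (int i))"
      then have ev: "i < n \<Longrightarrow> even (d i)" for i using sgn by simp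
      show "ray_count n \<theta> s mod (2 * int n) = ray_count n \<theta> u mod (2 * int n)"
      \<comment> \<open>Within half a turn no floor grows by 2, and from there on every floor grows;
        even growth is therefore 0 for all lines or 2 for all lines.\<close>
      proof (cases "u < s + pi")
        case True
        have d1: "d i \<le> 1" for i
        proof -
          have "(u - mid_angle \<theta> (int i)) / pi \<le> (s - mid_angle \<theta> (int i)) / pi + of_int 1"
            using True by (simp add: field_simps)
          then show ?thesis unfolding d_def using floor_mono floor_add_int by (smt (verit))
        qed
        have "d i = 0" if "i < n" for i using ev[OF that] d(1)[of i] d1[of i] by presburger
        then show ?thesis using sum by simp
      next
        case False
        have d1: "1 \<le> d i" for i
        proof -
          have "(s - mid_angle \<theta> (int i)) / pi + of_int 1 \<le> (u - mid_angle \<theta> (int i)) / pi"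
            using divide_right_mono[of "s - mid_angle \<theta> (int i) + pi" "u - mid_angle \<theta> (int i)" pi] False
            by (simp add: add_divide_distrib)
          then show ?thesis unfolding d_def using floor_mono floor_add_int by (smt (verit))
        qed
        have "d i = 2" if "i < n" for i using ev[OF that] d(2)[of i] d1[of i]
          by presburger
        then have "(\<Sum>i<n. d i) = 2 * int n" by simp
        then show ?thesis using sum by (metis mod_add_self2)
      qed
    qed
  qed
  \<comment> \<open>\<open>u\<close> is the representative of \<open>t\<close> modulo full turns in
    the window from \<open>s\<close> to \<open>s + 2 * pi\<close>.\<close>
  define k where "k = - \<lfloor>(t - s) / (2 * pi)\<rfloor>"
  define u where "u = t + 2 * pi * of_int k"
  have "of_int \<lfloor>(t - s) / (2 * pi)\<rfloor> * (2 * pi) \<le> t - s"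
    by (metis of_int_floor_le pi_gt_zero pos_le_divide_eq mult_pos_pos zero_less_numeral)
  moreover have "t - s < (of_int \<lfloor>(t - s) / (2 * pi)\<rfloor> + 1) * (2 * pi)"
    by (metis real_of_int_floor_add_one_gt pi_gt_zero pos_divide_less_eq mult_pos_pos zero_less_numeral)
  ultimately have "s \<le> u" "u < s + 2 * pi" by (auto simp: u_def k_def algebra_simps)
  moreover have sinu: "sin (u - mid_angle \<theta> (int i)) = sin (t - mid_angle \<theta> (int i))" for i
  proof -
    have "u - mid_angle \<theta> (int i) = (t - mid_angle \<theta> (int i)) + 2 * pi * of_int k" by (simp add: u_def)
    then show ?thesis by (simp only: sin_add sin_int_2pin cos_int_2pin)
  qed
  moreover have "ray_count n \<theta> u mod (2 * int n) = ray_count n \<theta> t mod (2 * int n)"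
    by (simp add: u_def ray_count_shift)
  ultimately show ?thesis using main[of u] t by simp
qed

text \<open>The nearest two rays after t belong to different lines or are opposite; the witness lies
  between them.\<close>

lemma ray_count_step:
  assumes t: "\<And>i. i < n \<Longrightarrow> sin (t - mid_angle \<theta> (int i)) \<noteq> 0"
    and dist: "\<And>i j. i < n \<Longrightarrow> j < n \<Longrightarrow> i \<noteq> j \<Longrightarrow> sin (mid_angle \<theta> (int i) - mid_angle \<theta> (int j)) \<noteq> 0"
  obtains s where "\<And>i. i < n \<Longrightarrow> sin (s - mid_angle \<theta> (int i)) \<noteq> 0" "ray_count n \<theta> s = ray_count n \<theta> t + 1"
proof -
  define f where "f i = \<lfloor>(t - mid_angle \<theta> (int i)) / pi\<rfloor>" for i
  \<comment> \<open>The first ray of line \<open>i\<close> after \<open>t\<close>.\<close>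
  define N where "N i = mid_angle \<theta> (int i) + (of_int (f i) + 1) * pi" for i
  have N: "N i - pi < t" "t < N i" if "i < n" for i
    using sin_floor_bounds[OF t[OF that]] by (auto simp: N_def f_def algebra_simps)
  have Nneq: "N i \<noteq> N j" if "i < n" "j < n" "i \<noteq> j" for i j
  proof
    assume "N i = N j"
    then have "mid_angle \<theta> (int i) - mid_angle \<theta> (int j) = pi * of_int (f j - f i)"
      by (simp add: N_def algebra_simps)
    then have "sin (mid_angle \<theta> (int i) - mid_angle \<theta> (int j)) = 0" by (metis sin_npi_int)
    with dist that show False by blast
  qed
  have "Min (N ` {..<n}) \<in> N ` {..<n}" using n3 by (intro Min_in) (auto simp: lessThan_empty_iff)
  then obtain a where a: "a < n" "N a = Min (N ` {..<n})" by auto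
  then have amin: "N a \<le> N i" if "i < n" for i using that by simp
  define B where "B = insert (N a + pi) (N ` ({..<n} - {a}))"
  have "N a < b" if "b \<in> B" for b
    using that amin Nneq a by (force simp: B_def le_less)
  then have "N a < Min B" by (subst Min_gr_iff) (auto simp: B_def)
  define s where "s = (N a + Min B) / 2"
  have s1: "N a < s" "s < Min B" using \<open>N a < Min B\<close> by (auto simp: s_def)
  have s2: "s < N i" if "i < n" "i \<noteq> a" for i
    using s1(2) that by (subst (asm) Min_gr_iff) (auto simp: B_def)
  have s3: "s < N a + pi" using s1(2) by (subst (asm) Min_gr_iff) (auto simp: B_def)
  \<comment> \<open>Only the ray \<open>N a\<close> lies between \<open>t\<close> and
    \<open>s\<close>, so a single floor grows, by 1.\<close>
  define g where "g i = (if i = a then f i + 1 else f i)" for i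
  have bd: "of_int (g i) * pi < s - mid_angle \<theta> (int i)" "s - mid_angle \<theta> (int i) < (of_int (g i) + 1) * pi"
    if "i < n" for i
    using s1 s2[OF that] s3 N[OF that] N[OF a(1)] by (auto simp: g_def N_def algebra_simps)
  have "ray_count n \<theta> s = (\<Sum>i<n. g i)"
    unfolding ray_count_def using bd by (intro sum.cong refl floor_div_pi_eqI less_imp_le) auto
  also have "\<dots> = (\<Sum>i<n. f i) + (\<Sum>i<n. if i = a then 1 else 0)"
    unfolding sum.distrib[symmetric] by (intro sum.cong) (auto simp: g_def)
  also have "(\<Sum>i<n. if i = a then 1 else 0 :: int) = 1" using a by simp
  also have "(\<Sum>i<n. f i) = ray_count n \<theta> t" by (simp add: ray_count_def f_def)
  finally have "ray_count n \<theta> s = ray_count n \<theta> t + 1" .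
  then show ?thesis using sin_neq_0I[OF bd] by (intro that) simp_all
qed

lemma ray_count_surj:
  assumes t: "\<And>i. i < n \<Longrightarrow> sin (t - mid_angle \<theta> (int i)) \<noteq> 0"
    and dist: "\<And>i j. i < n \<Longrightarrow> j < n \<Longrightarrow> i \<noteq> j \<Longrightarrow> sin (mid_angle \<theta> (int i) - mid_angle \<theta> (int j)) \<noteq> 0"
  shows "\<exists>s. (\<forall>i<n. sin (s - mid_angle \<theta> (int i)) \<noteq> 0) \<and> ray_count n \<theta> s = ray_count n \<theta> t + int k"
proof (induction k)
  case 0 then show ?case using t by auto
next
  case (Suc k)
  then obtain s where s: "\<And>i. i < n \<Longrightarrow> sin (s - mid_angle \<theta> (int i)) \<noteq> 0" "ray_count n \<theta> s = ray_count n \<theta> t + int k"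
    by auto
  obtain s' where "\<And>i. i < n \<Longrightarrow> sin (s' - mid_angle \<theta> (int i)) \<noteq> 0" "ray_count n \<theta> s' = ray_count n \<theta> s + 1"
    using ray_count_step[OF s(1) dist] by metis
  with s show ?case by (intro exI[of _ s']) auto
qed

end

section \<open>Regions and occupancy words\<close>

text \<open>With half sum \<open>m\<close> and half difference \<open>h\<close>, the chord is
  \<open>2 * sin h\<close> times a unit vector orthogonal to \<open>cis m\<close>, and the midpoint
  is a multiple of \<open>cis m\<close>. So the bisector is the line through 0 in direction
  \<open>cis m\<close>; the assumption says that the endpoints differ.\<close>

lemma perp_bisector_cis:
  assumes "sin ((b - a) / 2) \<noteq> 0"
  shows "perp_bisector (cis a) (cis b) = {z. Im z * cos ((a + b) / 2) - Re z * sin ((a + b) / 2) = 0}"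
proof -
  define m where "m = (a + b) / 2"
  define h where "h = (b - a) / 2"
  have ab: "a = m - h" "b = m + h" by (auto simp: m_def h_def field_simps)
  have "(z - midpoint (cis a) (cis b)) \<bullet> (cis b - cis a) =
        2 * sin h * (Im z * cos m - Re z * sin m)" for z
    by (simp add: inner_complex_def midpoint_def ab cos_add cos_diff sin_add sin_diff algebra_simps)
  then show ?thesis
    using assms by (simp add: perp_bisector_def orthogonal_def flip: m_def h_def)
qed

lemma cis_eq_imp: "cis x = cis y \<Longrightarrow> \<exists>k. x = y + 2 * pi * of_int k"
  by (metis cis.code complex.inject sin_cos_eq_iff mult.commute)

context circle_lift begin

abbreviation "pts \<equiv> (\<lambda>j. cis (\<theta> (int j)))"

lemma cis_period: "cis (\<theta> (i + int n * k)) = cis (\<theta> i)"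
  by (simp add: period_mult flip: cis_mult)

lemma cis_mod: "cis (\<theta> (i mod int n)) = cis (\<theta> i)"
  by (metis cis_period mod_mult_div_eq)

lemma cis_eq_iff: "cis (\<theta> i) = cis (\<theta> j) \<longleftrightarrow> i mod int n = j mod int n"
proof
  assume "cis (\<theta> i) = cis (\<theta> j)"
  then obtain k where "\<theta> i = \<theta> (j + int n * k)" using cis_eq_imp period_mult by metis
  then have "i = j + int n * k" using mono_iff by (metis less_irrefl linorder_neqE)
  then show "i mod int n = j mod int n" by simp
qed (metis cis_mod)

text \<open>Signed distance from the bisector of index \<open>i\<close>.\<close>

definition lin :: "nat \<Rightarrow> complex \<Rightarrow> real" where
  "lin i z = Im z * cos (mid_angle \<theta> (int i)) - Re z * sin (mid_angle \<theta> (int i))"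

lemma lin_cis: "lin i (cis t) = sin (t - mid_angle \<theta> (int i))"
  by (simp add: lin_def sin_diff)

lemma bisector_eq: "i < n \<Longrightarrow> bisector n pts i = {z. lin i z = 0}"
proof -
  assume i: "i < n"
  have "pts ((i + 1) mod n) = cis (\<theta> (int i + 1))"
    by (metis cis_mod of_nat_1 of_nat_add of_nat_mod)
  \<comment> \<open>A gap is shorter than a full turn because point \<open>i\<close> recurs only
    \<open>n\<close> steps later; half the gap then has positive sine.\<close>
  moreover have "\<theta> (int i + 1) < \<theta> (int i) + 2 * pi"
    using mono[of "int i + 1" "int i + int n"] period[of "int i"] n3 by simp
  then have "sin ((\<theta> (int i + 1) - \<theta> (int i)) / 2) > 0"
    using step[of "int i"] by (intro sin_gt_zero) auto
  ultimately show ?thesis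
    unfolding bisector_def using perp_bisector_cis by (simp add: lin_def mid_angle_def)
qed

lemma sin_mid_angle_mod:
  "sin (t - mid_angle \<theta> (i mod int n)) = 0 \<longleftrightarrow> sin (t - mid_angle \<theta> i) = 0"
proof -
  have "t - mid_angle \<theta> i = (t - mid_angle \<theta> (i mod int n)) - 2 * pi * of_int (i div int n)"
    using mid_angle_mult[of "i mod int n" "i div int n"] by simp
  then show ?thesis by (simp only: sin_diff sin_int_2pin cos_int_2pin) simp
qed

lemma sin_theta_mod: "sin (\<theta> (i mod int n) - m) = 0 \<longleftrightarrow> sin (\<theta> i - m) = 0"
proof -
  have "\<theta> i - m = (\<theta> (i mod int n) - m) + 2 * pi * of_int (i div int n)"
    using period_mult[of "i mod int n" "i div int n"] by simp
  then show ?thesis by (simp only: sin_add sin_int_2pin cos_int_2pin) simp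
qed

lemma sin_minus_iff: "sin (a - b) = 0 \<longleftrightarrow> sin (b - a) = (0::real)"
  by (metis minus_diff_eq sin_minus neg_equal_0_iff_equal)

lemma lin_zero_eqD:
  assumes "{z. lin i z = 0} = {z. lin j z = 0}"
  shows "sin (mid_angle \<theta> (int i) - mid_angle \<theta> (int j)) = 0"
proof -
  have "lin i (cis (mid_angle \<theta> (int i))) = 0" by (simp add: lin_cis)
  then have "lin j (cis (mid_angle \<theta> (int i))) = 0" using assms by blast
  then show ?thesis by (simp add: lin_cis)
qed

lemma lin_zero_eqI:
  assumes "sin (mid_angle \<theta> (int i) - mid_angle \<theta> (int j)) = 0"
  shows "{z. lin i z = 0} = {z. lin j z = 0}"
proof -
  obtain k where "mid_angle \<theta> (int i) - mid_angle \<theta> (int j) = of_int k * pi"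
    using assms sin_zero_iff_int2 by blast
  then have "mid_angle \<theta> (int i) = mid_angle \<theta> (int j) + of_int k * pi" by simp
  then have "lin i z = cos (of_int k * pi) * lin j z" for z
    by (simp add: lin_def cos_add sin_add mult.commute[of _ pi] algebra_simps)
  moreover have "cos (of_int k * pi) \<noteq> 0" by (simp add: cos_npi_int mult.commute)
  ultimately show ?thesis by simp
qed

text \<open>The clauses of \<open>generic\<close> concern indices below \<open>n\<close>; reducing
  an index modulo \<open>n\<close> changes angles by full turns, which preserves the vanishing of
  each sine.\<close>

lemma generic_iff: "generic n pts \<longleftrightarrow> generic_lift n \<theta>"
proof -
  have "inj_on (bisector n pts) {..<n} \<longleftrightarrow>
      (\<forall>i<n. \<forall>j<n. i \<noteq> j \<longrightarrow> sin (mid_angle \<theta> (int i) - mid_angle \<theta> (int j)) \<noteq> 0)"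
    unfolding inj_on_def using bisector_eq lin_zero_eqD lin_zero_eqI by (metis lessThan_iff)
  also have "\<dots> \<longleftrightarrow> (\<forall>i j. i mod int n \<noteq> j mod int n \<longrightarrow> sin (mid_angle \<theta> i - mid_angle \<theta> j) \<noteq> 0)"
  proof (intro iffI allI impI)
    fix i j
    assume *: "\<forall>i<n. \<forall>j<n. i \<noteq> j \<longrightarrow> sin (mid_angle \<theta> (int i) - mid_angle \<theta> (int j)) \<noteq> 0"
      and ij: "i mod int n \<noteq> j mod int n"
    have "sin (mid_angle \<theta> (int (nat (i mod int n))) - mid_angle \<theta> (int (nat (j mod int n)))) \<noteq> 0"
      using n3 ij by (intro *[rule_format]) (auto simp: nat_less_iff eq_nat_nat_iff)
    then show "sin (mid_angle \<theta> i - mid_angle \<theta> j) \<noteq> 0"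
      using n3 sin_mid_angle_mod[of "mid_angle \<theta> (i mod int n)" j] sin_mid_angle_mod[of "mid_angle \<theta> j" i] sin_minus_iff
      by simp
  next
    fix i j assume "\<forall>i j. i mod int n \<noteq> j mod int n \<longrightarrow> sin (mid_angle \<theta> i - mid_angle \<theta> j) \<noteq> 0"
      and "i < n" "j < n" "i \<noteq> j"
    then show "sin (mid_angle \<theta> (int i) - mid_angle \<theta> (int j)) \<noteq> 0" by simp
  qed
  finally have 1: "inj_on (bisector n pts) {..<n} \<longleftrightarrow>
    (\<forall>i j. i mod int n \<noteq> j mod int n \<longrightarrow> sin (mid_angle \<theta> i - mid_angle \<theta> j) \<noteq> 0)" .
  have 2: "(\<forall>i<n. \<forall>j<n. pts j \<notin> bisector n pts i) \<longleftrightarrow> (\<forall>i j. sin (\<theta> j - mid_angle \<theta> i) \<noteq> 0)"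
  proof
    assume "\<forall>i<n. \<forall>j<n. pts j \<notin> bisector n pts i"
    then have *: "sin (\<theta> (int j) - mid_angle \<theta> (int i)) \<noteq> 0" if "i < n" "j < n" for i j
      using that by (simp add: bisector_eq lin_cis)
    have "sin (\<theta> (int (nat (j mod int n))) - mid_angle \<theta> (int (nat (i mod int n)))) \<noteq> 0" for i j
      using n3 by (intro *) (auto simp: nat_less_iff)
    then show "\<forall>i j. sin (\<theta> j - mid_angle \<theta> i) \<noteq> 0"
      using n3 by (simp add: sin_mid_angle_mod sin_theta_mod)
  qed (simp add: bisector_eq lin_cis)
  have 3: "(\<forall>i<n. 1 \<notin> bisector n pts i) \<longleftrightarrow> (\<forall>i. sin (mid_angle \<theta> i) \<noteq> 0)"
  proof
    assume "\<forall>i<n. 1 \<notin> bisector n pts i"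
    then have *: "sin (0 - mid_angle \<theta> (int i)) \<noteq> 0" if "i < n" for i
      using that by (simp add: bisector_eq lin_def)
    have "sin (0 - mid_angle \<theta> (int (nat (i mod int n)))) \<noteq> 0" for i
      using n3 by (intro *) (auto simp: nat_less_iff)
    then have "sin (0 - mid_angle \<theta> i) \<noteq> 0" for i
      using n3 sin_mid_angle_mod[of 0 i] by simp
    then show "\<forall>i. sin (mid_angle \<theta> i) \<noteq> 0" by simp
  qed (simp add: bisector_eq lin_def)
  show ?thesis unfolding generic_def generic_lift_def 1 2 3 by blast
qed

section \<open>Regions as convex sectors\<close>

definition sector :: "complex \<Rightarrow> complex set" where
  "sector z = {w. \<forall>i<n. 0 < lin i z * lin i w}"

lemma lin_combine: "lin i (u *\<^sub>R x + v *\<^sub>R y) = u * lin i x + v * lin i y"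
  by (simp add: lin_def algebra_simps)

lemma continuous_lin: "continuous_on A (lin i)"
  unfolding lin_def by (intro continuous_intros)

lemma convex_sector: "convex (sector z)"
proof -
  have "convex {w. 0 < lin i z * lin i w}" for i
  proof (rule convexI)
    fix x y :: complex and u v :: real
    assume *: "x \<in> {w. 0 < lin i z * lin i w}" "y \<in> {w. 0 < lin i z * lin i w}" "0 \<le> u" "0 \<le> v" "u + v = 1"
    have "lin i z * lin i (u *\<^sub>R x + v *\<^sub>R y) = u * (lin i z * lin i x) + v * (lin i z * lin i y)"
      by (simp add: lin_combine algebra_simps)
    also have "\<dots> > 0"
    proof (cases "u = 0")
      case True with * show ?thesis by simp
    next
      case False with * have "0 < u * (lin i z * lin i x)" by simp
      moreover from * have "0 \<le> v * (lin i z * lin i y)" by simp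
      ultimately show ?thesis by simp
    qed
    finally show "u *\<^sub>R x + v *\<^sub>R y \<in> {w. 0 < lin i z * lin i w}" by simp
  qed
  then have "convex (\<Inter>i\<in>{..<n}. {w. 0 < lin i z * lin i w})" by (intro convex_INT) auto
  also have "(\<Inter>i\<in>{..<n}. {w. 0 < lin i z * lin i w}) = sector z" by (auto simp: sector_def)
  finally show ?thesis .
qed

lemma complement_eq: "- (\<Union>i<n. bisector n pts i) = {z. \<forall>i<n. lin i z \<noteq> 0}"
  by (auto simp: bisector_eq)

text \<open>The sector is convex and avoids the lines, so it lies in the component. Conversely each
  \<open>lin i\<close> maps the component to an interval without 0, so its sign is constant
  there.\<close>

lemma component_eq_sector:
  assumes "\<forall>i<n. lin i z \<noteq> 0"
  shows "connected_component_set {z. \<forall>i<n. lin i z \<noteq> 0} z = sector z"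
proof
  let ?U = "{z. \<forall>i<n. lin i z \<noteq> 0}"
  have "z \<in> sector z" using assms by (auto simp: sector_def zero_less_mult_iff) 
  moreover have "sector z \<subseteq> ?U" by (auto simp: sector_def)
  ultimately show "sector z \<subseteq> connected_component_set ?U z"
    by (intro connected_component_maximal convex_connected convex_sector)
  let ?C = "connected_component_set ?U z"
  have zC: "z \<in> ?C" using assms by (simp add: connected_component_refl)
  have CU: "?C \<subseteq> ?U" by (rule connected_component_subset)
  show "?C \<subseteq> sector z"
  proof
    fix w assume w: "w \<in> ?C"
    show "w \<in> sector z" unfolding sector_def
    proof (intro CollectI allI impI)
      fix i assume i: "i < n"
      have "connected (lin i ` ?C)"
        by (intro connected_continuous_image continuous_lin) (simp add: connected_connected_component)
      moreover have "0 \<notin> lin i ` ?C" using CU i by force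
      moreover have "lin i z \<in> lin i ` ?C" "lin i w \<in> lin i ` ?C" using zC w by blast+
      ultimately have "\<not> (lin i z \<le> 0 \<and> 0 \<le> lin i w)" "\<not> (lin i w \<le> 0 \<and> 0 \<le> lin i z)"
        by (meson connected_iff_interval)+
      then show "0 < lin i z * lin i w" by (auto simp: zero_less_mult_iff)
    qed
  qed
qed

lemma regions_eq: "regions n pts = sector ` {z. \<forall>i<n. lin i z \<noteq> 0}"
  unfolding regions_def complement_eq components_def using component_eq_sector by (auto simp: image_def)

abbreviation "offray t \<equiv> (\<forall>i<n. sin (t - mid_angle \<theta> (int i)) \<noteq> 0)"

lemma sector_cis_mem: "offray s \<Longrightarrow> offray t \<Longrightarrow>
    cis t \<in> sector (cis s) \<longleftrightarrow> ray_count n \<theta> t mod (2 * int n) = ray_count n \<theta> s mod (2 * int n)"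
  using same_region_iff[of s t] by (auto simp: sector_def lin_cis)

lemma sector_eq:
  assumes "z \<in> sector w" shows "sector z = sector w"
proof -
  have "0 < lin i z * lin i x \<longleftrightarrow> 0 < lin i w * lin i x" if "i < n" for i x
    using assms that by (auto simp: sector_def zero_less_mult_iff dest!: spec[of _ i])
  then show ?thesis by (auto simp: sector_def)
qed

text \<open>\<open>lin i\<close> is homogeneous, so scaling a point to modulus 1 changes no sign:
  every region meets the unit circle.\<close>

lemma region_cis:
  assumes "A \<in> regions n pts"
  obtains t where "offray t" "A = sector (cis t)"
proof -
  obtain z where z: "\<forall>i<n. lin i z \<noteq> 0" "A = sector z" using assms by (auto simp: regions_eq)
  have "lin 0 z \<noteq> 0" using z(1) n3 by simp
  then have "z \<noteq> 0" by (auto simp: lin_def)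
  have zz: "z = cmod z *\<^sub>R cis (Arg z)" by (metis rcis_cmod_Arg rcis_def scaleR_conv_of_real)
  have lin: "lin i z = cmod z * lin i (cis (Arg z))" for i
    by (subst zz) (use lin_combine[of i "cmod z" "cis (Arg z)" 0 0] in simp)
  then have "offray (Arg z)" using z(1) by (auto simp: lin_cis)
  moreover have "cis (Arg z) \<in> sector z"
    unfolding sector_def
  proof (intro CollectI allI impI)
    fix i assume "i < n"
    then have "lin i (cis (Arg z)) \<noteq> 0" using z(1) lin[of i] by auto
    then have "0 < lin i (cis (Arg z)) * lin i (cis (Arg z))" by (simp add: zero_less_mult_iff) linarith
    then show "0 < lin i z * lin i (cis (Arg z))"
      using \<open>z \<noteq> 0\<close> by (subst lin) (simp add: mult.assoc)
  qed
  ultimately show ?thesis using that sector_eq z(2) by metis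
qed

lemma sector_self: "offray s \<Longrightarrow> cis s \<in> sector (cis s)"
  by (simp add: sector_cis_mem)

lemma region_sector: "offray s \<Longrightarrow> sector (cis s) \<in> regions n pts"
  by (auto simp: regions_eq lin_cis)

lemma region_eqI: "A \<in> regions n pts \<Longrightarrow> z \<in> A \<Longrightarrow> A = sector z"
  using sector_eq by (auto simp: regions_eq)

text \<open>Every admissible numbering is rigid. Its witnesses have sorted angles within one turn,
  so their counts are weakly increasing; as these are pairwise distinct modulo \<open>2 * n\<close>,
  they are \<open>2 * n\<close> integers in a window of that length and hence consecutive. The
  region of 1 fixes the starting value.\<close>

lemma numbering_ray_count:
  assumes R: "region_numbering n pts R" and i: "i < 2 * n" and t: "offray t" and z: "offray 0"
  shows "cis t \<in> R i \<longleftrightarrow> ray_count n \<theta> t mod (2 * int n) = (ray_count n \<theta> 0 + int i) mod (2 * int n)"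
proof -
  let ?N = "2 * int n"
  have bij: "bij_betw R {..<2 * n} (regions n pts)" and one: "1 \<in> R 0"
    using R by (auto simp: region_numbering_def)
  obtain q where q: "ccw_ordered (2 * n) q" "\<And>i. i < 2 * n \<Longrightarrow> q i \<in> R i"
    using R by (auto simp: region_numbering_def)
  obtain \<tau> where \<tau>: "strict_mono_on {..<2 * n} \<tau>" "\<tau> (2 * n - 1) < \<tau> 0 + 2 * pi"
      "\<And>i. i < 2 * n \<Longrightarrow> q i = cis (\<tau> i)"
    using q(1) by (auto simp: ccw_ordered_def)
  have reg: "R i \<in> regions n pts" if "i < 2 * n" for i
    using bij that by (auto simp: bij_betw_def)
  have Rsec: "R i = sector (cis (\<tau> i))" if "i < 2 * n" for i
    using region_eqI[OF reg[OF that]] q(2)[OF that] \<tau>(3)[OF that] by simp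
  have off: "offray (\<tau> i)" if i: "i < 2 * n" for i
  proof -
    have "cis (\<tau> i) \<in> R i" using q(2)[OF i] \<tau>(3)[OF i] by simp
    then obtain x where "cis (\<tau> i) \<in> sector x" using reg[OF i] by (auto simp: regions_eq)
    then have "\<forall>i'<n. lin i' (cis (\<tau> i)) \<noteq> 0" by (auto simp: sector_def)
    then show ?thesis by (simp add: lin_cis)
  qed
  define c where "c i = ray_count n \<theta> (\<tau> i)" for i
  have cneq: "c i mod ?N \<noteq> c j mod ?N" if "i < 2 * n" "j < 2 * n" "i \<noteq> j" for i j
  proof
    assume "c i mod ?N = c j mod ?N"
    then have "cis (\<tau> i) \<in> sector (cis (\<tau> j))"
      using sector_cis_mem[OF off off] that by (simp add: c_def)
    then have "R i = R j" using Rsec sector_eq that by metis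
    with bij that show False by (auto simp: bij_betw_def inj_on_def)
  qed
  have le: "c i \<le> c j" if "i \<le> j" "j < 2 * n" for i j
    unfolding c_def using \<tau>(1) that
    by (intro ray_count_mono) (auto simp: strict_mono_on_def le_less)
  have less: "c i < c j" if "i < j" "j < 2 * n" for i j
    using le[of i j] cneq[of i j] that by (auto simp: order_le_less)
  have ge: "c 0 + int i \<le> c i" if "i < 2 * n" for i
    using that
  proof (induction i)
    case (Suc i) then show ?case using less[of i "Suc i"] by simp
  qed simp
  have last: "c (2 * n - 1) < c 0 + ?N"
  proof -
    have "c (2 * n - 1) \<le> ray_count n \<theta> (\<tau> 0 + 2 * pi * of_int 1)"
      unfolding c_def using \<tau>(2) by (intro ray_count_mono) simp
    also have "\<dots> = c 0 + ?N" by (simp only: ray_count_shift c_def)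
    finally have "c (2 * n - 1) \<le> c 0 + ?N" .
    moreover have "c (2 * n - 1) \<noteq> c 0 + ?N" using cneq[of "2 * n - 1" 0] n3 by auto
    ultimately show ?thesis by simp
  qed
  \<comment> \<open>Counting down from the last value supplies the upper bounds that match the lower
    bounds \<open>ge\<close>.\<close>
  have up: "c (2 * n - 1 - k) \<le> c (2 * n - 1) - int k" if "k < 2 * n" for k
    using that
  proof (induction k)
    case (Suc k)
    moreover have "2 * n - 1 - Suc k < 2 * n - 1 - k" using Suc.prems by linarith
    ultimately show ?case using less[of "2 * n - 1 - Suc k" "2 * n - 1 - k"] by simp
  qed simp
  have c: "c i = c 0 + int i" if "i < 2 * n" for i
    using up[of "2 * n - 1 - i"] last ge[OF that] that n3 by (simp add: of_nat_diff)
  have "cis 0 \<in> sector (cis (\<tau> 0))" using one Rsec[of 0] n3 by simp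
  then have c0: "ray_count n \<theta> 0 mod ?N = c 0 mod ?N"
    using sector_cis_mem[OF off z, of 0] n3 by (simp add: c_def)
  have "cis t \<in> R i \<longleftrightarrow> ray_count n \<theta> t mod ?N = c i mod ?N"
    using Rsec[OF i] sector_cis_mem[OF off[OF i] t] by (simp add: c_def)
  also have "c i mod ?N = (ray_count n \<theta> 0 + int i) mod ?N"
    using c0 c[OF i] by (metis mod_add_left_eq)
  finally show ?thesis .
qed

text \<open>Angles whose counts are the \<open>2 * n\<close> consecutive values from the count of 0
  onwards represent the regions; monotonicity of the count sorts them and keeps them within one
  turn.\<close>

lemma numbering_exists:
  assumes z: "offray 0"
    and dist: "\<And>i j. i < n \<Longrightarrow> j < n \<Longrightarrow> i \<noteq> j \<Longrightarrow> sin (mid_angle \<theta> (int i) - mid_angle \<theta> (int j)) \<noteq> 0"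
  shows "\<exists>R. region_numbering n pts R"
proof -
  let ?N = "2 * int n"
  have "\<exists>s. offray s \<and> ray_count n \<theta> s = ray_count n \<theta> 0 + int k" for k
    using ray_count_surj[of 0 k] z dist by auto
  then obtain s where s: "\<And>k. offray (s k)" "\<And>k. ray_count n \<theta> (s k) = ray_count n \<theta> 0 + int k" by metis
  define R where "R k = sector (cis (s k))" for k
  have mem: "cis t \<in> R k \<longleftrightarrow> ray_count n \<theta> t mod ?N = (ray_count n \<theta> 0 + int k) mod ?N" if "offray t" for t k
    using sector_cis_mem[OF s(1) that] s(2) by (simp add: R_def)
  have "inj_on R {..<2 * n}"
  proof (rule inj_onI)
    fix i j assume *: "i \<in> {..<2 * n}" "j \<in> {..<2 * n}" "R i = R j"
    have "cis (s i) \<in> R j" using sector_self[OF s(1)] *(3) by (metis R_def)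
    then have "(ray_count n \<theta> 0 + int i) mod ?N = (ray_count n \<theta> 0 + int j) mod ?N"
      using mem[OF s(1)] s(2) by simp
    then have "?N dvd int i - int j" by (simp add: mod_eq_dvd_iff)
    then have "int i mod ?N = int j mod ?N" by (simp add: mod_eq_dvd_iff)
    then show "i = j" using * by simp
  qed
  moreover have "R ` {..<2 * n} = regions n pts"
  proof
    show "R ` {..<2 * n} \<subseteq> regions n pts" using region_sector s(1) by (auto simp: R_def)
    show "regions n pts \<subseteq> R ` {..<2 * n}"
    proof
      fix A assume "A \<in> regions n pts"
      then obtain t where t: "offray t" "A = sector (cis t)" by (rule region_cis)
      define k where "k = nat ((ray_count n \<theta> t - ray_count n \<theta> 0) mod ?N)"
      have k: "int k = (ray_count n \<theta> t - ray_count n \<theta> 0) mod ?N" using n3 by (simp add: k_def)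
      then have "int k < ?N" using n3 by simp
      then have "k < 2 * n" by simp
      moreover have "cis t \<in> R k" using mem[OF t(1)] k by (simp add: mod_add_right_eq)
      then have "A = R k" using sector_eq t(2) by (simp add: R_def)
      ultimately show "A \<in> R ` {..<2 * n}" by blast
    qed
  qed
  moreover have "1 \<in> R 0" using mem[of 0 0] z by simp
  moreover have "ccw_ordered (2 * n) (\<lambda>k. cis (s k))"
    unfolding ccw_ordered_def
  proof (intro exI conjI allI impI)
    have "s i < s j" if "i < j" for i j
      using ray_count_mono[of "s j" "s i"] s(2) that by (metis add_le_cancel_left leI not_less of_nat_less_iff)
    then show "strict_mono_on {..<2 * n} s" by (auto simp: strict_mono_on_def)
    show "s (2 * n - 1) < s 0 + 2 * pi"
      using ray_count_mono[of "s 0 + 2 * pi * of_int 1" "s (2 * n - 1)"] ray_count_shift[of "s 0" 1] s(2)[of 0]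
        s(2)[of "2 * n - 1"] n3 by (cases "s (2 * n - 1) < s 0 + 2 * pi") (auto simp: of_nat_diff)
  qed simp
  moreover have "cis (s k) \<in> R k" for k using sector_self[OF s(1)] by (simp add: R_def)
  ultimately show ?thesis unfolding region_numbering_def bij_betw_def by blast
qed

lemma occupancy_word_iff:
  assumes "generic_lift n \<theta>"
  shows "occupancy_word n pts w \<longleftrightarrow>
    w = map (\<lambda>i. card {j. j < n \<and> ray_count n \<theta> (\<theta> (int j)) mod (2 * int n) = (ray_count n \<theta> 0 + int i) mod (2 * int n)}) [0..<2 * n]"
    (is "_ \<longleftrightarrow> w = ?w")
proof -
  have z: "offray 0" using assms by (simp add: generic_lift_def)
  have p: "offray (\<theta> j)" for j using assms by (simp add: generic_lift_def)
  have "map (\<lambda>i. card {j. j < n \<and> pts j \<in> R i}) [0..<2 * n] = ?w" if "region_numbering n pts R" for R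
    using numbering_ray_count[OF that _ p z] by (intro map_cong refl arg_cong[where f = card]) auto
  moreover have "sin (mid_angle \<theta> (int i) - mid_angle \<theta> (int j)) \<noteq> 0" if "i < n" "j < n" "i \<noteq> j" for i j
  proof -
    have "int i mod int n \<noteq> int j mod int n" using that by simp
    then show ?thesis using assms unfolding generic_lift_def by blast
  qed
  then have "\<exists>R. region_numbering n pts R" by (rule numbering_exists[OF z])
  ultimately show ?thesis unfolding occupancy_word_def by auto
qed

end

section \<open>Configurations with the given bracelet\<close>

definition occupied :: "nat \<Rightarrow> (int \<Rightarrow> real) \<Rightarrow> int \<Rightarrow> bool" where
  "occupied n \<theta> x \<longleftrightarrow> (\<exists>j. ray_count n \<theta> (\<theta> j) mod (2 * int n) = x mod (2 * int n))"

text \<open>The positions of the letter 1 in \<open>bracelet_word n\<close>, continued periodically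
  to the integers. Rotating the word translates the argument, and reversing it negates the argument
  up to a translation.\<close>

definition bracelet_letter :: "nat \<Rightarrow> int \<Rightarrow> bool" where
  "bracelet_letter n x \<longleftrightarrow> x mod (2 * int n) \<in> insert 0 {2..int n}"

text \<open>Complex conjugation of the points, with the index reversed to keep the lift increasing.
  The offset \<open>int n\<close> makes the bisectors with indices below \<open>n\<close> correspond
  to each other.\<close>

definition reflect :: "nat \<Rightarrow> (int \<Rightarrow> real) \<Rightarrow> int \<Rightarrow> real" where
  "reflect n \<theta> i = - \<theta> (int n - i)"

lemma mid_angle_reflect: "mid_angle (reflect n \<theta>) i = - mid_angle \<theta> (int n - 1 - i)"
  by (simp add: mid_angle_def reflect_def field_simps)

lemma reflect_reflect [simp]: "reflect n (reflect n \<theta>) = \<theta>"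
  by (simp add: reflect_def fun_eq_iff)

lemma bracelet_letter_add [simp]: "bracelet_letter n (x + 2 * int n * k) = bracelet_letter n x"
  by (simp add: bracelet_letter_def)

lemma bracelet_letter_cong: "x mod (2 * int n) = y mod (2 * int n) \<Longrightarrow> bracelet_letter n x = bracelet_letter n y"
  by (simp add: bracelet_letter_def)

lemma occupied_cong: "x mod (2 * int n) = y mod (2 * int n) \<Longrightarrow> occupied n \<theta> x = occupied n \<theta> y"
  by (simp add: occupied_def)

section \<open>Shifted and reflected lifts\<close>

context circle_lift begin

lemma lift_shift: "circle_lift n (\<lambda>i. \<theta> (i + a))"
proof
  show "3 \<le> n" by (rule n3)
  show "\<theta> (i + a) < \<theta> (i + 1 + a)" for i using step[of "i + a"] by (simp add: ac_simps)
  show "\<theta> (i + int n + a) = \<theta> (i + a) + 2 * pi" for i using period[of "i + a"] by (simp add: ac_simps)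
qed

lemma lift_reflect: "circle_lift n (reflect n \<theta>)"
proof
  show "3 \<le> n" by (rule n3)
  show "reflect n \<theta> i < reflect n \<theta> (i + 1)" for i
    using step[of "int n - (i + 1)"] by (simp add: reflect_def)
  show "reflect n \<theta> (i + int n) = reflect n \<theta> i + 2 * pi" for i
    using period[of "- i"] by (simp add: reflect_def)
qed

lemma generic_shift: "generic_lift n \<theta> \<Longrightarrow> generic_lift n (\<lambda>i. \<theta> (i + a))"
proof -
  assume g: "generic_lift n \<theta>"
  have mid_angle: "mid_angle (\<lambda>i. \<theta> (i + a)) i = mid_angle \<theta> (i + a)" for i
    by (simp add: mid_angle_def ac_simps)
  have "(i + a) mod int n \<noteq> (j + a) mod int n" if "i mod int n \<noteq> j mod int n" for i j
    using that by (simp add: mod_eq_dvd_iff)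
  then show ?thesis using g unfolding generic_lift_def mid_angle by simp
qed

lemma generic_reflect: "generic_lift n \<theta> \<Longrightarrow> generic_lift n (reflect n \<theta>)"
proof -
  assume g: "generic_lift n \<theta>"
  have 1: "sin (\<theta> j - mid_angle \<theta> i) \<noteq> 0" "sin (mid_angle \<theta> i) \<noteq> 0" for i j using g by (auto simp: generic_lift_def)
  have 2: "sin (mid_angle \<theta> i - mid_angle \<theta> j) \<noteq> 0" if "i mod int n \<noteq> j mod int n" for i j
    using g that by (auto simp: generic_lift_def)
  show ?thesis unfolding generic_lift_def mid_angle_reflect
  proof (intro conjI allI impI)
    fix i j
    have "reflect n \<theta> j - - mid_angle \<theta> (int n - 1 - i) = - (\<theta> (int n - j) - mid_angle \<theta> (int n - 1 - i))"
      by (simp add: reflect_def)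
    then show "sin (reflect n \<theta> j - - mid_angle \<theta> (int n - 1 - i)) \<noteq> 0"
      using 1 by (simp only: sin_minus neg_equal_0_iff_equal not_False_eq_True)
    show "sin (- mid_angle \<theta> (int n - 1 - i)) \<noteq> 0" using 1 by simp
    assume ij: "i mod int n \<noteq> j mod int n"
    have "(int n - 1 - j) mod int n \<noteq> (int n - 1 - i) mod int n"
      using ij unfolding mod_eq_dvd_iff by simp
    from 2[OF this] show "sin (- mid_angle \<theta> (int n - 1 - i) - - mid_angle \<theta> (int n - 1 - j)) \<noteq> 0"
      by simp
  qed
qed

lemma ray_count_shift_one: "ray_count n (\<lambda>i. \<theta> (i + 1)) t = ray_count n \<theta> t - 2"
proof -
  define f where "f i = \<lfloor>(t - mid_angle \<theta> (int i)) / pi\<rfloor>" for i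
  have "ray_count n (\<lambda>i. \<theta> (i + 1)) t = (\<Sum>i<n. f (Suc i))"
    by (simp add: ray_count_def f_def mid_angle_def ac_simps)
  also have "\<dots> = (\<Sum>i<Suc n. f i) - f 0" by (simp only: sum.lessThan_Suc_shift add_diff_cancel_left')
  also have "\<dots> = ray_count n \<theta> t + (f n - f 0)" by (simp add: ray_count_def f_def)
  also have "f n = f 0 + (- 2)"
  proof -
    have "(t - mid_angle \<theta> (int n)) / pi = (t - mid_angle \<theta> 0) / pi + of_int (- 2)"
      using mid_angle_mult[of 0 1] by (simp add: field_simps)
    then show ?thesis unfolding f_def by (simp only: floor_add_int of_nat_0)
  qed
  finally show ?thesis by simp
qed

end

lemma ray_count_shift_nat:
  assumes "circle_lift n \<theta>"
  shows "ray_count n (\<lambda>i. \<theta> (i + int a)) t = ray_count n \<theta> t - 2 * int a"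
proof (induction a)
  case (Suc a)
  interpret l: circle_lift n "\<lambda>i. \<theta> (i + int a)" using circle_lift.lift_shift[OF assms] .
  show ?case using l.ray_count_shift_one[of t] Suc by (simp add: ac_simps)
qed simp

context circle_lift begin

text \<open>For a non-integer \<open>x\<close> the floor of \<open>- x\<close> is
  \<open>- \<lfloor>x\<rfloor> - 1\<close>; the \<open>n\<close> corrections add up to
  \<open>- int n\<close>. Genericity makes the quotients non-integers.\<close>

lemma ray_count_reflect:
  assumes "generic_lift n \<theta>"
  shows "ray_count n (reflect n \<theta>) (reflect n \<theta> j) = - ray_count n \<theta> (\<theta> (int n - j)) - int n"
proof -
  define f where "f i = \<lfloor>(\<theta> (int n - j) - mid_angle \<theta> (int i)) / pi\<rfloor>" for i
  have "\<lfloor>(reflect n \<theta> j - mid_angle (reflect n \<theta>) (int i)) / pi\<rfloor> = - f (n - 1 - i) - 1" if "i < n" for i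
  proof -
    let ?y = "\<theta> (int n - j) - mid_angle \<theta> (int (n - 1 - i))"
    have "sin ?y \<noteq> 0" using assms by (simp add: generic_lift_def)
    note b = sin_floor_bounds[OF this]
    have "int (n - 1 - i) = int n - 1 - int i" using that by simp
    then have "reflect n \<theta> j - mid_angle (reflect n \<theta>) (int i) = - ?y" by (simp add: mid_angle_reflect reflect_def)
    moreover have "\<lfloor>- ?y / pi\<rfloor> = - \<lfloor>?y / pi\<rfloor> - 1"
      using b by (intro floor_div_pi_eqI) (auto simp: algebra_simps)
    ultimately show ?thesis by (simp add: f_def)
  qed
  then have "ray_count n (reflect n \<theta>) (reflect n \<theta> j) = (\<Sum>i<n. - f (n - 1 - i) - 1)"
    unfolding ray_count_def by (intro sum.cong) auto
  also have "\<dots> = (\<Sum>i<n. - f i - 1)" 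
    using sum.nat_diff_reindex[of "\<lambda>i. - f i - 1" n] by simp
  also have "\<dots> = - ray_count n \<theta> (\<theta> (int n - j)) - int n"
    by (simp add: ray_count_def f_def sum_subtractf sum_negf)
  finally show ?thesis .
qed

lemma occupied_reflect:
  assumes "generic_lift n \<theta>"
  shows "occupied n (reflect n \<theta>) x \<longleftrightarrow> occupied n \<theta> (- int n - x)"
proof -
  have "(- c - int n) mod (2 * int n) = x mod (2 * int n) \<longleftrightarrow> c mod (2 * int n) = (- int n - x) mod (2 * int n)" for c
  proof -
    have "- c - int n - x = - (c - (- int n - x))" by simp
    then show ?thesis unfolding mod_eq_dvd_iff by (metis dvd_minus_iff)
  qed
  then have "occupied n (reflect n \<theta>) x \<longleftrightarrow> (\<exists>j. ray_count n \<theta> (\<theta> (int n - j)) mod (2 * int n) = (- int n - x) mod (2 * int n))"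
    unfolding occupied_def ray_count_reflect[OF assms] by simp
  also have "\<dots> \<longleftrightarrow> occupied n \<theta> (- int n - x)"
    unfolding occupied_def by (metis diff_diff_eq2 add_diff_cancel_left' diff_add_cancel)
  finally show ?thesis .
qed

text \<open>The ray \<open>mid_angle \<theta> j\<close> lies between the two points, so its floor
  grows. Periodicity brings \<open>j\<close> into the range of summation.\<close>

lemma ray_count_pts_step: "ray_count n \<theta> (\<theta> j) < ray_count n \<theta> (\<theta> (j + 1))"
proof -
  obtain i k where i: "j = int i + int n * k" "i < n"
  proof
    show "j = int (nat (j mod int n)) + int n * (j div int n)" "nat (j mod int n) < n"
      using n3 by (auto simp: nat_less_iff)
  qed
  have j1: "j + 1 = (int i + 1) + int n * k" using i by simp
  have "ray_count n \<theta> (\<theta> (int i)) < ray_count n \<theta> (\<theta> (int i + 1))"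
    unfolding ray_count_def
  proof (rule sum_strict_mono_ex1)
    show "\<forall>x\<in>{..<n}. \<lfloor>(\<theta> (int i) - mid_angle \<theta> (int x)) / pi\<rfloor> \<le> \<lfloor>(\<theta> (int i + 1) - mid_angle \<theta> (int x)) / pi\<rfloor>"
      using step[of "int i"] by (intro ballI floor_mono divide_right_mono) auto
    have "(\<theta> (int i) - mid_angle \<theta> (int i)) / pi < 0"
      using mid_angle_bounds(1)[of "int i"] by (simp add: divide_less_0_iff)
    then have "\<lfloor>(\<theta> (int i) - mid_angle \<theta> (int i)) / pi\<rfloor> < 0" by simp
    moreover have "0 \<le> \<lfloor>(\<theta> (int i + 1) - mid_angle \<theta> (int i)) / pi\<rfloor>"
      using mid_angle_bounds(2)[of "int i"] by simp
    ultimately show "\<exists>a\<in>{..<n}. \<lfloor>(\<theta> (int i) - mid_angle \<theta> (int a)) / pi\<rfloor> < \<lfloor>(\<theta> (int i + 1) - mid_angle \<theta> (int a)) / pi\<rfloor>"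
      using i(2) by (intro bexI[of _ i]) (linarith, simp)
  qed simp
  then show ?thesis unfolding j1 using ray_count_index_shift[of "int i" k] ray_count_index_shift[of "int i + 1" k] i by simp
qed

lemma ray_count_pts_mono: "i < j \<Longrightarrow> ray_count n \<theta> (\<theta> i) < ray_count n \<theta> (\<theta> j)"
proof (induction j rule: int_gr_induct)
  case base then show ?case by (rule ray_count_pts_step)
next
  case (step j) then show ?case using ray_count_pts_step[of j] by simp
qed

text \<open>Counts increase strictly along the points and gain only \<open>2 * n\<close> in a full
  turn. So no region contains two points, and all letters are 0 or 1.\<close>

lemma ray_count_pts_inj:
  assumes "i < n" "j < n"
    "ray_count n \<theta> (\<theta> (int i)) mod (2 * int n) = ray_count n \<theta> (\<theta> (int j)) mod (2 * int n)"
  shows "i = j"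
proof -
  have *: False if "i < j" "j < n"
    "ray_count n \<theta> (\<theta> (int i)) mod (2 * int n) = ray_count n \<theta> (\<theta> (int j)) mod (2 * int n)" for i j
  proof -
    have "ray_count n \<theta> (\<theta> (int i)) < ray_count n \<theta> (\<theta> (int j))" using ray_count_pts_mono that by simp
    moreover have "ray_count n \<theta> (\<theta> (int j)) < ray_count n \<theta> (\<theta> (int i)) + 2 * int n"
      using ray_count_pts_mono[of "int j" "int i + int n * 1"] that by (simp only: ray_count_index_shift) simp
    moreover have "2 * int n dvd ray_count n \<theta> (\<theta> (int j)) - ray_count n \<theta> (\<theta> (int i))"
      using that(3) by (metis mod_eq_dvd_iff)
    ultimately show False using zdvd_not_zless[of "ray_count n \<theta> (\<theta> (int j)) - ray_count n \<theta> (\<theta> (int i))" "2 * int n"]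
      by simp
  qed
  show ?thesis using *[of i j] *[of j i] assms by (metis linorder_neqE_nat)
qed

section \<open>Words as periodic patterns of occupied counts\<close>

lemma occupied_nat: "occupied n \<theta> x \<longleftrightarrow> (\<exists>j<n. ray_count n \<theta> (\<theta> (int j)) mod (2 * int n) = x mod (2 * int n))"
proof
  assume "occupied n \<theta> x"
  then obtain j where j: "ray_count n \<theta> (\<theta> j) mod (2 * int n) = x mod (2 * int n)" by (auto simp: occupied_def)
  have "j = j mod int n + int n * (j div int n)" by simp
  then have "ray_count n \<theta> (\<theta> j) = ray_count n \<theta> (\<theta> (j mod int n)) + 2 * int n * (j div int n)"
    by (metis ray_count_index_shift)
  with j n3 show "\<exists>j<n. ray_count n \<theta> (\<theta> (int j)) mod (2 * int n) = x mod (2 * int n)"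
    by (intro exI[of _ "nat (j mod int n)"]) (auto simp: nat_less_iff)
qed (auto simp: occupied_def)

lemma card_occupied:
  "card {j. j < n \<and> ray_count n \<theta> (\<theta> (int j)) mod (2 * int n) = x mod (2 * int n)} = of_bool (occupied n \<theta> x)"
proof (cases "occupied n \<theta> x")
  case True
  then obtain j where j: "j < n" "ray_count n \<theta> (\<theta> (int j)) mod (2 * int n) = x mod (2 * int n)"
    by (auto simp: occupied_nat)
  then have "{j. j < n \<and> ray_count n \<theta> (\<theta> (int j)) mod (2 * int n) = x mod (2 * int n)} = {j}"
    using ray_count_pts_inj by auto
  then show ?thesis using True by simp
next
  case False
  then have "{j. j < n \<and> ray_count n \<theta> (\<theta> (int j)) mod (2 * int n) = x mod (2 * int n)} = {}"
    by (auto simp: occupied_nat)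
  then show ?thesis using False by simp
qed

lemma length_bracelet_word: "length (bracelet_word n) = 2 * n"
  using n3 by (simp add: bracelet_word_def)

lemma nth_bracelet_word: "i < 2 * n \<Longrightarrow> bracelet_word n ! i = of_bool (bracelet_letter n (int i))"
proof -
  assume i: "i < 2 * n"
  have "int i mod (2 * int n) = int i" using i by simp
  then have l: "bracelet_letter n (int i) \<longleftrightarrow> i = 0 \<or> 2 \<le> i \<and> i \<le> n" by (auto simp: bracelet_letter_def)
  consider "i = 0" | "i = 1" | m where "i = Suc (Suc m)" by (metis One_nat_def nat.exhaust)
  then show ?thesis
    using i n3 unfolding l by cases (auto simp: bracelet_word_def nth_append)
qed

text \<open>Passes from \<open>2 * n\<close> letters, read from an arbitrary starting count, to a
  periodic predicate on the integers.\<close>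

lemma all_index_iff:
  assumes "\<And>x y. x mod (2 * int n) = y mod (2 * int n) \<Longrightarrow> Q x = Q y"
  shows "(\<forall>i<2*n. Q (c + int i)) \<longleftrightarrow> (\<forall>x. Q x)"
proof (intro iffI allI)
  fix x assume *: "\<forall>i<2*n. Q (c + int i)"
  have "Q (c + int (nat ((x - c) mod (2 * int n))))"
    using n3 by (intro *[rule_format]) (auto simp: nat_less_iff)
  moreover have "(c + int (nat ((x - c) mod (2 * int n)))) mod (2 * int n) = x mod (2 * int n)"
    using n3 by (simp add: mod_add_right_eq)
  ultimately show "Q x" using assms by metis
qed simp

text \<open>The disjuncts correspond to the rotations of the word and to those of its reversal. The
  count at angle 0, where the word starts, is absorbed into \<open>k\<close>.\<close>

lemma bracelet_iff:
  assumes "generic_lift n \<theta>" "occupancy_word n pts w"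
  shows "bracelet w = bracelet (bracelet_word n) \<longleftrightarrow>
    (\<exists>k. \<forall>x. occupied n \<theta> x = bracelet_letter n (x - k)) \<or> (\<exists>k. \<forall>x. occupied n \<theta> x = bracelet_letter n (k - x))"
proof -
  let ?b = "bracelet_word n" and ?N = "2 * int n" and ?c = "ray_count n \<theta> 0"
  note lb = length_bracelet_word
  have w: "length w = 2 * n" "\<And>i. i < 2 * n \<Longrightarrow> w ! i = of_bool (occupied n \<theta> (?c + int i))"
    using assms(2) unfolding occupancy_word_iff[OF assms(1)] card_occupied by auto
  have rot: "w = rotate k ?b \<longleftrightarrow> (\<forall>x. occupied n \<theta> x = bracelet_letter n (x - (?c - int k)))" for k
  proof -
    have "rotate k ?b ! i = of_bool (bracelet_letter n (?c + int i - (?c - int k)))" if "i < 2 * n" for i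
    proof -
      have "rotate k ?b ! i = of_bool (bracelet_letter n (int ((k + i) mod (2 * n))))"
        using that n3 by (simp add: nth_rotate lb nth_bracelet_word)
      also have "bracelet_letter n (int ((k + i) mod (2 * n))) = bracelet_letter n (?c + int i - (?c - int k))"
        by (rule bracelet_letter_cong) (simp add: of_nat_mod add.commute)
      finally show ?thesis .
    qed
    then have "w = rotate k ?b \<longleftrightarrow> (\<forall>i<2*n. occupied n \<theta> (?c + int i) = bracelet_letter n (?c + int i - (?c - int k)))"
      using w by (auto simp: list_eq_iff_nth_eq lb)
    also have "\<dots> \<longleftrightarrow> (\<forall>x. occupied n \<theta> x = bracelet_letter n (x - (?c - int k)))"
    proof (rule all_index_iff)
      fix x y assume "x mod (2 * int n) = y mod (2 * int n)"
      then show "(occupied n \<theta> x = bracelet_letter n (x - (?c - int k))) = (occupied n \<theta> y = bracelet_letter n (y - (?c - int k)))"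
        using occupied_cong bracelet_letter_cong mod_diff_cong by metis
    qed
    finally show ?thesis .
  qed
  have rotr: "w = rotate k (rev ?b) \<longleftrightarrow> (\<forall>x. occupied n \<theta> x = bracelet_letter n (?c - 1 - int k - x))" for k
  proof -
    have "rev ?b ! i = of_bool (bracelet_letter n (- 1 - int i))" if "i < 2 * n" for i
    proof -
      have "rev ?b ! i = of_bool (bracelet_letter n (int (2 * n - 1 - i)))"
        using that by (simp add: rev_nth lb nth_bracelet_word)
      \<comment> \<open>Reversal sends position \<open>i\<close> to \<open>2 * n - 1 - i\<close>,
        which is \<open>- 1 - i\<close> modulo the period.\<close>
      also have "int (2 * n - 1 - i) = - 1 - int i + 2 * int n * 1" using that by (simp add: of_nat_diff)
      finally show ?thesis by (simp only: bracelet_letter_add)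
    qed
    then have "rotate k (rev ?b) ! i = of_bool (bracelet_letter n (- 1 - (int k + int i)))" if "i < 2 * n" for i
    proof -
      have "rotate k (rev ?b) ! i = of_bool (bracelet_letter n (- 1 - int ((k + i) mod (2 * n))))"
        using that n3 \<open>\<And>i. i < 2 * n \<Longrightarrow> rev ?b ! i = of_bool (bracelet_letter n (- 1 - int i))\<close>
        by (simp add: nth_rotate lb)
      also have "bracelet_letter n (- 1 - int ((k + i) mod (2 * n))) = bracelet_letter n (- 1 - (int k + int i))"
        by (rule bracelet_letter_cong) (simp add: of_nat_mod mod_diff_right_eq)
      finally show ?thesis .
    qed
    then have "w = rotate k (rev ?b) \<longleftrightarrow> (\<forall>i<2*n. occupied n \<theta> (?c + int i) = bracelet_letter n (- 1 - (int k + int i)))"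
      using w by (auto simp: list_eq_iff_nth_eq lb)
    also have "\<dots> \<longleftrightarrow> (\<forall>i<2*n. occupied n \<theta> (?c + int i) = bracelet_letter n (?c - 1 - int k - (?c + int i)))"
      by (simp add: algebra_simps)
    also have "\<dots> \<longleftrightarrow> (\<forall>x. occupied n \<theta> x = bracelet_letter n (?c - 1 - int k - x))"
    proof (rule all_index_iff)
      fix x y assume "x mod (2 * int n) = y mod (2 * int n)"
      then show "(occupied n \<theta> x = bracelet_letter n (?c - 1 - int k - x)) = (occupied n \<theta> y = bracelet_letter n (?c - 1 - int k - y))"
        using occupied_cong bracelet_letter_cong mod_diff_cong by metis
    qed
    finally show ?thesis .
  qed
  have "bracelet w = bracelet ?b \<longleftrightarrow> (w, ?b) \<in> bracelet_rel"
    unfolding bracelet_def using eq_equiv_class_iff[OF equiv_bracelet_rel] by simp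
  also have "\<dots> \<longleftrightarrow> (?b, w) \<in> bracelet_rel"
    using equiv_bracelet_rel by (meson equivE symD)
  also have "\<dots> \<longleftrightarrow> (\<exists>k. w = rotate k ?b) \<or> (\<exists>k. w = rotate k (rev ?b))"
    by (auto simp: bracelet_rel_def)
  also have "(\<exists>k. w = rotate k ?b) \<longleftrightarrow> (\<exists>k. \<forall>x. occupied n \<theta> x = bracelet_letter n (x - k))"
  proof
    assume "\<exists>k. \<forall>x. occupied n \<theta> x = bracelet_letter n (x - k)"
    then obtain k where k: "\<And>x. occupied n \<theta> x = bracelet_letter n (x - k)" by blast
    \<comment> \<open>\<open>rotate\<close> takes a natural number, so the integer
      \<open>?c - k\<close> is replaced by its residue.\<close>
    have "bracelet_letter n (x - k) = bracelet_letter n (x - (?c - int (nat ((?c - k) mod ?N))))" for x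
    proof (rule bracelet_letter_cong)
      have "(x - (?c - (?c - k) mod ?N)) mod ?N = ((x - ?c) + (?c - k) mod ?N) mod ?N"
        by (simp add: algebra_simps)
      also have "\<dots> = (x - k) mod ?N" by (simp add: mod_add_right_eq)
      finally show "(x - k) mod ?N = (x - (?c - int (nat ((?c - k) mod ?N)))) mod ?N" using n3 by simp
    qed
    with k show "\<exists>k. w = rotate k ?b" unfolding rot by blast
  qed (use rot in blast)
  also have "(\<exists>k. w = rotate k (rev ?b)) \<longleftrightarrow> (\<exists>k. \<forall>x. occupied n \<theta> x = bracelet_letter n (k - x))"
  proof
    assume "\<exists>k. \<forall>x. occupied n \<theta> x = bracelet_letter n (k - x)"
    then obtain k where k: "\<And>x. occupied n \<theta> x = bracelet_letter n (k - x)" by blast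
    have "bracelet_letter n (k - x) = bracelet_letter n (?c - 1 - int (nat ((?c - 1 - k) mod ?N)) - x)" for x
    proof (rule bracelet_letter_cong)
      have "(?c - 1 - (?c - 1 - k) mod ?N - x) mod ?N = ((?c - 1 - x) - (?c - 1 - k) mod ?N) mod ?N"
        by (simp add: algebra_simps)
      also have "\<dots> = (k - x) mod ?N" by (simp add: mod_diff_right_eq)
      finally show "(k - x) mod ?N = (?c - 1 - int (nat ((?c - 1 - k) mod ?N)) - x) mod ?N" using n3 by simp
    qed
    with k show "\<exists>k. w = rotate k (rev ?b)" unfolding rotr by blast
  qed (use rotr in blast)
  finally show ?thesis .
qed

end

section \<open>Rays in the gaps of a good lift\<close>

text \<open>The rays \<open>m + k * pi\<close> up to \<open>m + l * pi\<close> lie between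
  \<open>s\<close> and \<open>t\<close>, and each contributes 1.\<close>

lemma floor_gain:
  assumes "s < m + of_int k * pi" "m + of_int l * pi \<le> t"
  shows "\<lfloor>(s - m) / pi\<rfloor> + (l - k + 1) \<le> \<lfloor>(t - m) / pi\<rfloor>"
proof -
  have "\<lfloor>(s - m) / pi\<rfloor> < k"
    using assms(1) by (simp add: floor_less_iff pos_divide_less_eq)
  moreover have "l \<le> \<lfloor>(t - m) / pi\<rfloor>"
    using assms(2) by (simp add: le_floor_iff pos_le_divide_eq)
  ultimately show ?thesis by simp
qed

lemma sum_step: "j \<le> m \<Longrightarrow> (\<Sum>i<m. if j \<le> i then - 1 else 0 :: int) = int j - int m"
proof (induction m)
  case (Suc m) then show ?case by (cases "j = Suc m") (auto simp: sum.neutral)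
qed simp

context circle_lift begin

text \<open>Write b_j for \<open>\<theta> j - \<theta> 0\<close>. As b_1 is at most b_(n-2), also
  b_(n-1) + b_1 < 2 * pi. Averaging this with b_(n-1) < 2 * b_1 gives the third bound, which keeps
  the last point before the ray opposite to \<open>mid_angle \<theta> 0\<close>. Weights 1/3 and 2/3
  give the fourth one with room to spare.\<close>

lemma good_bounds:
  assumes "good_lift n \<theta>"
  shows "\<theta> (int n - 1) - \<theta> 0 < 2 * (\<theta> 1 - \<theta> 0)"
    "(\<theta> (int n - 1) - \<theta> 0) + (\<theta> (int n - 2) - \<theta> 0) < 2 * pi"
    "\<theta> (int n - 1) - \<theta> 0 < pi + (\<theta> 1 - \<theta> 0) / 2"
    "\<theta> (int n - 1) - \<theta> 1 < pi" "\<theta> (int n - 1) < \<theta> 0 + 2 * pi"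
    "mid_angle \<theta> (int n - 1) = (\<theta> (int n - 1) + \<theta> 0) / 2 + pi"
    "mid_angle \<theta> (int n - 2) = (\<theta> (int n - 1) + \<theta> (int n - 2)) / 2"
proof -
  show 1: "\<theta> (int n - 1) - \<theta> 0 < 2 * (\<theta> 1 - \<theta> 0)"
    and 2: "(\<theta> (int n - 1) - \<theta> 0) + (\<theta> (int n - 2) - \<theta> 0) < 2 * pi"
    using assms by (auto simp: good_lift_def)
  have 3: "\<theta> 1 \<le> \<theta> (int n - 2)" using n3 by (intro mono_le) simp
  show "\<theta> (int n - 1) - \<theta> 0 < pi + (\<theta> 1 - \<theta> 0) / 2" using 1 2 3 by (simp add: field_simps)
  have "y - x < p" if "y < 2 * x" "y + z < 2 * p" "x \<le> z" "0 < p" for x y z p :: real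
    using that by linarith
  from this[OF 1 2] show "\<theta> (int n - 1) - \<theta> 1 < pi" using 3 by simp
  show "\<theta> (int n - 1) < \<theta> 0 + 2 * pi" using mono[of "int n - 1" "0 + int n"] period[of 0] by simp
  show "mid_angle \<theta> (int n - 1) = (\<theta> (int n - 1) + \<theta> 0) / 2 + pi"
    using period[of 0] by (simp add: mid_angle_def field_simps)
  show "mid_angle \<theta> (int n - 2) = (\<theta> (int n - 1) + \<theta> (int n - 2)) / 2"
    by (simp add: mid_angle_def field_simps)
qed

text \<open>\<open>v\<close> tabulates the floors. The far half of line \<open>n - 1\<close> falls
  between points 0 and 1, so for this line only point 0 has the value - 2. Every other line meets
  the arc from point 0 to point \<open>n - 1\<close> only in its near half, just after point
  \<open>i\<close>.\<close>

lemma good_floor_bounds: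
  assumes "good_lift n \<theta>" "i < n" "j < n"
  defines "v \<equiv> (if i = n - 1 then (if j = 0 then - 2 else - 1) else if j \<le> i then - 1 else 0 :: int)"
  shows "of_int v * pi < \<theta> (int j) - mid_angle \<theta> (int i)" "\<theta> (int j) - mid_angle \<theta> (int i) < (of_int v + 1) * pi"
proof -
  note g = good_bounds[OF assms(1)]
  have j1: "\<theta> 1 \<le> \<theta> (int j)" if "j \<noteq> 0" using that by (intro mono_le) simp
  have j0: "\<theta> 0 \<le> \<theta> (int j)" by (intro mono_le) simp
  have jn: "\<theta> (int j) \<le> \<theta> (int n - 1)" using assms(3) by (intro mono_le) simp
  have b1: "\<theta> 0 < \<theta> 1" by (rule mono) simp
  have "of_int v * pi < \<theta> (int j) - mid_angle \<theta> (int i) \<and> \<theta> (int j) - mid_angle \<theta> (int i) < (of_int v + 1) * pi"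
  proof (cases "i = n - 1")
    case True
    then have i: "int i = int n - 1" using n3 by simp
    have "\<theta> 0 < \<theta> (int n - 1)" using n3 by (intro mono) simp
    then show ?thesis unfolding i g(6) v_def using True g b1 j1 jn
      by (cases "j = 0") (auto simp: field_simps)
  next
    case False
    then have i: "int i \<le> int n - 2" using assms(2) by simp
    have m: "mid_angle \<theta> (int i) \<le> mid_angle \<theta> (int n - 2)" using mid_angle_mono[of "int i" "int n - 2"] i
      by (cases "int i = int n - 2") auto
    show ?thesis
    proof (cases "j \<le> i")
      case True
      have "\<theta> (int j) < mid_angle \<theta> (int i)"
        using mono_le[of "int j" "int i"] mid_angle_bounds(1)[of "int i"] True by simp
      moreover have "mid_angle \<theta> (int i) - \<theta> (int j) < pi" using m g(2,7) j0 by (simp add: field_simps)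
      ultimately show ?thesis using True False by (simp add: v_def)
    next
      case j: False
      have "mid_angle \<theta> (int i) < \<theta> (int j)"
        using mono_le[of "int i + 1" "int j"] mid_angle_bounds(2)[of "int i"] j by simp
      moreover have "\<theta> (int j) - mid_angle \<theta> (int i) < pi"
      proof (cases "i = 0")
        case True
        have "mid_angle \<theta> (int i) = (\<theta> 0 + \<theta> 1) / 2" by (simp add: True mid_angle_def)
        then show ?thesis using g(3) jn by (simp add: field_simps)
      next
        case False
        then have "\<theta> 1 \<le> \<theta> (int i)" by (intro mono_le) simp
        then show ?thesis using g(4) jn mid_angle_bounds(1)[of "int i"] by linarith
      qed
      ultimately show ?thesis using j False by (simp add: v_def)
    qed
  qed
  then show "of_int v * pi < \<theta> (int j) - mid_angle \<theta> (int i)" "\<theta> (int j) - mid_angle \<theta> (int i) < (of_int v + 1) * pi"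
    by auto
qed

text \<open>The counts jump by 2 from point 0 to point 1, then by 1 each, and finally by
  \<open>n\<close> to point 0 of the next turn. An excess of the jump over 1 is a number of empty
  regions.\<close>

lemma good_ray_count:
  assumes "good_lift n \<theta>" "j < n"
  shows "ray_count n \<theta> (\<theta> (int j)) = (if j = 0 then - int n - 1 else int j - int n)"
proof -
  obtain m where m: "n = Suc m" using n3 by (cases n) auto
  have "ray_count n \<theta> (\<theta> (int j)) = (\<Sum>i<n. if i = n - 1 then (if j = 0 then - 2 else - 1) else if j \<le> i then - 1 else 0)"
    unfolding ray_count_def using good_floor_bounds[OF assms(1) _ assms(2)]
    by (intro sum.cong refl floor_div_pi_eqI less_imp_le) auto
  also have "\<dots> = (if j = 0 then - 2 else - 1) + (\<Sum>i<m. if j \<le> i then - 1 else 0)"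
    by (simp add: m)
  also have "\<dots> = (if j = 0 then - int n - 1 else int j - int n)"
    using assms(2) sum_step[of j m] by (simp add: m)
  finally show ?thesis .
qed

lemma good_generic:
  assumes "good_lift n \<theta>" and one: "\<And>i. sin (mid_angle \<theta> i) \<noteq> 0"
  shows "generic_lift n \<theta>"
proof -
  note g = good_bounds[OF assms(1)]
  have "sin (\<theta> j - mid_angle \<theta> i) \<noteq> 0" for i j
  proof -
    have "sin (\<theta> (int (nat (j mod int n))) - mid_angle \<theta> (int (nat (i mod int n)))) \<noteq> 0"
      using n3 by (intro sin_neq_0I[OF good_floor_bounds[OF assms(1)]]) (auto simp: nat_less_iff)
    then show ?thesis using n3 by (simp add: sin_mid_angle_mod sin_theta_mod)
  qed
  moreover
  have *: "sin (mid_angle \<theta> b - mid_angle \<theta> a) \<noteq> 0" if "0 \<le> a" "a < b" "b < int n" for a b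
  proof (cases "b = int n - 1")
    case True
    have b1: "\<theta> 0 < \<theta> 1" "\<theta> 1 < \<theta> (int n - 1)" using n3 by (auto intro: mono)
    have mb: "mid_angle \<theta> b = (\<theta> (int n - 1) + \<theta> 0) / 2 + pi" using g(6) True by simp
    show ?thesis
    proof (cases "a = 0")
      case a: True
      have "mid_angle \<theta> a = (\<theta> 0 + \<theta> 1) / 2" by (simp add: a mid_angle_def)
      then show ?thesis unfolding mb using g b1
        by (intro sin_neq_0I[of 1]) (simp_all add: field_simps)
    next
      case False
      have "\<theta> 1 \<le> \<theta> a" using that False by (intro mono_le) simp
      moreover have "mid_angle \<theta> a \<le> mid_angle \<theta> (int n - 2)" using mid_angle_mono[of a "int n - 2"] True that
        by (cases "a = int n - 2") auto
      ultimately show ?thesis unfolding mb using g b1 mid_angle_bounds(1)[of a]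
        by (intro sin_neq_0I[of 0]) (simp_all add: field_simps)
    qed
  next
    case False
    have "mid_angle \<theta> a < mid_angle \<theta> b" using that by (intro mid_angle_mono) simp
    moreover have "\<theta> 0 \<le> \<theta> a" using that by (intro mono_le) simp
    moreover have "mid_angle \<theta> b \<le> mid_angle \<theta> (int n - 2)" using mid_angle_mono[of b "int n - 2"] False that
        by (cases "b = int n - 2") auto
    ultimately show ?thesis using g mid_angle_bounds(1)[of a]
      by (intro sin_neq_0I[of 0]) (simp_all add: field_simps)
  qed
  have "sin (mid_angle \<theta> i - mid_angle \<theta> j) \<noteq> 0" if "i mod int n \<noteq> j mod int n" for i j
  proof -
    have "sin (mid_angle \<theta> (i mod int n) - mid_angle \<theta> (j mod int n)) \<noteq> 0"
      using *[of "i mod int n" "j mod int n"] *[of "j mod int n" "i mod int n"] that n3 sin_minus_iff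
      by (metis linorder_neqE pos_mod_bound pos_mod_sign of_nat_0_less_iff less_le_trans zero_less_numeral)
    then show ?thesis
      using sin_mid_angle_mod[of "mid_angle \<theta> (i mod int n)" j] sin_mid_angle_mod[of "mid_angle \<theta> j" i] sin_minus_iff by metis
  qed
  ultimately show ?thesis using one by (simp add: generic_lift_def)
qed

text \<open>The pattern starts at point 0, whose count is \<open>- int n - 1\<close>.\<close>

lemma good_occupied:
  assumes "good_lift n \<theta>"
  shows "occupied n \<theta> x = bracelet_letter n (x - (- int n - 1))"
proof
  let ?N = "2 * int n"
  assume "occupied n \<theta> x"
  then obtain j where j: "j < n" "ray_count n \<theta> (\<theta> (int j)) mod ?N = x mod ?N" by (auto simp: occupied_nat)
  have "(x - (- int n - 1)) mod ?N = (ray_count n \<theta> (\<theta> (int j)) - (- int n - 1)) mod ?N"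
    using j(2) by (metis mod_diff_left_eq)
  also have "\<dots> = (if j = 0 then 0 else int j + 1)"
    using j(1) by (simp add: good_ray_count[OF assms])
  finally show "bracelet_letter n (x - (- int n - 1))" using j(1) by (auto simp: bracelet_letter_def)
next
  let ?N = "2 * int n"
  assume l: "bracelet_letter n (x - (- int n - 1))"
  define v where "v = (x - (- int n - 1)) mod ?N"
  have v: "(v + (- int n - 1)) mod ?N = x mod ?N"
    unfolding v_def by (metis mod_add_left_eq diff_add_cancel)
  from l have "v = 0 \<or> 2 \<le> v \<and> v \<le> int n" by (auto simp: bracelet_letter_def v_def)
  then show "occupied n \<theta> x"
  proof
    assume "v = 0"
    with v show ?thesis unfolding occupied_nat using good_ray_count[OF assms, of 0] n3
      by (intro exI[of _ 0]) auto
  next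
    assume *: "2 \<le> v \<and> v \<le> int n"
    then have "nat (v - 1) < n" "nat (v - 1) \<noteq> 0" by auto
    moreover from this * have "ray_count n \<theta> (\<theta> (int (nat (v - 1)))) = v + (- int n - 1)"
      using good_ray_count[OF assms, of "nat (v - 1)"] by simp
    ultimately show ?thesis unfolding occupied_nat using v by metis
  qed
qed

text \<open>The counts of points 1 to \<open>n - 1\<close>, relative to point 0, lie between 2 and
  \<open>n\<close>. Failure of an inequality would move the far half of a bisector into an arc
  between two points and make the count grow too much there; equality is excluded by
  genericity.\<close>

lemma good_of_bracelet_letter:
  assumes g: "generic_lift n \<theta>" and l: "\<And>j. bracelet_letter n (ray_count n \<theta> (\<theta> j) - ray_count n \<theta> (\<theta> 0))"
  shows "good_lift n \<theta>"
proof -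
  define f where "f j = ray_count n \<theta> (\<theta> j) - ray_count n \<theta> (\<theta> 0)" for j
  have fn: "f (int n) = 2 * int n" using ray_count_index_shift[of 0 1] by (simp add: f_def)
  have f: "2 \<le> f j \<and> f j \<le> int n" if "0 < j" "j < int n" for j
  proof -
    have "0 < f j" "f j < 2 * int n"
      using ray_count_pts_mono[OF that(1)] ray_count_pts_mono[OF that(2)] fn by (auto simp: f_def)
    then show ?thesis using l[of j] by (auto simp: bracelet_letter_def f_def)
  qed
  have gap: "f (int n - 1) - f 1 \<le> int n - 2" "f (int n - 1) \<le> int n"
    using f[of 1] f[of "int n - 1"] n3 by auto
  have m1: "mid_angle \<theta> (int n - 1) = (\<theta> (int n - 1) + \<theta> 0) / 2 + pi"
    using period[of 0] by (simp add: mid_angle_def field_simps)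
  have m2: "mid_angle \<theta> (int n - 2) = (\<theta> (int n - 1) + \<theta> (int n - 2)) / 2"
    by (simp add: mid_angle_def field_simps)
  have b1: "\<theta> 0 < \<theta> 1" "\<theta> 1 < \<theta> (int n - 1)" using n3 by (auto intro: mono)
  define fl where "fl t i = \<lfloor>(t - mid_angle \<theta> (int i)) / pi\<rfloor>" for t i
  have ray_count: "ray_count n \<theta> t = (\<Sum>i<n. fl t i)" for t by (simp add: ray_count_def fl_def)
  have in1: "int (n - 1) = int n - 1" "int (n - 2) = int n - 2" using n3 by auto
  have between: "\<theta> (int j) < mid_angle \<theta> (int i)" if "j \<le> i" for i j
    using mono_le[of "int j" "int i"] mid_angle_bounds(1)[of "int i"] that by linarith
  have between': "mid_angle \<theta> (int i) < \<theta> (int n - 1)" if "i < n - 1" for i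
    using mono_le[of "int i + 1" "int n - 1"] mid_angle_bounds(2)[of "int i"] that by linarith
  show ?thesis
    unfolding good_lift_def
  proof (rule conjI; rule ccontr)
    assume "\<not> \<theta> (int n - 1) - \<theta> 0 < 2 * (\<theta> 1 - \<theta> 0)"
    moreover have "\<theta> (int n - 1) - \<theta> 0 \<noteq> 2 * (\<theta> 1 - \<theta> 0)"
    proof
      assume "\<theta> (int n - 1) - \<theta> 0 = 2 * (\<theta> 1 - \<theta> 0)"
      then have "\<theta> 1 - mid_angle \<theta> (int n - 1) = - pi" unfolding m1 by (simp add: field_simps)
      then have "sin (\<theta> 1 - mid_angle \<theta> (int n - 1)) = 0" by simp
      with g show False by (auto simp: generic_lift_def)
    qed
    ultimately have big: "2 * (\<theta> 1 - \<theta> 0) < \<theta> (int n - 1) - \<theta> 0" by linarith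
    have "fl (\<theta> 1) i + (if i = 0 then 0 else 1) \<le> fl (\<theta> (int n - 1)) i" if "i < n" for i
    proof -
      have "i = 0 \<or> i = n - 1 \<and> i \<noteq> 0 \<or> i \<noteq> 0 \<and> i < n - 1" using that by arith
      then consider "i = 0" | "i = n - 1" "i \<noteq> 0" | "i \<noteq> 0" "i < n - 1" by blast
      then show ?thesis
      proof cases
        case 1
        then show ?thesis using b1 by (simp add: fl_def floor_mono divide_right_mono)
      next
        case 2
        then show ?thesis using floor_gain[of "\<theta> 1" "mid_angle \<theta> (int i)" "-1" "-1" "\<theta> (int n - 1)"] big b1
          unfolding fl_def in1 2(1) m1 by (simp add: field_simps)
      next
        case 3
        then show ?thesis using floor_gain[of "\<theta> 1" "mid_angle \<theta> (int i)" 0 0 "\<theta> (int n - 1)"]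
            between[of 1 i] between'[of i] by (simp add: fl_def)
      qed
    qed
    then have "(\<Sum>i<n. fl (\<theta> 1) i + (if i = 0 then 0 else 1)) \<le> (\<Sum>i<n. fl (\<theta> (int n - 1)) i)"
      by (intro sum_mono) auto
    moreover have "(\<Sum>i<n. if i = 0 then 0 else 1 :: int) = int n - 1"
    proof -
      obtain m where "n = Suc m" using n3 by (cases n) auto
      then show ?thesis by (simp only: sum.lessThan_Suc_shift) simp
    qed
    ultimately have "int n - 1 \<le> f (int n - 1) - f 1"
      by (simp add: sum.distrib f_def ray_count)
    with gap show False by simp
  next
    assume "\<not> \<theta> (int n - 1) - \<theta> 0 + (\<theta> (int n - 2) - \<theta> 0) < 2 * pi"
    moreover have "\<theta> (int n - 1) - \<theta> 0 + (\<theta> (int n - 2) - \<theta> 0) \<noteq> 2 * pi"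
    proof
      assume "\<theta> (int n - 1) - \<theta> 0 + (\<theta> (int n - 2) - \<theta> 0) = 2 * pi"
      then have "\<theta> 0 - mid_angle \<theta> (int n - 2) = - pi" unfolding m2 by (simp add: field_simps)
      then have "sin (\<theta> 0 - mid_angle \<theta> (int n - 2)) = 0" by simp
      with g show False by (auto simp: generic_lift_def)
    qed
    ultimately have big: "2 * pi < \<theta> (int n - 1) - \<theta> 0 + (\<theta> (int n - 2) - \<theta> 0)" by linarith
    \<comment> \<open>The far half of line \<open>n - 2\<close> now comes after point 0, so this
      line is crossed twice on the way to point \<open>n - 1\<close> and every other line at least
      once. That makes \<open>n + 1\<close> rays, while \<open>gap\<close> allows
      \<open>n\<close>.\<close>
    have "fl (\<theta> 0) i + (if i = n - 2 then 2 else 1) \<le> fl (\<theta> (int n - 1)) i" if "i < n" for i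
    proof -
      have "i = n - 1 \<and> i \<noteq> n - 2 \<or> i = n - 2 \<or> i \<noteq> n - 2 \<and> i < n - 1" using that n3 by arith
      then consider "i = n - 1" "i \<noteq> n - 2" | "i = n - 2" | "i \<noteq> n - 2" "i < n - 1" by blast
      then show ?thesis
      proof cases
        case 1
        then show ?thesis using floor_gain[of "\<theta> 0" "mid_angle \<theta> (int i)" "-1" "-1" "\<theta> (int n - 1)"] b1
          unfolding fl_def in1 1(1) m1 by (simp add: field_simps)
      next
        case 2
        have "\<theta> (int n - 2) < \<theta> (int n - 1)" by (rule mono) simp
        then show ?thesis using floor_gain[of "\<theta> 0" "mid_angle \<theta> (int i)" "-1" 0 "\<theta> (int n - 1)"] big
          unfolding fl_def in1 2 m2 by (simp add: field_simps)
      next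
        case 3
        then show ?thesis using floor_gain[of "\<theta> 0" "mid_angle \<theta> (int i)" 0 0 "\<theta> (int n - 1)"]
            between[of 0 i] between'[of i] by (simp add: fl_def)
      qed
    qed
    then have "(\<Sum>i<n. fl (\<theta> 0) i + (1 + (if i = n - 2 then 1 else 0))) \<le> (\<Sum>i<n. fl (\<theta> (int n - 1)) i)"
      by (intro sum_mono) (force split: if_splits)
    then have "int n + 1 \<le> f (int n - 1)"
      using n3 by (simp add: sum.distrib f_def ray_count)
    with gap show False by simp
  qed
qed

end

text \<open>The point in the region where the pattern starts is relabelled as point 0. Shifting the
  index by \<open>a\<close> lowers all counts by \<open>2 * a\<close>, which merely translates a
  pattern.\<close>

lemma occupied_pattern_iff_good:
  assumes "circle_lift n \<theta>" "generic_lift n \<theta>"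
  shows "(\<exists>k. \<forall>x. occupied n \<theta> x = bracelet_letter n (x - k)) \<longleftrightarrow> (\<exists>a. good_lift n (\<lambda>i. \<theta> (i + int a)))"
proof
  interpret circle_lift n \<theta> by fact
  assume "\<exists>k. \<forall>x. occupied n \<theta> x = bracelet_letter n (x - k)"
  then obtain k where k: "\<And>x. occupied n \<theta> x = bracelet_letter n (x - k)" by blast
  have "occupied n \<theta> k" using k[of k] by (simp add: bracelet_letter_def)
  then obtain a where a: "ray_count n \<theta> (\<theta> (int a)) mod (2 * int n) = k mod (2 * int n)"
    by (auto simp: occupied_nat)
  interpret s: circle_lift n "\<lambda>i. \<theta> (i + int a)" by (rule lift_shift)
  have "good_lift n (\<lambda>i. \<theta> (i + int a))"
  proof (rule s.good_of_bracelet_letter)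
    show "generic_lift n (\<lambda>i. \<theta> (i + int a))" using generic_shift assms(2) by blast
    fix j
    have "bracelet_letter n (ray_count n \<theta> (\<theta> (j + int a)) - k)" using k by (auto simp: occupied_def)
    also have "bracelet_letter n (ray_count n \<theta> (\<theta> (j + int a)) - k) =
        bracelet_letter n (ray_count n \<theta> (\<theta> (j + int a)) - ray_count n \<theta> (\<theta> (int a)))"
      using a by (intro bracelet_letter_cong) (metis mod_diff_right_eq)
    finally show "bracelet_letter n (ray_count n (\<lambda>i. \<theta> (i + int a)) (\<theta> (j + int a)) - ray_count n (\<lambda>i. \<theta> (i + int a)) (\<theta> (0 + int a)))"
      by (simp add: ray_count_shift_nat[OF assms(1)])
  qed
  then show "\<exists>a. good_lift n (\<lambda>i. \<theta> (i + int a))" by blast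
next
  interpret circle_lift n \<theta> by fact
  assume "\<exists>a. good_lift n (\<lambda>i. \<theta> (i + int a))"
  then obtain a where a: "good_lift n (\<lambda>i. \<theta> (i + int a))" by blast
  interpret s: circle_lift n "\<lambda>i. \<theta> (i + int a)" by (rule lift_shift)
  have "occupied n \<theta> x = occupied n (\<lambda>i. \<theta> (i + int a)) (x - 2 * int a)" for x
  proof -
    have "(c - 2 * int a) mod (2 * int n) = (x - 2 * int a) mod (2 * int n) \<longleftrightarrow> c mod (2 * int n) = x mod (2 * int n)" for c
      by (simp add: mod_eq_dvd_iff)
    then have "occupied n (\<lambda>i. \<theta> (i + int a)) (x - 2 * int a) \<longleftrightarrow> (\<exists>j. ray_count n \<theta> (\<theta> (j + int a)) mod (2 * int n) = x mod (2 * int n))"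
      by (simp add: occupied_def ray_count_shift_nat[OF assms(1)])
    then show ?thesis unfolding occupied_def by (metis diff_add_cancel)
  qed
  then have "occupied n \<theta> x = bracelet_letter n (x - (2 * int a - int n - 1))" for x
    using s.good_occupied[OF a] by (simp add: algebra_simps)
  then show "\<exists>k. \<forall>x. occupied n \<theta> x = bracelet_letter n (x - k)" by blast
qed

text \<open>Reflection negates the counts up to a constant, so a reversed pattern is a direct
  pattern of the reflected lift.\<close>

lemma occupied_reflected_pattern_iff_good:
  assumes "circle_lift n \<theta>" "generic_lift n \<theta>"
  shows "(\<exists>k. \<forall>x. occupied n \<theta> x = bracelet_letter n (k - x)) \<longleftrightarrow> (\<exists>a. good_lift n (\<lambda>i. reflect n \<theta> (i + int a)))"
proof -
  interpret circle_lift n \<theta> by fact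
  have "(\<exists>k. \<forall>x. occupied n \<theta> x = bracelet_letter n (k - x)) \<longleftrightarrow> (\<exists>k. \<forall>x. occupied n (reflect n \<theta>) x = bracelet_letter n (x - k))"
  proof
    assume "\<exists>k. \<forall>x. occupied n \<theta> x = bracelet_letter n (k - x)"
    then obtain k where "\<And>x. occupied n \<theta> x = bracelet_letter n (k - x)" by blast
    then have "occupied n (reflect n \<theta>) x = bracelet_letter n (x - (- int n - k))" for x
      by (simp add: occupied_reflect[OF assms(2)] algebra_simps)
    then show "\<exists>k. \<forall>x. occupied n (reflect n \<theta>) x = bracelet_letter n (x - k)" by blast
  next
    assume "\<exists>k. \<forall>x. occupied n (reflect n \<theta>) x = bracelet_letter n (x - k)"
    then obtain k where k: "\<And>x. occupied n (reflect n \<theta>) x = bracelet_letter n (x - k)" by blast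
    have "occupied n \<theta> x = bracelet_letter n ((- int n - k) - x)" for x
      using k[of "- int n - x"] by (simp add: occupied_reflect[OF assms(2)] algebra_simps)
    then show "\<exists>k. \<forall>x. occupied n \<theta> x = bracelet_letter n (k - x)" by blast
  qed
  also have "\<dots> \<longleftrightarrow> (\<exists>a. good_lift n (\<lambda>i. reflect n \<theta> (i + int a)))"
    by (rule occupied_pattern_iff_good[OF lift_reflect generic_reflect[OF assms(2)]])
  finally show ?thesis .
qed

section \<open>From sets of points to lifts\<close>

definition extend_lift :: "nat \<Rightarrow> (nat \<Rightarrow> real) \<Rightarrow> int \<Rightarrow> real" where
  "extend_lift n t i = t (nat (i mod int n)) + 2 * pi * of_int (i div int n)"

lemma extend_nat: "j < n \<Longrightarrow> extend_lift n t (int j) = t j"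
  by (simp add: extend_lift_def)

lemma lift_extend:
  assumes "3 \<le> n" "\<And>j. j + 1 < n \<Longrightarrow> t j < t (j + 1)" "t (n - 1) < t 0 + 2 * pi"
  shows "circle_lift n (extend_lift n t)"
proof
  show "3 \<le> n" by fact
  fix i :: int
  show "extend_lift n t (i + int n) = extend_lift n t i + 2 * pi"
    using assms(1) by (simp add: extend_lift_def algebra_simps)
  define r where "r = nat (i mod int n)"
  have r: "int r = i mod int n" "r < n" using assms(1) by (auto simp: r_def nat_less_iff)
  have i: "i = int r + int n * (i div int n)" using r by simp
  show "extend_lift n t i < extend_lift n t (i + 1)"
  proof (cases "r + 1 < n")
    case True
    have eq: "i + 1 = int n * (i div int n) + int (r + 1)" using i by simp
    have "(i + 1) mod int n = int (r + 1)" "(i + 1) div int n = i div int n"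
      using True by (simp_all add: int_mod_pos_eq[OF eq] int_div_pos_eq[OF eq])
    then have "nat ((i + 1) mod int n) = r + 1" "(i + 1) div int n = i div int n" by simp_all
    then show ?thesis using assms(2)[OF True] unfolding extend_lift_def r_def[symmetric] by simp
  next
    case False
    then have rn: "r = n - 1" using r by simp
    have eq: "i + 1 = int n * (i div int n + 1) + 0" using i rn assms(1) by (simp add: algebra_simps)
    have "(i + 1) mod int n = 0" "(i + 1) div int n = i div int n + 1"
      using assms(1) by (simp_all add: int_mod_pos_eq[OF eq] int_div_pos_eq[OF eq])
    then show ?thesis using assms(3) rn by (simp add: extend_lift_def r_def algebra_simps)
  qed
qed

lemma bisector_cong:
  assumes "\<And>j. j < n \<Longrightarrow> P j = Q j" "i < n"
  shows "bisector n P i = bisector n Q i"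
proof -
  have "(i + 1) mod n < n" using assms(2) by simp
  then show ?thesis using assms by (simp add: bisector_def)
qed

lemma generic_cong:
  assumes "\<And>j. j < n \<Longrightarrow> P j = Q j"
  shows "generic n P = generic n Q"
proof -
  have "inj_on (bisector n P) {..<n} = inj_on (bisector n Q) {..<n}"
    by (rule inj_on_cong) (use bisector_cong[OF assms] in auto)
  then show ?thesis unfolding generic_def using assms bisector_cong[OF assms] by simp
qed

lemma occupancy_word_cong:
  assumes "\<And>j. j < n \<Longrightarrow> P j = Q j"
  shows "occupancy_word n P w = occupancy_word n Q w"
proof -
  have "regions n P = regions n Q"
    unfolding regions_def using bisector_cong[of n P Q, OF assms] by (intro arg_cong[where f = "\<lambda>U. components (- U)"]) auto
  then have "region_numbering n P = region_numbering n Q" by (simp add: region_numbering_def fun_eq_iff)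
  moreover have "{j. j < n \<and> P j \<in> A} = {j. j < n \<and> Q j \<in> A}" for A using assms by auto
  ultimately show ?thesis by (simp add: occupancy_word_def)
qed

context circle_lift begin

lemma range_pts: "pts ` {..<n} = range (\<lambda>i. cis (\<theta> i))"
proof
  show "range (\<lambda>i. cis (\<theta> i)) \<subseteq> pts ` {..<n}"
  proof
    fix z assume "z \<in> range (\<lambda>i. cis (\<theta> i))"
    then obtain i where z: "z = cis (\<theta> i)" by blast
    have "z = pts (nat (i mod int n))" using n3 by (simp add: z cis_mod)
    moreover have "nat (i mod int n) < n" using n3 by (simp add: nat_less_iff)
    ultimately show "z \<in> pts ` {..<n}" by blast
  qed
qed auto

lemma ccw_ordered_pts: "ccw_ordered n pts"
  unfolding ccw_ordered_def
proof (intro exI conjI allI impI)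
  show "strict_mono_on {..<n} (\<lambda>j. \<theta> (int j))" by (auto simp: strict_mono_on_def intro: mono)
  show "\<theta> (int (n - 1)) < \<theta> (int 0) + 2 * pi"
    using mono[of "int (n - 1)" "0 + int n"] period[of 0] n3 by simp
qed simp

lemma range_reflect: "range (\<lambda>i. cis (reflect n \<theta> i)) = cnj ` range (\<lambda>i. cis (\<theta> i))"
proof -
  have "range (\<lambda>i. cis (reflect n \<theta> i)) = (\<lambda>i. cnj (cis (\<theta> i))) ` range (\<lambda>i. int n - i)"
    by (simp only: reflect_def cis_cnj image_image)
  also have "range (\<lambda>i. int n - i) = UNIV" by (metis surj_def diff_diff_eq2 add_diff_cancel_left')
  finally show ?thesis by (simp add: image_image)
qed

lemma range_shift: "range (\<lambda>i. cis (\<theta> (i + a))) = range (\<lambda>i. cis (\<theta> i))"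
proof -
  have "range (\<lambda>i. cis (\<theta> (i + a))) = (\<lambda>i. cis (\<theta> i)) ` range (\<lambda>i. i + a)" by (simp only: image_image)
  also have "range (\<lambda>i. i + a) = UNIV" by (metis surj_def diff_add_cancel)
  finally show ?thesis .
qed

end

text \<open>The angles provided by \<open>ccw_ordered\<close> extend periodically to a lift. A
  labelling is prescribed only below \<open>n\<close>, hence the passage from \<open>P\<close> to
  \<open>pts\<close> by congruence.\<close>

lemma yields_bracelet_iff_lift:
  assumes "3 \<le> n"
  shows "yields_bracelet n S (bracelet (bracelet_word n)) \<longleftrightarrow>
    (\<exists>\<theta>. circle_lift n \<theta> \<and> generic_lift n \<theta> \<and> S = range (\<lambda>i. cis (\<theta> i)) \<and>
      ((\<exists>k. \<forall>x. occupied n \<theta> x = bracelet_letter n (x - k)) \<or> (\<exists>k. \<forall>x. occupied n \<theta> x = bracelet_letter n (k - x))))"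
proof
  assume "yields_bracelet n S (bracelet (bracelet_word n))"
  then obtain P w where P: "P ` {..<n} = S" "ccw_ordered n P" "generic n P" "occupancy_word n P w"
      "bracelet w = bracelet (bracelet_word n)"
    by (auto simp: yields_bracelet_def)
  then obtain t where t: "strict_mono_on {..<n} t" "t (n - 1) < t 0 + 2 * pi" "\<And>i. i < n \<Longrightarrow> P i = cis (t i)"
    by (auto simp: ccw_ordered_def)
  define \<theta> where "\<theta> = extend_lift n t"
  interpret circle_lift n \<theta>
    unfolding \<theta>_def using assms t(1,2) by (intro lift_extend) (auto simp: strict_mono_on_def)
  have eq: "P j = pts j" if "j < n" for j using t(3)[OF that] that by (simp add: \<theta>_def extend_nat)
  have generic_lift: "generic_lift n \<theta>" using P(3) generic_cong[OF eq] generic_iff by simp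
  moreover have "S = range (\<lambda>i. cis (\<theta> i))" using P(1) eq range_pts by simp
  moreover have "occupancy_word n pts w" using P(4) occupancy_word_cong[OF eq] by simp
  then have "(\<exists>k. \<forall>x. occupied n \<theta> x = bracelet_letter n (x - k)) \<or> (\<exists>k. \<forall>x. occupied n \<theta> x = bracelet_letter n (k - x))"
    using bracelet_iff[OF generic_lift] P(5) by blast
  ultimately show "\<exists>\<theta>. circle_lift n \<theta> \<and> generic_lift n \<theta> \<and> S = range (\<lambda>i. cis (\<theta> i)) \<and>
      ((\<exists>k. \<forall>x. occupied n \<theta> x = bracelet_letter n (x - k)) \<or> (\<exists>k. \<forall>x. occupied n \<theta> x = bracelet_letter n (k - x)))"
    using circle_lift_axioms by blast
next
  assume "\<exists>\<theta>. circle_lift n \<theta> \<and> generic_lift n \<theta> \<and> S = range (\<lambda>i. cis (\<theta> i)) \<and>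
      ((\<exists>k. \<forall>x. occupied n \<theta> x = bracelet_letter n (x - k)) \<or> (\<exists>k. \<forall>x. occupied n \<theta> x = bracelet_letter n (k - x)))"
  then obtain \<theta> where l: "circle_lift n \<theta>" and generic_lift: "generic_lift n \<theta>" and S: "S = range (\<lambda>i. cis (\<theta> i))"
    and pat: "(\<exists>k. \<forall>x. occupied n \<theta> x = bracelet_letter n (x - k)) \<or> (\<exists>k. \<forall>x. occupied n \<theta> x = bracelet_letter n (k - x))"
    by blast
  interpret circle_lift n \<theta> by fact
  obtain w where w: "occupancy_word n pts w" using occupancy_word_iff[OF generic_lift] by blast
  have "bracelet w = bracelet (bracelet_word n)" using bracelet_iff[OF generic_lift w] pat by blast
  then show "yields_bracelet n S (bracelet (bracelet_word n))"
    unfolding yields_bracelet_def using S range_pts ccw_ordered_pts generic_iff generic_lift w by blast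
qed

text \<open>Goodness yields all of general position except the condition on 1, which is kept; the
  reversed pattern is expressed by conjugating \<open>S\<close>.\<close>

lemma yields_bracelet_iff_good:
  assumes "3 \<le> n"
  shows "yields_bracelet n S (bracelet (bracelet_word n)) \<longleftrightarrow>
    (\<exists>\<theta>. circle_lift n \<theta> \<and> good_lift n \<theta> \<and> (\<forall>i. sin (mid_angle \<theta> i) \<noteq> 0) \<and>
      (S = range (\<lambda>i. cis (\<theta> i)) \<or> S = cnj ` range (\<lambda>i. cis (\<theta> i))))"
  unfolding yields_bracelet_iff_lift[OF assms]
proof
  assume "\<exists>\<theta>. circle_lift n \<theta> \<and> generic_lift n \<theta> \<and> S = range (\<lambda>i. cis (\<theta> i)) \<and>
      ((\<exists>k. \<forall>x. occupied n \<theta> x = bracelet_letter n (x - k)) \<or> (\<exists>k. \<forall>x. occupied n \<theta> x = bracelet_letter n (k - x)))"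
  then obtain \<theta> where l: "circle_lift n \<theta>" and generic_lift: "generic_lift n \<theta>" and S: "S = range (\<lambda>i. cis (\<theta> i))"
    and pat: "(\<exists>k. \<forall>x. occupied n \<theta> x = bracelet_letter n (x - k)) \<or> (\<exists>k. \<forall>x. occupied n \<theta> x = bracelet_letter n (k - x))"
    by blast
  interpret circle_lift n \<theta> by fact
  interpret r: circle_lift n "reflect n \<theta>" by (rule lift_reflect)
  from pat consider a where "good_lift n (\<lambda>i. \<theta> (i + int a))" | a where "good_lift n (\<lambda>i. reflect n \<theta> (i + int a))"
    using occupied_pattern_iff_good[OF l generic_lift] occupied_reflected_pattern_iff_good[OF l generic_lift] by blast
  then show "\<exists>\<theta>. circle_lift n \<theta> \<and> good_lift n \<theta> \<and> (\<forall>i. sin (mid_angle \<theta> i) \<noteq> 0) \<and>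
      (S = range (\<lambda>i. cis (\<theta> i)) \<or> S = cnj ` range (\<lambda>i. cis (\<theta> i)))"
  proof cases
    case 1
    moreover have "\<forall>i. sin (mid_angle (\<lambda>i. \<theta> (i + int a)) i) \<noteq> 0"
      using generic_shift[OF generic_lift] by (simp add: generic_lift_def)
    ultimately show ?thesis using lift_shift[of "int a"] range_shift[of "int a"] S
      by (intro exI[of _ "\<lambda>i. \<theta> (i + int a)"]) simp
  next
    case 2
    moreover have "\<forall>i. sin (mid_angle (\<lambda>i. reflect n \<theta> (i + int a)) i) \<noteq> 0"
      using r.generic_shift[OF generic_reflect[OF generic_lift]] by (simp add: generic_lift_def)
    moreover have "S = cnj ` range (\<lambda>i. cis (reflect n \<theta> (i + int a)))"
      unfolding r.range_shift range_reflect S by (simp add: image_image)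
    ultimately show ?thesis using r.lift_shift[of "int a"]
      by (intro exI[of _ "\<lambda>i. reflect n \<theta> (i + int a)"]) simp
  qed
next
  assume "\<exists>\<theta>. circle_lift n \<theta> \<and> good_lift n \<theta> \<and> (\<forall>i. sin (mid_angle \<theta> i) \<noteq> 0) \<and>
      (S = range (\<lambda>i. cis (\<theta> i)) \<or> S = cnj ` range (\<lambda>i. cis (\<theta> i)))"
  then obtain \<theta> where l: "circle_lift n \<theta>" and good_lift: "good_lift n \<theta>" and one: "\<And>i. sin (mid_angle \<theta> i) \<noteq> 0"
    and S: "S = range (\<lambda>i. cis (\<theta> i)) \<or> S = cnj ` range (\<lambda>i. cis (\<theta> i))" by blast
  interpret circle_lift n \<theta> by fact
  note generic_lift = good_generic[OF good_lift one]
  from S show "\<exists>\<theta>. circle_lift n \<theta> \<and> generic_lift n \<theta> \<and> S = range (\<lambda>i. cis (\<theta> i)) \<and>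
      ((\<exists>k. \<forall>x. occupied n \<theta> x = bracelet_letter n (x - k)) \<or> (\<exists>k. \<forall>x. occupied n \<theta> x = bracelet_letter n (k - x)))"
  proof
    assume "S = range (\<lambda>i. cis (\<theta> i))"
    then show ?thesis using l generic_lift good_occupied[OF good_lift] by blast
  next
    assume "S = cnj ` range (\<lambda>i. cis (\<theta> i))"
    moreover have "\<exists>a. good_lift n (\<lambda>i. reflect n (reflect n \<theta>) (i + int a))"
      using good_lift by (intro exI[of _ 0]) simp
    then have "\<exists>k. \<forall>x. occupied n (reflect n \<theta>) x = bracelet_letter n (k - x)"
      using occupied_reflected_pattern_iff_good[OF lift_reflect generic_reflect[OF generic_lift]] by blast
    ultimately show ?thesis using lift_reflect generic_reflect[OF generic_lift] range_reflect by blast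
  qed
qed

text \<open>A measurable form of being a good lift, in the angles measured from point 0. The last
  clause says that 1 lies on no bisector: two points of the unit circle are equally far from 1
  exactly if their real parts agree.\<close>

definition good_pts :: "nat \<Rightarrow> (nat \<Rightarrow> complex) \<Rightarrow> bool" where
  "good_pts n z \<longleftrightarrow> (\<forall>i<n. cmod (z i) = 1) \<and>
     (\<forall>j. j + 1 < n \<longrightarrow> Arg2pi (z j / z 0) < Arg2pi (z (j + 1) / z 0)) \<and>
     Arg2pi (z (n - 1) / z 0) < 2 * Arg2pi (z 1 / z 0) \<and>
     Arg2pi (z (n - 1) / z 0) + Arg2pi (z (n - 2) / z 0) < 2 * pi \<and>
     (\<forall>i<n. Re (z i) \<noteq> Re (z ((i + 1) mod n)))"

lemma Arg2pi_cis: "0 \<le> t \<Longrightarrow> t < 2 * pi \<Longrightarrow> Arg2pi (cis t) = t"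
  using Arg2pi_exp[of "\<i> * of_real t"] by (simp add: cis_conv_exp)

lemma cis_Arg2pi: "cmod z = 1 \<Longrightarrow> cis (Arg2pi z) = z"
  using complex_norm_eq_1_exp[of z] by (simp add: cis_conv_exp)

context circle_lift begin

lemma cos_neq_iff: "cos (\<theta> i) \<noteq> cos (\<theta> (i + 1)) \<longleftrightarrow> sin (mid_angle \<theta> i) \<noteq> 0"
proof -
  have "\<theta> (i + 1) < \<theta> i + 2 * pi" using mono[of "i + 1" "i + int n"] period[of i] n3 by simp
  then have "sin ((\<theta> (i + 1) - \<theta> i) / 2) > 0" using step[of i] by (intro sin_gt_zero) auto
  moreover have "cos (\<theta> i) - cos (\<theta> (i + 1)) = 2 * sin (mid_angle \<theta> i) * sin ((\<theta> (i + 1) - \<theta> i) / 2)"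
    by (simp add: cos_diff_cos mid_angle_def)
  ultimately show ?thesis by auto
qed

lemma pts_Suc_mod: "pts ((i + 1) mod n) = cis (\<theta> (int i + 1))"
  by (metis cis_mod of_nat_1 of_nat_add of_nat_mod)

end

lemma good_pts_iff:
  assumes n: "3 \<le> n"
  shows "good_pts n z \<longleftrightarrow>
    (\<exists>\<theta>. circle_lift n \<theta> \<and> good_lift n \<theta> \<and> (\<forall>i. sin (mid_angle \<theta> i) \<noteq> 0) \<and> (\<forall>i<n. z i = cis (\<theta> (int i))))"
proof
  assume g: "good_pts n z"
  \<comment> \<open>Angles measured from point 0 lie in one turn; adding the argument of point 0
    makes them arguments of the points themselves.\<close>
  define t where "t j = Arg2pi (z 0) + Arg2pi (z j / z 0)" for j
  have c: "cmod (z i) = 1" if "i < n" for i using g that by (auto simp: good_pts_def)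
  have c0: "cmod (z 0) = 1" using c n by simp
  then have z0: "z 0 \<noteq> 0" by auto
  have t0: "t 0 = Arg2pi (z 0)" using z0 Arg2pi_of_real[of 1] by (simp add: t_def)
  have z: "z j = cis (t j)" if "j < n" for j
    unfolding t_def cis_mult[symmetric] using c[OF that] c0 z0 by (simp add: cis_Arg2pi norm_divide)
  interpret circle_lift n "extend_lift n t"
    using n g Arg2pi[of "z (n - 1) / z 0"] t0
    by (intro lift_extend) (auto simp: t_def good_pts_def)
  have e: "extend_lift n t (int j) = t j" if "j < n" for j using that by (rule extend_nat)
  have "good_lift n (extend_lift n t)"
  proof -
    have "extend_lift n t (int n - 1) = t (n - 1)" "extend_lift n t (int n - 2) = t (n - 2)"
      "extend_lift n t 0 = t 0" "extend_lift n t 1 = t 1"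
      using e[of "n - 1"] e[of "n - 2"] e[of 0] e[of 1] n by (simp_all add: of_nat_diff)
    then show ?thesis unfolding good_lift_def using g t0 by (simp add: t_def good_pts_def)
  qed
  moreover have "sin (mid_angle (extend_lift n t) i) \<noteq> 0" for i
  proof -
    define j where "j = nat (i mod int n)"
    have j: "j < n" "int j = i mod int n" using n by (auto simp: j_def nat_less_iff)
    have "(j + 1) mod n < n" using n by simp
    then have "z ((j + 1) mod n) = cis (extend_lift n t (int j + 1))"
      using z[of "(j + 1) mod n"] e[of "(j + 1) mod n"] pts_Suc_mod[of j] by metis
    moreover have "z j = cis (extend_lift n t (int j))" using z[OF j(1)] e[OF j(1)] by simp
    moreover have "Re (z j) \<noteq> Re (z ((j + 1) mod n))" using g j(1) by (simp add: good_pts_def)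
    ultimately have "Re (cis (extend_lift n t (int j))) \<noteq> Re (cis (extend_lift n t (int j + 1)))"
      by metis
    then have "sin (mid_angle (extend_lift n t) (int j)) \<noteq> 0" using cos_neq_iff[of "int j"] by simp
    then show ?thesis using sin_mid_angle_mod[of 0 i] by (simp add: j)
  qed
  moreover have "\<forall>i<n. z i = cis (extend_lift n t (int i))" using z e by simp
  ultimately show "\<exists>\<theta>. circle_lift n \<theta> \<and> good_lift n \<theta> \<and> (\<forall>i. sin (mid_angle \<theta> i) \<noteq> 0) \<and> (\<forall>i<n. z i = cis (\<theta> (int i)))"
    using circle_lift_axioms by blast
next
  assume "\<exists>\<theta>. circle_lift n \<theta> \<and> good_lift n \<theta> \<and> (\<forall>i. sin (mid_angle \<theta> i) \<noteq> 0) \<and> (\<forall>i<n. z i = cis (\<theta> (int i)))"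
  then obtain \<theta> where "circle_lift n \<theta>" and good_lift: "good_lift n \<theta>" and one: "\<And>i. sin (mid_angle \<theta> i) \<noteq> 0"
    and z: "\<And>i. i < n \<Longrightarrow> z i = cis (\<theta> (int i))" by blast
  interpret circle_lift n \<theta> by fact
  have arg: "Arg2pi (z j / z 0) = \<theta> (int j) - \<theta> 0" if "j < n" for j
  proof -
    have "\<theta> 0 \<le> \<theta> (int j)" by (intro mono_le) simp
    moreover have "\<theta> (int j) < \<theta> 0 + 2 * pi" using mono[of "int j" "0 + int n"] period[of 0] that by simp
    moreover have "z j / z 0 = cis (\<theta> (int j) - \<theta> 0)" using z[OF that] z[of 0] n by (simp add: cis_divide)
    ultimately show ?thesis by (simp add: Arg2pi_cis)
  qed
  have in1: "int (n - 1) = int n - 1" "int (n - 2) = int n - 2" using n by auto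
  have "Arg2pi (z j / z 0) < Arg2pi (z (j + 1) / z 0)" if "j + 1 < n" for j
    using arg[of j] arg[of "j + 1"] that step[of "int j"] by (simp add: add.commute)
  moreover have "Re (z i) \<noteq> Re (z ((i + 1) mod n))" if "i < n" for i
  proof -
    have "(i + 1) mod n < n" using n by simp
    then have "z ((i + 1) mod n) = cis (\<theta> (int i + 1))" using z pts_Suc_mod[of i] by simp
    then show ?thesis using z[OF that] cos_neq_iff[of "int i"] one by simp
  qed
  moreover have "Arg2pi (z (n - 1) / z 0) < 2 * Arg2pi (z 1 / z 0)"
    "Arg2pi (z (n - 1) / z 0) + Arg2pi (z (n - 2) / z 0) < 2 * pi"
    using arg[of 1] arg[of "n - 1"] arg[of "n - 2"] good_lift n by (simp_all add: in1 good_lift_def)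
  moreover have "cmod (z i) = 1" if "i < n" for i using z[OF that] by simp
  ultimately show "good_pts n z" unfolding good_pts_def by blast
qed

lemma permutes_of_same_image:
  fixes n :: nat
  assumes "x ` {..<n} = p ` {..<n}" "inj_on p {..<n}"
  obtains \<sigma> where "\<sigma> permutes {..<n}" "\<And>i. i < n \<Longrightarrow> x (\<sigma> i) = p i"
proof -
  have "card (x ` {..<n}) = card {..<n}" using assms by (simp add: card_image)
  then have inj: "inj_on x {..<n}" using eq_card_imp_inj_on[of "{..<n}" x] by simp
  define \<sigma> where "\<sigma> i = (if i < n then inv_into {..<n} x (p i) else i)" for i
  have x: "x (\<sigma> i) = p i" "\<sigma> i < n" if "i < n" for i
  proof -
    have "p i \<in> x ` {..<n}" using assms(1) that by blast
    then show "x (\<sigma> i) = p i" "\<sigma> i < n"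
      using that f_inv_into_f[of "p i" x "{..<n}"] inv_into_into[of "p i" x "{..<n}"] by (auto simp: \<sigma>_def)
  qed
  have "inj_on \<sigma> {..<n}" using x assms(2) by (metis (no_types, lifting) inj_on_def lessThan_iff)
  then have "bij_betw \<sigma> {..<n} {..<n}"
    unfolding bij_betw_def using x(2) endo_inj_surj[of "{..<n}" \<sigma>] by auto
  then have "\<sigma> permutes {..<n}" by (rule bij_imp_permutes) (simp add: \<sigma>_def)
  then show ?thesis using that x by blast
qed

lemma good_pts_imp_range:
  assumes "3 \<le> n" "good_pts n (x \<circ> \<sigma>)" "\<sigma> permutes {..<n}"
  obtains \<theta> where "circle_lift n \<theta>" "good_lift n \<theta>" "\<And>i. sin (mid_angle \<theta> i) \<noteq> 0" "x ` {..<n} = range (\<lambda>i. cis (\<theta> i))"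
    "\<And>i. i < n \<Longrightarrow> x (\<sigma> i) = cis (\<theta> (int i))"
proof -
  obtain \<theta> where \<theta>: "circle_lift n \<theta>" "good_lift n \<theta>" "\<And>i. sin (mid_angle \<theta> i) \<noteq> 0" "\<And>i. i < n \<Longrightarrow> x (\<sigma> i) = cis (\<theta> (int i))"
    using assms good_pts_iff by auto
  have "x ` {..<n} = (\<lambda>i. x (\<sigma> i)) ` {..<n}" using permutes_image[OF assms(3)] by (metis image_image)
  also have "\<dots> = range (\<lambda>i. cis (\<theta> i))" using \<theta>(4) circle_lift.range_pts[OF \<theta>(1)] by simp
  finally show ?thesis using that \<theta> by blast
qed

text \<open>The indices of the given points are unrelated to their cyclic order;
  \<open>\<sigma>\<close> recovers the labelling that starts at the isolated point, and
  \<open>cnj\<close> accounts for the other orientation.\<close>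

lemma yields_bracelet_iff_permutes:
  assumes n: "3 \<le> n"
  shows "yields_bracelet n (x ` {..<n}) (bracelet (bracelet_word n)) \<longleftrightarrow>
    (\<exists>\<sigma>. \<sigma> permutes {..<n} \<and> (good_pts n (x \<circ> \<sigma>) \<or> good_pts n (cnj \<circ> x \<circ> \<sigma>)))"
proof -
  have perm: "(\<exists>\<sigma>. \<sigma> permutes {..<n} \<and> good_pts n (x \<circ> \<sigma>)) \<longleftrightarrow>
    (\<exists>\<theta>. circle_lift n \<theta> \<and> good_lift n \<theta> \<and> (\<forall>i. sin (mid_angle \<theta> i) \<noteq> 0) \<and> x ` {..<n} = range (\<lambda>i. cis (\<theta> i)))" for x
  proof
    assume "\<exists>\<sigma>. \<sigma> permutes {..<n} \<and> good_pts n (x \<circ> \<sigma>)"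
    then show "\<exists>\<theta>. circle_lift n \<theta> \<and> good_lift n \<theta> \<and> (\<forall>i. sin (mid_angle \<theta> i) \<noteq> 0) \<and> x ` {..<n} = range (\<lambda>i. cis (\<theta> i))"
      using good_pts_imp_range[OF n] by metis
  next
    assume "\<exists>\<theta>. circle_lift n \<theta> \<and> good_lift n \<theta> \<and> (\<forall>i. sin (mid_angle \<theta> i) \<noteq> 0) \<and> x ` {..<n} = range (\<lambda>i. cis (\<theta> i))"
    then obtain \<theta> where \<theta>: "circle_lift n \<theta>" "good_lift n \<theta>" "\<And>i. sin (mid_angle \<theta> i) \<noteq> 0" "x ` {..<n} = range (\<lambda>i. cis (\<theta> i))"
      by blast
    interpret circle_lift n \<theta> by fact
    have "inj_on pts {..<n}" by (auto simp: inj_on_def cis_eq_iff)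
    then obtain \<sigma> where "\<sigma> permutes {..<n}" "\<And>i. i < n \<Longrightarrow> x (\<sigma> i) = pts i"
      using permutes_of_same_image[of x n pts] \<theta>(4) range_pts by auto
    then show "\<exists>\<sigma>. \<sigma> permutes {..<n} \<and> good_pts n (x \<circ> \<sigma>)"
      using good_pts_iff[OF n] \<theta> by auto
  qed
  have cnj: "x ` {..<n} = cnj ` A \<longleftrightarrow> (cnj \<circ> x) ` {..<n} = A" for A
  proof
    assume "x ` {..<n} = cnj ` A"
    then have "cnj ` x ` {..<n} = cnj ` cnj ` A" by simp
    then show "(cnj \<circ> x) ` {..<n} = A" by (simp add: image_image)
  next
    assume "(cnj \<circ> x) ` {..<n} = A"
    then have "cnj ` (cnj \<circ> x) ` {..<n} = cnj ` A" by simp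
    then show "x ` {..<n} = cnj ` A" by (simp add: image_image)
  qed
  show ?thesis
    unfolding yields_bracelet_iff_good[OF n] cnj conj_disj_distribL ex_disj_distrib perm
    by (simp only: conj_assoc)
qed

text \<open>The labelling and the orientation are determined by the points: the largest gap precedes
  \<open>\<theta> 0\<close> and the second largest follows it.\<close>

lemma lift_same_range:
  assumes "circle_lift n \<theta>" "circle_lift n \<eta>" "range (\<lambda>i. cis (\<theta> i)) = range (\<lambda>i. cis (\<eta> i))"
  obtains k where "\<And>i. \<eta> i = \<theta> (i + k)"
proof -
  interpret t: circle_lift n \<theta> by fact
  interpret e: circle_lift n \<eta> by fact
  have R: "\<exists>j. \<beta> i = \<alpha> j" if "circle_lift n \<alpha>" "range (\<lambda>i. cis (\<alpha> i)) = range (\<lambda>i. cis (\<beta> i))" for \<alpha> \<beta> i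
  proof -
    have "cis (\<beta> i) \<in> range (\<lambda>i. cis (\<alpha> i))" using that by blast
    then obtain j where "cis (\<beta> i) = cis (\<alpha> j)" by blast
    then obtain k where "\<beta> i = \<alpha> j + 2 * pi * of_int k" using cis_eq_imp by blast
    then show ?thesis using circle_lift.period_mult[OF that(1)] by metis
  qed
  \<comment> \<open>\<open>f\<close> is an order-preserving bijection of the integers and hence a
    translation: no value fits between \<open>f i\<close> and \<open>f (i + 1)\<close>.\<close>
  obtain f where f: "\<And>i. \<eta> i = \<theta> (f i)" using R[OF assms(1,3)] by metis
  have f_mono: "f i < f j \<longleftrightarrow> i < j" for i j using f t.mono_iff e.mono_iff by metis
  have surj: "\<exists>j. f j = i" for i
  proof -
    obtain j where "\<theta> i = \<eta> j" using R[OF assms(2) assms(3)[symmetric]] by blast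
    then have "\<theta> i = \<theta> (f j)" using f by simp
    then show ?thesis using t.mono_iff by (metis less_irrefl linorder_neqE)
  qed
  have Suc: "f (i + 1) = f i + 1" for i
  proof -
    have "f i < f (i + 1)" using f_mono by simp
    obtain j where j: "f j = f i + 1" using surj by blast
    then have "i < j" using f_mono[of i j] by simp
    then have "f (i + 1) \<le> f j" using f_mono[of j "i + 1"] by (simp add: not_less[symmetric])
    with j \<open>f i < f (i + 1)\<close> show ?thesis by simp
  qed
  have "f i = i + f 0" for i
  proof (induction i rule: int_induct[where k = 0])
    case (step1 i) then show ?case using Suc[of i] by simp
  next
    case (step2 i) then show ?case using Suc[of "i - 1"] by simp
  qed simp
  then have "\<eta> i = \<theta> (i + f 0)" for i unfolding f by (rule arg_cong)
  then show ?thesis by (rule that)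
qed

context circle_lift begin

lemma gap_mod: "\<theta> (i mod int n + 1) - \<theta> (i mod int n) = \<theta> (i + 1) - \<theta> i"
proof -
  have "i + 1 = (i mod int n + 1) + int n * (i div int n)" by simp
  then show ?thesis
    using period_mult[of "i mod int n" "i div int n"] period_mult[of "i mod int n + 1" "i div int n"] by simp
qed

text \<open>The first inequality makes the whole arc from point 1 to point \<open>n - 1\<close>, and
  so each gap inside it, shorter than the gap after point 0. The second makes the gap before point 0
  longer than the arc from point 0 to point \<open>n - 2\<close>, which contains the gap after point
  0.\<close>

lemma good_gaps:
  assumes "good_lift n \<theta>"
  shows "0 < i \<Longrightarrow> i < int n - 1 \<Longrightarrow> \<theta> (i + 1) - \<theta> i < \<theta> 1 - \<theta> 0"
    and "\<theta> 1 - \<theta> 0 < \<theta> (int n) - \<theta> (int n - 1)"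
    and "i mod int n \<noteq> int n - 1 \<Longrightarrow> \<theta> (i + 1) - \<theta> i < \<theta> (int n) - \<theta> (int n - 1)"
proof -
  show 1: "\<theta> (i + 1) - \<theta> i < \<theta> 1 - \<theta> 0" if "0 < i" "i < int n - 1" for i
  proof -
    have "\<theta> 1 \<le> \<theta> i" "\<theta> (i + 1) \<le> \<theta> (int n - 1)" using that by (auto intro: mono_le)
    then show ?thesis using assms by (simp add: good_lift_def)
  qed
  have "\<theta> 1 \<le> \<theta> (int n - 2)" using n3 by (intro mono_le) simp
  then show 2: "\<theta> 1 - \<theta> 0 < \<theta> (int n) - \<theta> (int n - 1)"
    using assms period[of 0] by (simp add: good_lift_def)
  assume *: "i mod int n \<noteq> int n - 1"
  have "0 \<le> i mod int n" "i mod int n < int n" using n3 by auto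
  with * consider "i mod int n = 0" | "0 < i mod int n" "i mod int n < int n - 1" by linarith
  then show "\<theta> (i + 1) - \<theta> i < \<theta> (int n) - \<theta> (int n - 1)"
  proof cases
    case 1 then show ?thesis using gap_mod[of i] 2 by simp
  next
    case 2 then show ?thesis using gap_mod[of i] 1[OF 2] \<open>\<theta> 1 - \<theta> 0 < \<theta> (int n) - \<theta> (int n - 1)\<close> by linarith
  qed
qed

end

text \<open>If the shift were no multiple of \<open>n\<close>, the largest gap of either lift would
  occur in the other as a gap that is not the largest, so each would be smaller than the
  other.\<close>

lemma good_unique:
  assumes "circle_lift n \<theta>" "good_lift n \<theta>" "circle_lift n \<eta>" "good_lift n \<eta>" "range (\<lambda>i. cis (\<theta> i)) = range (\<lambda>i. cis (\<eta> i))"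
  shows "cis (\<eta> i) = cis (\<theta> i)"
proof -
  interpret t: circle_lift n \<theta> by fact
  interpret e: circle_lift n \<eta> by fact
  obtain k where k: "\<And>i. \<eta> i = \<theta> (i + k)" using lift_same_range[OF assms(1,3,5)] by blast
  have top: "(int n - 1) mod int n = int n - 1" using t.n3 by (intro mod_pos_pos_trivial) auto
  have "k mod int n = 0"
  proof (rule ccontr)
    assume *: "k mod int n \<noteq> 0"
    have "(int n - 1 + k) mod int n \<noteq> int n - 1"
    proof
      assume "(int n - 1 + k) mod int n = int n - 1"
      then have "(int n - 1 + k) mod int n = (int n - 1) mod int n" by (simp only: top)
      then have "int n dvd k" by (simp only: mod_eq_dvd_iff) simp
      then show False using * by simp
    qed
    from t.good_gaps(3)[OF assms(2) this]
    have "\<eta> (int n) - \<eta> (int n - 1) < \<theta> (int n) - \<theta> (int n - 1)" by (simp add: k add.commute)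
    moreover have "(int n - 1 - k) mod int n \<noteq> int n - 1"
    proof
      assume "(int n - 1 - k) mod int n = int n - 1"
      then have "(int n - 1 - k) mod int n = (int n - 1) mod int n" by (simp only: top)
      then have "int n dvd (int n - 1 - k) - (int n - 1)" by (simp only: mod_eq_dvd_iff)
      then have "int n dvd - k" by (simp only: diff_diff_eq diff_diff_eq2 diff_add_cancel algebra_simps) simp
      then show False using * by simp
    qed
    from e.good_gaps(3)[OF assms(4) this]
    have "\<theta> (int n) - \<theta> (int n - 1) < \<eta> (int n) - \<eta> (int n - 1)" by (simp add: k)
    ultimately show False by simp
  qed
  then have "(i + k) mod int n = i mod int n" by (metis mod_add_right_eq add_0_right)
  then show ?thesis using k t.cis_eq_iff by simp
qed

text \<open>Conjugation reverses the cyclic order of the gaps. The largest gaps must correspond, so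
  in each lift the gap following the largest one corresponds to the gap preceding it in the other.
  In both lifts the following gap is the longer one, which is contradictory.\<close>

lemma good_chiral:
  assumes "circle_lift n \<theta>" "good_lift n \<theta>" "circle_lift n \<eta>" "good_lift n \<eta>"
  shows "range (\<lambda>i. cis (\<theta> i)) \<noteq> cnj ` range (\<lambda>i. cis (\<eta> i))"
proof
  interpret t: circle_lift n \<theta> by fact
  interpret e: circle_lift n \<eta> by fact
  assume "range (\<lambda>i. cis (\<theta> i)) = cnj ` range (\<lambda>i. cis (\<eta> i))"
  then have "range (\<lambda>i. cis (\<theta> i)) = range (\<lambda>i. cis (reflect n \<eta> i))" by (simp add: e.range_reflect)
  then obtain k where k: "\<And>i. reflect n \<eta> i = \<theta> (i + k)" using lift_same_range[OF assms(1) e.lift_reflect] by blast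
  have gap: "\<eta> (int n - i) - \<eta> (int n - i - 1) = \<theta> (i + k + 1) - \<theta> (i + k)" for i
    using k[of i] k[of "i + 1"] by (simp add: reflect_def algebra_simps)
  have k1: "k mod int n = int n - 1"
  proof (rule ccontr)
    assume *: "k mod int n \<noteq> int n - 1"
    from t.good_gaps(3)[OF assms(2) this] gap[of 0]
    have "\<eta> (int n) - \<eta> (int n - 1) < \<theta> (int n) - \<theta> (int n - 1)" by simp
    moreover have "(int n - (int n - 1 - k) - 1) mod int n \<noteq> int n - 1" using * by simp
    from e.good_gaps(3)[OF assms(4) this] gap[of "int n - 1 - k"]
    have "\<theta> (int n) - \<theta> (int n - 1) < \<eta> (int n) - \<eta> (int n - 1)" by (simp add: algebra_simps)
    ultimately show False by simp
  qed
  have "\<theta> ((1 + k) + 1) - \<theta> (1 + k) = \<theta> 1 - \<theta> 0"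
  proof -
    have "(1 + k) mod int n = 0" using k1 by (metis mod_add_right_eq add.commute diff_add_cancel mod_self)
    then show ?thesis using t.gap_mod[of "1 + k"] by simp
  qed
  moreover have "\<theta> ((int n - 1 + k) + 1) - \<theta> (int n - 1 + k) = \<theta> (int n - 1) - \<theta> (int n - 2)"
  proof -
    have "(int n - 1 + k) mod int n = (int n - 1 + (int n - 1)) mod int n" using k1 by (metis mod_add_right_eq)
    also have "\<dots> = (int n - 2 + int n) mod int n" by (simp add: algebra_simps)
    also have "\<dots> = int n - 2" using t.n3 by (simp only: mod_add_self2) (intro mod_pos_pos_trivial, auto)
    finally show ?thesis using t.gap_mod[of "int n - 1 + k"] by simp
  qed
  ultimately have "\<eta> (int n - 1) - \<eta> (int n - 2) = \<theta> 1 - \<theta> 0" "\<eta> 1 - \<eta> 0 = \<theta> (int n - 1) - \<theta> (int n - 2)"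
    using gap[of 1] gap[of "int n - 1"] by simp_all
  moreover have "\<theta> (int n - 1) - \<theta> (int n - 2) < \<theta> 1 - \<theta> 0" "\<eta> (int n - 1) - \<eta> (int n - 2) < \<eta> 1 - \<eta> 0"
    using t.good_gaps(1)[OF assms(2), of "int n - 2"] e.good_gaps(1)[OF assms(4), of "int n - 2"] t.n3 by simp_all
  ultimately show False by simp
qed

text \<open>Makes the events of distinct permutations disjoint. The points of a lift are distinct,
  so \<open>x\<close> is injective and equality of points passes to their indices.\<close>

lemma good_pts_permutes_unique:
  assumes n: "3 \<le> n" and "\<sigma> permutes {..<n}" "\<tau> permutes {..<n}"
    "good_pts n (x \<circ> \<sigma>)" "good_pts n (x \<circ> \<tau>)"
  shows "\<sigma> = \<tau>"
proof
  obtain \<theta> where \<theta>: "circle_lift n \<theta>" "good_lift n \<theta>" "\<And>i. sin (mid_angle \<theta> i) \<noteq> 0" "x ` {..<n} = range (\<lambda>i. cis (\<theta> i))"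
    "\<And>i. i < n \<Longrightarrow> x (\<sigma> i) = cis (\<theta> (int i))" by (rule good_pts_imp_range[OF n assms(4,2)]) (rule that)
  obtain \<eta> where \<eta>: "circle_lift n \<eta>" "good_lift n \<eta>" "\<And>i. sin (mid_angle \<eta> i) \<noteq> 0" "x ` {..<n} = range (\<lambda>i. cis (\<eta> i))"
    "\<And>i. i < n \<Longrightarrow> x (\<tau> i) = cis (\<eta> (int i))" by (rule good_pts_imp_range[OF n assms(5,3)]) (rule that)
  interpret circle_lift n \<theta> by fact
  have "inj_on pts {..<n}" by (auto simp: inj_on_def cis_eq_iff)
  then have "card (x ` {..<n}) = card {..<n}" using card_image range_pts \<theta>(4) by metis
  then have inj: "inj_on x {..<n}" using eq_card_imp_inj_on[of "{..<n}" x] by simp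
  fix i
  show "\<sigma> i = \<tau> i"
  proof (cases "i < n")
    case True
    have "x (\<sigma> i) = x (\<tau> i)"
      using good_unique[OF \<theta>(1,2) \<eta>(1,2)] \<theta>(4,5) \<eta>(4,5) True by simp
    then show ?thesis
      using inj True permutes_in_image[OF assms(2)] permutes_in_image[OF assms(3)] by (simp add: inj_on_def)
  next
    case False
    then show ?thesis using permutes_not_in[OF assms(2)] permutes_not_in[OF assms(3)] by simp
  qed
qed

lemma good_pts_permutes_chiral:
  assumes n: "3 \<le> n" and "\<sigma> permutes {..<n}" "\<tau> permutes {..<n}"
    "good_pts n (x \<circ> \<sigma>)" "good_pts n (cnj \<circ> x \<circ> \<tau>)"
  shows False
proof -
  obtain \<theta> where \<theta>: "circle_lift n \<theta>" "good_lift n \<theta>" "\<And>i. sin (mid_angle \<theta> i) \<noteq> 0" "x ` {..<n} = range (\<lambda>i. cis (\<theta> i))"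
    "\<And>i. i < n \<Longrightarrow> x (\<sigma> i) = cis (\<theta> (int i))"
    by (rule good_pts_imp_range[OF n assms(4,2)]) (rule that)
  obtain \<eta> where \<eta>: "circle_lift n \<eta>" "good_lift n \<eta>" "\<And>i. sin (mid_angle \<eta> i) \<noteq> 0" "(cnj \<circ> x) ` {..<n} = range (\<lambda>i. cis (\<eta> i))"
    "\<And>i. i < n \<Longrightarrow> (cnj \<circ> x) (\<tau> i) = cis (\<eta> (int i))"
    by (rule good_pts_imp_range[OF n assms(5,3)]) (rule that)
  have "x ` {..<n} = cnj ` range (\<lambda>i. cis (\<eta> i))" unfolding \<eta>(4)[symmetric] by (simp add: image_image)
  with good_chiral[OF \<theta>(1,2) \<eta>(1,2)] \<theta>(4) show False by simp
qed

section \<open>The volume of the simplex of angles\<close>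

text \<open>Slicing: fixing coordinate \<open>b\<close> at \<open>y\<close> leaves a simplex of one
  dimension less with bound \<open>t - w b * y\<close>; the power of this bound is then integrated
  over \<open>y\<close>.\<close>

lemma emeasure_weighted_simplex:
  fixes w :: "'i \<Rightarrow> real"
  assumes "finite I" "\<And>i. i \<in> I \<Longrightarrow> 0 < w i" "0 < t"
  shows "emeasure (Pi\<^sub>M I (\<lambda>_. lborel)) {x \<in> space (Pi\<^sub>M I (\<lambda>_. lborel)). (\<forall>i\<in>I. 0 < x i) \<and> (\<Sum>i\<in>I. w i * x i) < t}
    = ennreal (t ^ card I / (fact (card I) * (\<Prod>i\<in>I. w i)))"
  using assms
proof (induction arbitrary: t rule: finite_induct)
  case (empty t)
  then show ?case by (simp add: PiM_empty)
next
  case (insert b A t)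
  define S where "S B s = {x \<in> space (Pi\<^sub>M B (\<lambda>_. lborel)). (\<forall>i\<in>B. 0 < x i) \<and> (\<Sum>i\<in>B. w i * x i) < s}"
    for B :: "'i set" and s :: real
  have S[measurable]: "S B s \<in> sets (Pi\<^sub>M B (\<lambda>_. lborel))" if [simp]: "finite B" for B s
    unfolding S_def by measurable
  let ?M = "\<lambda>A. (Pi\<^sub>M A (\<lambda>_. lborel :: real measure))" and ?c = "fact (card A) * (\<Prod>i\<in>A. w i)"
  define n where "n = Suc (card A)"
  have wb: "0 < w b" using insert.prems by simp
  have c: "0 < ?c" using insert.prems by (simp add: prod_pos)
  then have c0: "(\<Prod>i\<in>A. w i) \<noteq> 0" by auto
  interpret product_sigma_finite "\<lambda>_. lborel :: real measure" by standard
  have split: "indicator (S (insert b A) t) (x(b := y)) =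
      (indicator {0<..<t / w b} y * indicator (S A (t - w b * y)) x :: ennreal)"
    if x: "x \<in> space (?M A)" for x y
  proof -
    have sum: "(\<Sum>i\<in>A. w i * (if i = b then y else x i)) = (\<Sum>i\<in>A. w i * x i)"
      using insert.hyps by (intro sum.cong) auto
    have "x(b := y) \<in> space (?M (insert b A))"
      using x by (auto simp: space_PiM PiE_def extensional_def)
    then have 1: "x(b := y) \<in> S (insert b A) t \<longleftrightarrow> 0 < y \<and> (\<forall>i\<in>A. 0 < x i) \<and> w b * y + (\<Sum>i\<in>A. w i * x i) < t"
      using insert.hyps sum by (auto simp: S_def)
    have "y < t / w b" if "x(b := y) \<in> S (insert b A) t"
    proof -
      have "0 \<le> (\<Sum>i\<in>A. w i * x i)"
        using that insert.prems unfolding 1 by (intro sum_nonneg mult_nonneg_nonneg) (auto intro: less_imp_le)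
      then show ?thesis using that wb unfolding 1 by (simp add: field_simps)
    qed
    then have "x(b := y) \<in> S (insert b A) t \<longleftrightarrow> y \<in> {0<..<t / w b} \<and> x \<in> S A (t - w b * y)"
      using 1 x by (auto simp: S_def)
    then show ?thesis by (simp add: indicator_def)
  qed
  have "emeasure (?M (insert b A)) (S (insert b A) t) = (\<integral>\<^sup>+x. indicator (S (insert b A) t) x \<partial>?M (insert b A))"
    using insert.hyps by (subst nn_integral_indicator) auto
  also have "\<dots> = (\<integral>\<^sup>+y. \<integral>\<^sup>+x. indicator (S (insert b A) t) (x(b := y)) \<partial>?M A \<partial>lborel)"
    using insert.hyps by (intro product_nn_integral_insert_rev) auto
  also have "\<dots> = (\<integral>\<^sup>+y. \<integral>\<^sup>+x. indicator {0<..<t / w b} y * indicator (S A (t - w b * y)) x \<partial>?M A \<partial>lborel)"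
    using split by (intro nn_integral_cong) auto
  also have "\<dots> = (\<integral>\<^sup>+y. indicator {0<..<t / w b} y * emeasure (?M A) (S A (t - w b * y)) \<partial>lborel)"
    using insert.hyps by (subst nn_integral_cmult) auto
  also have "\<dots> = (\<integral>\<^sup>+y. ennreal ((t - w b * y) ^ card A / ?c) * indicator {0<..<t / w b} y \<partial>lborel)"
  proof (intro nn_integral_cong)
    fix y
    have "emeasure (?M A) (S A (t - w b * y)) = ennreal ((t - w b * y) ^ card A / ?c)" if "y \<in> {0<..<t / w b}"
      unfolding S_def using that wb insert.prems by (intro insert.IH) (auto simp: field_simps)
    then show "indicator {0<..<t / w b} y * emeasure (?M A) (S A (t - w b * y)) =
        ennreal ((t - w b * y) ^ card A / ?c) * indicator {0<..<t / w b} y"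
      by (auto simp: indicator_def)
  qed
  \<comment> \<open>The induction hypothesis requires a positive bound, hence the open interval; the
    fundamental theorem is applied on the closed one.\<close>
  also have "\<dots> = (\<integral>\<^sup>+y. ennreal ((t - w b * y) ^ card A / ?c) * indicator {0..t / w b} y \<partial>lborel)"
  proof (intro nn_integral_cong_AE)
    have "AE y in lborel. y \<noteq> 0 \<and> y \<noteq> t / w b"
      using AE_lborel_singleton[of 0] AE_lborel_singleton[of "t / w b"] by eventually_elim auto
    then show "AE y in lborel. ennreal ((t - w b * y) ^ card A / ?c) * indicator {0<..<t / w b} y =
        ennreal ((t - w b * y) ^ card A / ?c) * indicator {0..t / w b} y"
      by eventually_elim (auto simp: indicator_def)
  qed
  also have "\<dots> = ennreal (- ((t - w b * (t / w b)) ^ n / (n * w b * ?c)) - (- ((t - w b * 0) ^ n / (n * w b * ?c))))"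
  proof (rule nn_integral_FTC_Icc)
    fix x
    have n: "n - 1 = card A" "real n > 0" by (auto simp: n_def)
    have "((\<lambda>x. - ((t - w b * x) ^ n / D)) has_real_derivative real n * (t - w b * x) ^ (n - 1) * w b / D) (at x)"
      if "D \<noteq> 0" for D
      using that by (auto intro!: derivative_eq_intros simp: field_simps)
    moreover have "n * w b * ?c \<noteq> 0" using wb c0 n(2) by simp
    moreover have "real n * (t - w b * x) ^ (n - 1) * w b / (n * w b * ?c) = (t - w b * x) ^ card A / ?c"
      using wb c0 n(2) unfolding n(1) by (simp add: field_simps)
    ultimately show "((\<lambda>x. - ((t - w b * x) ^ n / (n * w b * ?c))) has_real_derivative (t - w b * x) ^ card A / ?c) (at x)"
      by metis
    assume "x \<in> {0..t / w b}"
    then show "0 \<le> (t - w b * x) ^ card A / ?c"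
      using wb c by (intro divide_nonneg_pos zero_le_power) (auto simp: field_simps)
  qed (use insert.prems wb in \<open>auto simp: less_imp_le\<close>)
  also have "\<dots> = ennreal (t ^ n / (n * w b * ?c))" using wb by (simp add: n_def)
  also have "real n * w b * ?c = fact (card (insert b A)) * (\<Prod>i\<in>insert b A. w i)"
    using insert.hyps by (simp add: n_def algebra_simps)
  also have "n = card (insert b A)" using insert.hyps by (simp add: n_def)
  finally show ?case by (simp add: S_def)
qed

text \<open>Passing to partial sums is a unimodular triangular change of variables.\<close>

lemma nn_integral_partial_sums:
  fixes f :: "(nat \<Rightarrow> real) \<Rightarrow> ennreal"
  assumes "f \<in> borel_measurable (Pi\<^sub>M {1..<Suc k} (\<lambda>_. lborel))"
  shows "(\<integral>\<^sup>+x. f x \<partial>Pi\<^sub>M {1..<Suc k} (\<lambda>_. lborel)) =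
    (\<integral>\<^sup>+x. f (\<lambda>j\<in>{1..<Suc k}. \<Sum>i\<in>{1..j}. x i) \<partial>Pi\<^sub>M {1..<Suc k} (\<lambda>_. lborel))"
  using assms
proof (induction k arbitrary: f)
  case 0
  show ?case by (simp add: PiM_empty nn_integral_count_space_finite restrict_def)
next
  case (Suc k)
  let ?M = "\<lambda>k. Pi\<^sub>M {1..<Suc k} (\<lambda>_. lborel :: real measure)"
  define F where "F m x = (\<lambda>j\<in>{1..<Suc m}. \<Sum>i\<in>{1..j}. x i)" for m and x :: "nat \<Rightarrow> real"
  interpret product_sigma_finite "\<lambda>_. lborel :: real measure" by standard
  have ins: "{1..<Suc (Suc k)} = insert (Suc k) {1..<Suc k}" by auto
  have F[measurable]: "F m \<in> measurable (?M m) (?M m)" for m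
    unfolding F_def by measurable
  have f[measurable]: "f \<in> borel_measurable (Pi\<^sub>M (insert (Suc k) {1..<Suc k}) (\<lambda>_. lborel))"
    using Suc.prems unfolding ins .
  have F'[measurable]: "F (Suc k) \<in> measurable (Pi\<^sub>M (insert (Suc k) {1..<Suc k}) (\<lambda>_. lborel)) (Pi\<^sub>M (insert (Suc k) {1..<Suc k}) (\<lambda>_. lborel))"
    using F[of "Suc k"] unfolding ins .
  have upd: "F (Suc k) (x(Suc k := y)) = (F k x)(Suc k := (\<Sum>i\<in>{1..k}. x i) + y)" for x y
  proof
    fix j
    have "(\<Sum>i\<in>{1..j}. (x(Suc k := y)) i) = (\<Sum>i\<in>{1..j}. x i)" if "j \<le> k"
      using that by (intro sum.cong) auto
    moreover have "(\<Sum>i\<in>{1..Suc k}. (x(Suc k := y)) i) = (\<Sum>i\<in>{1..k}. x i) + y"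
      by (simp add: sum.atLeast1_atMost_eq) 
    ultimately show "F (Suc k) (x(Suc k := y)) j = ((F k x)(Suc k := (\<Sum>i\<in>{1..k}. x i) + y)) j"
      by (auto simp: F_def)
  qed
  have shift: "(\<integral>\<^sup>+y. g (c + y) \<partial>lborel) = (\<integral>\<^sup>+y. g y \<partial>lborel)"
    if "g \<in> borel_measurable borel" for g :: "real \<Rightarrow> ennreal" and c
    using nn_integral_real_affine[OF that, of 1 c] by simp
  have "(\<integral>\<^sup>+x. f (F (Suc k) x) \<partial>?M (Suc k)) =
      (\<integral>\<^sup>+x. \<integral>\<^sup>+y. f (F (Suc k) (x(Suc k := y))) \<partial>lborel \<partial>?M k)"
    unfolding ins by (rule product_nn_integral_insert) (simp, simp, rule measurable_compose[OF F' f])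
  \<comment> \<open>The inner integral over the last coordinate absorbs the translation by the
    preceding partial sum.\<close>
  also have "\<dots> = (\<integral>\<^sup>+x. \<integral>\<^sup>+y. f ((F k x)(Suc k := y)) \<partial>lborel \<partial>?M k)"
    unfolding upd
  proof (rule nn_integral_cong)
    fix x assume "x \<in> space (?M k)"
    then have "F k x \<in> space (?M k)" by (rule measurable_space[OF F])
    then have "(\<lambda>y. (F k x)(Suc k := y)) \<in> measurable borel (Pi\<^sub>M (insert (Suc k) {1..<Suc k}) (\<lambda>_. lborel))"
      by (intro measurable_fun_upd[where J = "{1..<Suc k}"]) auto
    then have "(\<lambda>y. f ((F k x)(Suc k := y))) \<in> borel_measurable borel"
      by (rule measurable_compose[OF _ f])
    then show "(\<integral>\<^sup>+y. f ((F k x)(Suc k := (\<Sum>i\<in>{1..k}. x i) + y)) \<partial>lborel) = (\<integral>\<^sup>+y. f ((F k x)(Suc k := y)) \<partial>lborel)"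
      by (rule shift)
  qed
  also have "\<dots> = (\<integral>\<^sup>+x. \<integral>\<^sup>+y. f (x(Suc k := y)) \<partial>lborel \<partial>?M k)"
    unfolding F_def
    by (rule Suc.IH[symmetric, where f = "\<lambda>x. \<integral>\<^sup>+y. f (x(Suc k := y)) \<partial>lborel"]) measurable
  also have "\<dots> = (\<integral>\<^sup>+x. f x \<partial>?M (Suc k))"
    unfolding ins by (rule product_nn_integral_insert[symmetric]) (simp, simp, rule f)
  finally show ?case unfolding F_def by (rule sym)
qed

text \<open>Coordinate \<open>j\<close> is the angle of point \<open>j\<close> measured from point
  0. For \<open>3 \<le> n\<close> the inequalities already force these angles to lie between 0 and
  \<open>2 * pi\<close>.\<close>

definition angle_simplex :: "nat \<Rightarrow> (nat \<Rightarrow> real) set" where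
  "angle_simplex n = {x. (\<forall>j\<in>{1..<n - 1}. x j < x (j + 1)) \<and> x (n - 1) < 2 * x 1 \<and> x (n - 1) + x (n - 2) < 2 * pi}"

lemma angle_simplex_measurable:
  assumes "3 \<le> n"
  shows "{x \<in> space (Pi\<^sub>M {1..<n} (\<lambda>_. lborel)). x \<in> angle_simplex n} \<in> sets (Pi\<^sub>M {1..<n} (\<lambda>_. lborel :: real measure))"
proof -
  have meas: "(\<lambda>x. x j) \<in> borel_measurable (Pi\<^sub>M {1..<n} (\<lambda>_. lborel :: real measure))" if "j \<in> {1..<n}" for j
    using measurable_component_singleton[OF that, of "\<lambda>_. lborel"] by simp
  show ?thesis unfolding angle_simplex_def mem_Collect_eq
    by (intro sets.sets_Collect_conj sets.sets_Collect_finite_All borel_measurable_less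
        borel_measurable_add borel_measurable_times borel_measurable_const meas) (use assms in auto)
qed

text \<open>Two measure-preserving substitutions: the angles become partial sums of gaps, and then
  the first gap is translated by the sum of the others, so that the new first coordinate is
  \<open>2 * b 1 - b k\<close>.\<close>

lemma emeasure_angle_simplex:
  assumes "3 \<le> n"
  shows "emeasure (Pi\<^sub>M {1..<n} (\<lambda>_. lborel)) {x \<in> space (Pi\<^sub>M {1..<n} (\<lambda>_. lborel)). x \<in> angle_simplex n} =
    ennreal ((2 * pi) ^ (n - 1) / (fact (n - 1) * (6 * 4 ^ (n - 3))))"
proof -
  define k where "k = n - 1"
  have k: "n = Suc k" "2 \<le> k" using assms by (auto simp: k_def)
  let ?M = "Pi\<^sub>M {1..<Suc k} (\<lambda>_. lborel :: real measure)" and ?N = "Pi\<^sub>M {2..<Suc k} (\<lambda>_. lborel :: real measure)"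
  define T where "T = {x \<in> space ?M. x \<in> angle_simplex n}"
  define F where "F x = (\<lambda>j\<in>{1..<Suc k}. \<Sum>i\<in>{1..j}. x i)" for x :: "nat \<Rightarrow> real"
  \<comment> \<open>With \<open>c\<close> the sum of gaps 2 to \<open>k\<close> and \<open>y\<close>
    the new first coordinate, the last two angles are \<open>2 * c + y\<close> and
    \<open>2 * c + y - x k\<close>. Their sum \<open>2 * y + 4 * c - x k\<close> has these
    coefficients.\<close>
  define w :: "nat \<Rightarrow> real" where "w i = (if i = 1 then 2 else if i = k then 3 else 4)" for i
  define S where "S = {x \<in> space ?M. (\<forall>i\<in>{1..<Suc k}. 0 < x i) \<and> (\<Sum>i\<in>{1..<Suc k}. w i * x i) < 2 * pi}"
  interpret product_sigma_finite "\<lambda>_. lborel :: real measure" by standard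
  have ins: "{1..<Suc k} = insert 1 {2..<Suc k}" using k by auto
  have T[measurable]: "T \<in> sets ?M" unfolding T_def using angle_simplex_measurable[OF assms] by (simp add: k(1))
  have S[measurable]: "S \<in> sets ?M" unfolding S_def by measurable
  have F[measurable]: "F \<in> measurable ?M ?M" unfolding F_def by measurable
  have h: "(\<lambda>x. indicator T (F x) :: ennreal) \<in> borel_measurable ?M"
    by (rule measurable_compose[OF F]) measurable
  have shift: "(\<integral>\<^sup>+y. g (c + y) \<partial>lborel) = (\<integral>\<^sup>+y. g y \<partial>lborel)"
    if "g \<in> borel_measurable borel" for g :: "real \<Rightarrow> ennreal" and c
    using nn_integral_real_affine[OF that, of 1 c] by simp
  have key: "F (x(1 := (\<Sum>i\<in>{2..<Suc k}. x i) + y)) \<in> T \<longleftrightarrow> x(1 := y) \<in> S"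
    if x: "x \<in> space ?N" for x y
  proof -
    define c where "c = (\<Sum>i\<in>{2..<Suc k}. x i)"
    define b where "b j = (\<Sum>i\<in>{1..j}. (x(1 := c + y)) i)" for j
    have bF: "F (x(1 := c + y)) j = b j" if "j \<in> {1..<Suc k}" for j
      using that by (simp add: F_def b_def)
    have sp: "F (x(1 := c + y)) \<in> space ?M" "x(1 := y) \<in> space ?M"
      using x k by (auto simp: F_def space_PiM PiE_def extensional_def)
    have bs: "b (j + 1) = b j + x (j + 1)" if "1 \<le> j" for j using that by (simp add: b_def)
    have b1: "b 1 = c + y" by (simp add: b_def)
    have ins': "{1..k} = insert 1 {2..<Suc k}" using k by auto
    have "(\<Sum>i\<in>{2..<Suc k}. (x(1 := c + y)) i) = c" unfolding c_def by (intro sum.cong) auto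
    then have bk: "b k = 2 * c + y" unfolding b_def ins' by (subst sum.insert) simp_all
    have bk1: "b (k - 1) = 2 * c + y - x k" using bs[of "k - 1"] bk k by simp
    have "(\<Sum>i\<in>{2..<Suc k}. w i * (x(1 := y)) i) = (\<Sum>i\<in>{2..<Suc k}. 4 * x i - (if i = k then x i else 0))"
      by (intro sum.cong) (auto simp: w_def)
    also have "\<dots> = 4 * c - x k" using k by (simp add: sum_subtractf c_def sum_distrib_left)
    finally have ws: "(\<Sum>i\<in>{1..<Suc k}. w i * (x(1 := y)) i) = 2 * y + 4 * c - x k"
      unfolding ins by (simp add: w_def)
    \<comment> \<open>The translation by \<open>c\<close> is chosen so that
      \<open>b k < 2 * b 1\<close> becomes the positivity of \<open>y\<close>.\<close>
    have arith: "b k < 2 * b 1 \<and> b k + b (k - 1) < 2 * pi \<longleftrightarrow> 0 < y \<and> 2 * y + 4 * c - x k < 2 * pi"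
      unfolding b1 bk bk1 by auto
    have "F (x(1 := c + y)) \<in> T \<longleftrightarrow> (\<forall>j\<in>{1..<k}. b j < b (j + 1)) \<and> b k < 2 * b 1 \<and> b k + b (k - 1) < 2 * pi"
    proof -
      have "k - 1 \<in> {1..<Suc k}" using k by auto
      note bF[OF this]
      moreover have "n - 2 = k - 1" "n - 1 = k" using k by auto
      ultimately show ?thesis using sp(1) k(2) bF by (simp add: T_def angle_simplex_def)
    qed
    also have "(\<forall>j\<in>{1..<k}. b j < b (j + 1)) \<longleftrightarrow> (\<forall>i\<in>{2..<Suc k}. 0 < x i)"
    proof
      assume *: "\<forall>j\<in>{1..<k}. b j < b (j + 1)"
      show "\<forall>i\<in>{2..<Suc k}. 0 < x i"
      proof
        fix i assume "i \<in> {2..<Suc k}"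
        then obtain j where "i = j + 1" "1 \<le> j" "j < k" by (cases i) auto
        then show "0 < x i" using bspec[OF *, of j] bs[of j] by simp
      qed
    next
      assume *: "\<forall>i\<in>{2..<Suc k}. 0 < x i"
      show "\<forall>j\<in>{1..<k}. b j < b (j + 1)"
      proof
        fix j assume "j \<in> {1..<k}"
        then show "b j < b (j + 1)" using bspec[OF *, of "j + 1"] bs[of j] by simp
      qed
    qed
    finally have "F (x(1 := c + y)) \<in> T \<longleftrightarrow> (\<forall>i\<in>{2..<Suc k}. 0 < x i) \<and> 0 < y \<and> 2 * y + 4 * c - x k < 2 * pi"
      by (simp only: arith)
    also have "\<dots> \<longleftrightarrow> x(1 := y) \<in> S"
    proof -
      have "(\<forall>i\<in>{1..<Suc k}. 0 < (x(1 := y)) i) \<longleftrightarrow> 0 < y \<and> (\<forall>i\<in>{2..<Suc k}. 0 < x i)"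
        unfolding ins by auto
      then show ?thesis unfolding S_def mem_Collect_eq ws using sp(2) by blast
    qed
    finally show ?thesis by (simp add: c_def)
  qed
  have "emeasure ?M T = (\<integral>\<^sup>+x. indicator T x \<partial>?M)" by (rule nn_integral_indicator[OF T, symmetric])
  also have "\<dots> = (\<integral>\<^sup>+x. indicator T (F x) \<partial>?M)"
    unfolding F_def by (rule nn_integral_partial_sums) measurable
  also have "\<dots> = (\<integral>\<^sup>+x. \<integral>\<^sup>+y. indicator T (F (x(1 := y))) \<partial>lborel \<partial>?N)"
    unfolding ins by (rule product_nn_integral_insert) (simp, simp, rule h[unfolded ins])
  also have "\<dots> = (\<integral>\<^sup>+x. \<integral>\<^sup>+y. indicator T (F (x(1 := (\<Sum>i\<in>{2..<Suc k}. x i) + y))) \<partial>lborel \<partial>?N)"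
  proof (rule nn_integral_cong)
    fix x assume "x \<in> space ?N"
    then have "(\<lambda>y. x(1 := y)) \<in> measurable borel ?M"
      unfolding ins by (intro measurable_fun_upd[where J = "{2..<Suc k}"]) auto
    then have "(\<lambda>y. indicator T (F (x(1 := y))) :: ennreal) \<in> borel_measurable borel"
      by (rule measurable_compose[OF _ h])
    then show "(\<integral>\<^sup>+y. indicator T (F (x(1 := y))) \<partial>lborel) =
      (\<integral>\<^sup>+y. indicator T (F (x(1 := (\<Sum>i\<in>{2..<Suc k}. x i) + y))) \<partial>lborel)"
      by (rule shift[symmetric])
  qed
  also have "\<dots> = (\<integral>\<^sup>+x. \<integral>\<^sup>+y. indicator S (x(1 := y)) \<partial>lborel \<partial>?N)"
    using key by (intro nn_integral_cong) (auto simp: indicator_def)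
  also have "\<dots> = (\<integral>\<^sup>+x. indicator S x \<partial>?M)"
    unfolding ins by (rule product_nn_integral_insert[symmetric]) (simp, simp, rule borel_measurable_indicator[OF S[unfolded ins]])
  also have "\<dots> = emeasure ?M S" by (rule nn_integral_indicator[OF S])
  also have "\<dots> = ennreal ((2 * pi) ^ card {1..<Suc k} / (fact (card {1..<Suc k}) * (\<Prod>i\<in>{1..<Suc k}. w i)))"
    unfolding S_def by (rule emeasure_weighted_simplex) (auto simp: w_def)
  also have "(\<Prod>i\<in>{1..<Suc k}. w i) = 6 * 4 ^ (k - 2)"
  proof -
    have "{1..<Suc k} = insert 1 (insert k {2..<k})" using k by auto
    moreover have "(\<Prod>i\<in>{2..<k}. w i) = (\<Prod>i\<in>{2..<k}. 4)" by (intro prod.cong) (auto simp: w_def)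
    ultimately show ?thesis using k by (simp add: w_def)
  qed
  finally show ?thesis using k by (simp add: T_def)
qed

section \<open>Uniform points on the circle\<close>

abbreviation angle_measure :: "real measure" where
  "angle_measure \<equiv> uniform_measure lborel {0..<2 * pi}"

lemma emeasure_angle_measure:
  assumes "A \<in> sets borel"
  shows "emeasure angle_measure A = emeasure lborel ({0..<2 * pi} \<inter> A) / ennreal (2 * pi)"
  using assms by (subst emeasure_uniform_measure) auto

lemma prob_space_angle_measure: "prob_space angle_measure"
  by (rule prob_space_uniform_measure) auto

lemma measurable_cis [measurable]: "cis \<in> borel_measurable borel"
  by (intro borel_measurable_continuous_onI continuous_intros continuous_on_cis)

lemma sets_uniform_circle [measurable_cong, simp]: "sets uniform_circle = sets borel"
  by (simp add: uniform_circle_def)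

lemma space_uniform_circle [simp]: "space uniform_circle = UNIV"
  by (simp add: uniform_circle_def)

lemma prob_space_uniform_circle: "prob_space uniform_circle"
  unfolding uniform_circle_def by (rule prob_space.prob_space_distr[OF prob_space_angle_measure]) measurable

lemma emeasure_uniform_circle:
  assumes [measurable]: "B \<in> sets borel"
  shows "emeasure uniform_circle B = emeasure lborel ({0..<2 * pi} \<inter> cis -` B) / ennreal (2 * pi)"
proof -
  have [measurable]: "cis -` B \<in> sets borel"
    using measurable_sets[OF measurable_cis assms] by simp
  have "emeasure uniform_circle B = emeasure angle_measure (cis -` B)"
    unfolding uniform_circle_def by (subst emeasure_distr) auto
  then show ?thesis by (simp add: emeasure_angle_measure)
qed

lemma emeasure_lborel_translate:
  fixes A :: "real set"
  assumes [measurable]: "A \<in> sets borel"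
  shows "emeasure lborel {t. t + c \<in> A} = emeasure lborel A"
proof -
  have "emeasure lborel A = emeasure (distr lborel borel ((+) c)) A" by (simp add: lborel_distr_plus)
  also have "\<dots> = emeasure lborel {t. t + c \<in> A}"
    by (subst emeasure_distr) (auto simp: vimage_def add.commute)
  finally show ?thesis ..
qed

text \<open>The part beyond \<open>2 * pi\<close> is moved back by one period and fills the part
  before \<open>s\<close>.\<close>

lemma emeasure_lborel_periodic:
  fixes C :: "real set"
  assumes [measurable]: "C \<in> sets borel" and per: "\<And>t. t + 2 * pi \<in> C \<longleftrightarrow> t \<in> C" and s: "0 \<le> s" "s < 2 * pi"
  shows "emeasure lborel ({s..<s + 2 * pi} \<inter> C) = emeasure lborel ({0..<2 * pi} \<inter> C)"
proof -
  have "emeasure lborel ({s..<s + 2 * pi} \<inter> C) = emeasure lborel (({s..<2 * pi} \<inter> C) \<union> ({2 * pi..<s + 2 * pi} \<inter> C))"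
    using s by (intro arg_cong[where f = "emeasure lborel"]) auto
  also have "\<dots> = emeasure lborel ({s..<2 * pi} \<inter> C) + emeasure lborel ({2 * pi..<s + 2 * pi} \<inter> C)"
    by (intro plus_emeasure[symmetric]) auto
  also have "emeasure lborel ({2 * pi..<s + 2 * pi} \<inter> C) = emeasure lborel ({0..<s} \<inter> C)"
  proof -
    have "{t. t + 2 * pi \<in> {2 * pi..<s + 2 * pi} \<inter> C} = {0..<s} \<inter> C" using per by auto
    then show ?thesis using emeasure_lborel_translate[of "{2 * pi..<s + 2 * pi} \<inter> C" "2 * pi"] by simp
  qed
  also have "emeasure lborel ({s..<2 * pi} \<inter> C) + emeasure lborel ({0..<s} \<inter> C) =
      emeasure lborel (({s..<2 * pi} \<inter> C) \<union> ({0..<s} \<inter> C))"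
    by (intro plus_emeasure) auto
  also have "\<dots> = emeasure lborel ({0..<2 * pi} \<inter> C)"
    using s by (intro arg_cong[where f = "emeasure lborel"]) auto
  finally show ?thesis .
qed

lemma cis_vimage_periodic: "t + 2 * pi \<in> cis -` B \<longleftrightarrow> t \<in> cis -` B"
  by (simp flip: cis_mult)

text \<open>Division by \<open>a\<close> is multiplication by its conjugate, that is, translation of
  the angle by \<open>s\<close>; the translated window is again one period.\<close>

lemma uniform_circle_rotate:
  assumes "cmod a = 1"
  shows "distr uniform_circle borel (\<lambda>z. z / a) = uniform_circle"
proof (rule measure_eqI)
  define s where "s = Arg2pi (cnj a)"
  have s: "0 \<le> s" "s < 2 * pi" using Arg2pi by (auto simp: s_def)
  have a: "z / a = z * cis s" for z
  proof -
    have "cis s = cnj a" using assms cis_Arg2pi[of "cnj a"] by (simp add: s_def)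
    moreover have "a * cnj a = 1" using complex_norm_square[of a] assms by simp
    then have "inverse a = cnj a" by (rule inverse_unique)
    ultimately show ?thesis by (simp add: divide_inverse)
  qed
  fix B assume "B \<in> sets (distr uniform_circle borel (\<lambda>z. z / a))"
  then have B[measurable]: "B \<in> sets borel" by simp
  have [measurable]: "(\<lambda>z. z * cis s) -` B \<in> sets borel"
    using measurable_sets[of "\<lambda>z. z * cis s" borel borel B] by simp
  have C[measurable]: "cis -` B \<in> sets borel"
    using measurable_sets[OF measurable_cis B] by simp
  have "emeasure (distr uniform_circle borel (\<lambda>z. z / a)) B = emeasure uniform_circle ((\<lambda>z. z * cis s) -` B)"
    unfolding a by (subst emeasure_distr) auto
  also have "\<dots> = emeasure lborel ({0..<2 * pi} \<inter> cis -` (\<lambda>z. z * cis s) -` B) / ennreal (2 * pi)"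
    by (rule emeasure_uniform_circle) measurable
  also have "{0..<2 * pi} \<inter> cis -` (\<lambda>z. z * cis s) -` B = {t. t + s \<in> {s..<s + 2 * pi} \<inter> cis -` B}"
    by (auto simp: cis_mult)
  also have "emeasure lborel \<dots> = emeasure lborel ({0..<2 * pi} \<inter> cis -` B)"
    by (subst emeasure_lborel_translate) (auto intro!: emeasure_lborel_periodic cis_vimage_periodic s)
  finally show "emeasure (distr uniform_circle borel (\<lambda>z. z / a)) B = emeasure uniform_circle B"
    by (simp add: emeasure_uniform_circle)
qed simp

text \<open>Conjugation negates the angle. After adding a full turn the half-open interval is closed
  at its other end, and the two endpoints form a null set.\<close>

lemma uniform_circle_cnj: "distr uniform_circle borel cnj = uniform_circle"
proof (rule measure_eqI)
  have cnj[measurable]: "cnj \<in> borel_measurable borel"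
    by (intro borel_measurable_continuous_onI continuous_intros)
  fix B assume "B \<in> sets (distr uniform_circle borel cnj)"
  then have B[measurable]: "B \<in> sets borel" by simp
  have [measurable]: "cnj -` B \<in> sets borel" using measurable_sets[OF cnj B] by simp
  have C[measurable]: "cis -` B \<in> sets borel"
    using measurable_sets[OF measurable_cis B] by simp
  have "emeasure (distr uniform_circle borel cnj) B = emeasure lborel ({0..<2 * pi} \<inter> cis -` cnj -` B) / ennreal (2 * pi)"
    by (subst emeasure_distr) (auto simp: emeasure_uniform_circle)
  also have "emeasure lborel ({0..<2 * pi} \<inter> cis -` cnj -` B) = emeasure (distr lborel borel uminus) ({0..<2 * pi} \<inter> cis -` cnj -` B)"
    by (simp add: lborel_distr_uminus)
  also have "\<dots> = emeasure lborel {t. t + 2 * pi \<in> {0<..2 * pi} \<inter> cis -` B}"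
  proof -
    have [measurable]: "{0..<2 * pi} \<inter> cis -` cnj -` B \<in> sets borel"
      using measurable_sets[OF measurable_cis, of "cnj -` B"] by auto
    have "uminus -` ({0..<2 * pi} \<inter> cis -` cnj -` B) = {t. t + 2 * pi \<in> {0<..2 * pi} \<inter> cis -` B}"
    proof (rule set_eqI)
      fix t
      have "cnj (cis (- t)) = cis (t + 2 * pi)" by (simp add: cis_cnj flip: cis_mult)
      then show "t \<in> uminus -` ({0..<2 * pi} \<inter> cis -` cnj -` B) \<longleftrightarrow> t \<in> {t. t + 2 * pi \<in> {0<..2 * pi} \<inter> cis -` B}"
        by (simp only: vimage_eq Int_iff mem_Collect_eq atLeastLessThan_iff greaterThanAtMost_iff) linarith
    qed
    then show ?thesis by (subst emeasure_distr) auto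
  qed
  also have "\<dots> = emeasure lborel ({0<..2 * pi} \<inter> cis -` B)"
    by (rule emeasure_lborel_translate) measurable
  also have "\<dots> = emeasure lborel ({0..<2 * pi} \<inter> cis -` B)"
  proof (rule emeasure_eq_AE)
    show "AE t in lborel. t \<in> {0<..2 * pi} \<inter> cis -` B \<longleftrightarrow> t \<in> {0..<2 * pi} \<inter> cis -` B"
      using AE_lborel_singleton[of 0] AE_lborel_singleton[of "2 * pi"] by eventually_elim auto
  qed measurable
  finally show "emeasure (distr uniform_circle borel cnj) B = emeasure uniform_circle B"
    by (simp add: emeasure_uniform_circle)
qed simp

lemma measurable_Arg2pi [measurable]: "Arg2pi \<in> borel_measurable borel"
  by (subst borel_measurable_iff_greater) (auto intro!: borel_open open_Arg2pi2pi_gt)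

text \<open>By rotation invariance the law of the angle measured from \<open>a\<close> does not
  depend on \<open>a\<close>; on one turn \<open>Arg2pi\<close> inverts \<open>cis\<close>.\<close>

lemma distr_uniform_circle_Arg2pi:
  assumes "cmod a = 1"
  shows "distr uniform_circle borel (\<lambda>z. Arg2pi (z / a)) = angle_measure"
proof -
  have "distr uniform_circle borel (\<lambda>z. Arg2pi (z / a)) = distr (distr uniform_circle borel (\<lambda>z. z / a)) borel Arg2pi"
    by (subst distr_distr) (auto simp: comp_def)
  also have "\<dots> = distr uniform_circle borel Arg2pi" by (simp only: uniform_circle_rotate[OF assms])
  also have "\<dots> = distr (distr angle_measure borel cis) borel Arg2pi" by (simp only: uniform_circle_def)
  also have "\<dots> = distr angle_measure borel (Arg2pi \<circ> cis)" by (subst distr_distr) auto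
  also have "\<dots> = distr angle_measure borel (\<lambda>t. t)"
  proof (rule distr_cong_AE)
    show "AE t in angle_measure. (Arg2pi \<circ> cis) t = t"
      by (rule AE_uniform_measureI) (auto simp: Arg2pi_cis)
  qed auto
  also have "\<dots> = angle_measure" by (rule distr_id2) simp
  finally show ?thesis .
qed

lemma AE_uniform_circle_norm: "AE z in uniform_circle. cmod z = 1"
  unfolding uniform_circle_def by (subst AE_distr_iff) auto

lemma emeasure_uniform_circle_Re: "emeasure uniform_circle {z. Re z = r} = 0"
proof -
  have "countable {t. cos t = r}"
  proof (cases "\<exists>s. cos s = r")
    case True
    then obtain s where "cos s = r" by blast
    then have "{t. cos t = r} \<subseteq> (\<lambda>n. s + 2 * n * pi) ` \<int> \<union> (\<lambda>n. - s + 2 * n * pi) ` \<int>"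
      using cos_eq[of _ s] by auto
    moreover have "countable (\<int> :: real set)" by (simp add: Ints_def)
    ultimately show ?thesis by (meson countable_Un countable_image countable_subset)
  next
    case False then have "{t. cos t = r} = {}" by auto
    then show ?thesis by simp
  qed
  then have "emeasure lborel ({0..<2 * pi} \<inter> {t. cos t = r}) = 0"
    by (intro emeasure_lborel_countable) auto
  then show ?thesis by (subst emeasure_uniform_circle) (auto simp: vimage_def)
qed

text \<open>Reduces product probabilities to Lebesgue volumes; it suffices to compare the measures
  on boxes.\<close>

lemma PiM_angle_measure:
  assumes "finite I"
  shows "Pi\<^sub>M I (\<lambda>_. angle_measure) = density (Pi\<^sub>M I (\<lambda>_. lborel))
    (\<lambda>x. ennreal (1 / (2 * pi)) ^ card I * indicator (Pi\<^sub>E I (\<lambda>_. {0..<2 * pi})) x)" (is "_ = ?D")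
proof (rule sym, rule product_sigma_finite.PiM_eqI)
  interpret prob_space angle_measure by (rule prob_space_angle_measure)
  interpret L: product_sigma_finite "\<lambda>_. lborel :: real measure" by standard
  show "product_sigma_finite (\<lambda>_. angle_measure)"
    by (simp add: product_sigma_finite_def sigma_finite_measure_axioms)
  show "finite I" by fact
  show "sets ?D = sets (Pi\<^sub>M I (\<lambda>_. angle_measure))"
    by (simp only: sets_density) (intro sets_PiM_cong, auto)
  fix A assume "\<And>i. i \<in> I \<Longrightarrow> A i \<in> sets angle_measure"
  then have A: "\<And>i. i \<in> I \<Longrightarrow> A i \<in> sets lborel" by simp
  let ?B = "Pi\<^sub>E I (\<lambda>_. {0..<2 * pi})" and ?c = "ennreal (1 / (2 * pi))"
  have B: "?B \<in> sets (Pi\<^sub>M I (\<lambda>_. lborel))" using assms by (intro sets_PiM_I_finite) auto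
  have P: "Pi\<^sub>E I A \<in> sets (Pi\<^sub>M I (\<lambda>_. lborel))" using assms A by (intro sets_PiM_I_finite) auto
  have "emeasure ?D (Pi\<^sub>E I A) = (\<integral>\<^sup>+x. ?c ^ card I * indicator (Pi\<^sub>E I (\<lambda>i. {0..<2 * pi} \<inter> A i)) x \<partial>Pi\<^sub>M I (\<lambda>_. lborel))"
    using B P by (subst emeasure_density) (auto intro!: nn_integral_cong simp: indicator_def PiE_Int[symmetric] simp del: PiE_Int)
  also have "\<dots> = ?c ^ card I * emeasure (Pi\<^sub>M I (\<lambda>_. lborel)) (Pi\<^sub>E I (\<lambda>i. {0..<2 * pi} \<inter> A i))"
    using assms A by (subst nn_integral_cmult_indicator) (auto intro!: sets_PiM_I_finite)
  also have "emeasure (Pi\<^sub>M I (\<lambda>_. lborel)) (Pi\<^sub>E I (\<lambda>i. {0..<2 * pi} \<inter> A i)) = (\<Prod>i\<in>I. emeasure lborel ({0..<2 * pi} \<inter> A i))"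
    using assms A by (intro L.emeasure_PiM) auto
  also have "?c ^ card I * \<dots> = (\<Prod>i\<in>I. ?c * emeasure lborel ({0..<2 * pi} \<inter> A i))"
    by (simp add: prod.distrib)
  also have "\<dots> = (\<Prod>i\<in>I. emeasure angle_measure (A i))"
  proof (intro prod.cong refl)
    fix i assume "i \<in> I"
    then have "A i \<in> sets borel" using A by simp
    moreover have "?c = inverse (ennreal (2 * pi))"
      by (subst inverse_ennreal) (auto simp: field_simps)
    ultimately show "?c * emeasure lborel ({0..<2 * pi} \<inter> A i) = emeasure angle_measure (A i)"
      by (simp add: emeasure_angle_measure divide_ennreal_def mult.commute)
  qed
  finally show "emeasure ?D (Pi\<^sub>E I A) = (\<Prod>i\<in>I. emeasure angle_measure (A i))" .
qed

text \<open>From \<open>x 1 \<le> x (n - 1) < 2 * x 1\<close> the first angle is positive, hence so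
  is \<open>x (n - 2)\<close>, and the bound on the sum gives \<open>x (n - 1) < 2 * pi\<close>. The
  box in the density therefore cuts nothing off.\<close>

lemma angle_simplex_box:
  assumes "3 \<le> n" "x \<in> space (Pi\<^sub>M {1..<n} (\<lambda>_. lborel))" "x \<in> angle_simplex n"
  shows "x \<in> Pi\<^sub>E {1..<n} (\<lambda>_. {0..<2 * pi})"
proof -
  have less: "x j < x (j + 1)" if "j \<in> {1..<n - 1}" for j using assms(3) that by (auto simp: angle_simplex_def)
  have up: "x i \<le> x j" if "1 \<le> i" "i \<le> j" "j < n" for i j
    using that(2,3)
  proof (induction j rule: dec_induct)
    case (step m)
    then have "x i \<le> x m" "x m < x (m + 1)" using \<open>1 \<le> i\<close> less[of m] by simp_all
    then show ?case by simp
  qed simp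
  have b: "x (n - 1) < 2 * x 1" "x (n - 1) + x (n - 2) < 2 * pi" using assms(3) by (auto simp: angle_simplex_def)
  have "x 1 \<le> x (n - 1)" "x 1 \<le> x (n - 2)" using assms(1) by (auto intro!: up)
  with b have "0 < x 1" "x (n - 1) < 2 * pi" by linarith+
  then have "0 \<le> x j \<and> x j < 2 * pi" if "j \<in> {1..<n}" for j
    using up[of 1 j] up[of j "n - 1"] that by fastforce
  then show ?thesis using assms(2) by (auto simp: space_PiM PiE_def)
qed

lemma emeasure_PiM_angle_simplex:
  assumes "3 \<le> n"
  shows "emeasure (Pi\<^sub>M {1..<n} (\<lambda>_. angle_measure)) {x \<in> space (Pi\<^sub>M {1..<n} (\<lambda>_. lborel)). x \<in> angle_simplex n} =
    ennreal (1 / (fact (n - 1) * (6 * 4 ^ (n - 3))))"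
proof -
  let ?L = "Pi\<^sub>M {1..<n} (\<lambda>_. lborel :: real measure)"
  define T where "T = {x \<in> space ?L. x \<in> angle_simplex n}"
  have T: "T \<in> sets ?L" unfolding T_def by (rule angle_simplex_measurable[OF assms])
  have box: "Pi\<^sub>E {1..<n} (\<lambda>_. {0..<2 * pi}) \<in> sets ?L" by (intro sets_PiM_I_finite) auto
  have "emeasure (Pi\<^sub>M {1..<n} (\<lambda>_. angle_measure)) T =
      (\<integral>\<^sup>+x. ennreal (1 / (2 * pi)) ^ (n - 1) * indicator (Pi\<^sub>E {1..<n} (\<lambda>_. {0..<2 * pi})) x * indicator T x \<partial>?L)"
    unfolding PiM_angle_measure[OF finite_atLeastLessThan] using T box by (subst emeasure_density) auto
  also have "\<dots> = (\<integral>\<^sup>+x. ennreal (1 / (2 * pi)) ^ (n - 1) * indicator T x \<partial>?L)"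
    using angle_simplex_box[OF assms] by (intro nn_integral_cong) (auto simp: indicator_def T_def)
  also have "\<dots> = ennreal (1 / (2 * pi)) ^ (n - 1) * emeasure ?L T"
    using T by (rule nn_integral_cmult_indicator)
  also have "\<dots> = ennreal ((1 / (2 * pi)) ^ (n - 1) * ((2 * pi) ^ (n - 1) / (fact (n - 1) * (6 * 4 ^ (n - 3)))))"
    unfolding T_def emeasure_angle_simplex[OF assms]
    by (subst ennreal_power, simp) (rule ennreal_mult[symmetric], auto)
  also have "(1 / (2 * pi)) ^ (n - 1) * ((2 * pi) ^ (n - 1) / (fact (n - 1) * (6 * 4 ^ (n - 3)))) = 1 / (fact (n - 1) * (6 * 4 ^ (n - 3)))"
    by (simp add: power_one_over field_simps)
  finally show ?thesis by (simp add: T_def)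
qed

section \<open>The probability of good points in a fixed labelling\<close>

lemma good_pts_cong:
  assumes "3 \<le> n" "\<And>i. i < n \<Longrightarrow> z i = z' i"
  shows "good_pts n z = good_pts n z'"
proof -
  have "0 < n" "1 < n" "n - 1 < n" "n - 2 < n" using assms(1) by auto
  moreover have "j < n" "j + 1 < n" if "j + 1 < n" for j using that by auto
  moreover have "(i + 1) mod n < n" for i using assms(1) by simp
  ultimately show ?thesis unfolding good_pts_def using assms(2) by (simp cong: conj_cong imp_cong)
qed

lemma good_pts_measurable:
  assumes "3 \<le> n"
  shows "{z \<in> space (Pi\<^sub>M {..<n} (\<lambda>_. borel)). good_pts n z} \<in> sets (Pi\<^sub>M {..<n} (\<lambda>_. borel))"
proof -
  let ?M = "Pi\<^sub>M {..<n} (\<lambda>_. borel :: complex measure)"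
  have comp: "(\<lambda>z. z j) \<in> borel_measurable ?M" if "j < n" for j
    using that by (intro measurable_component_singleton) auto
  have arg: "(\<lambda>z. Arg2pi (z j / z 0)) \<in> borel_measurable ?M" if "j < n" for j
    using that assms by (intro measurable_compose[OF _ measurable_Arg2pi] borel_measurable_divide comp) auto
  have Re: "(\<lambda>z. Re (z j)) \<in> borel_measurable ?M" if "j < n" for j
    using measurable_compose[OF comp[OF that] borel_measurable_Re] .
  have norm: "(\<lambda>z. cmod (z j)) \<in> borel_measurable ?M" if "j < n" for j
    using measurable_compose[OF comp[OF that] borel_measurable_norm] .
  have 1: "{z \<in> space ?M. \<forall>i\<in>{..<n}. cmod (z i) = 1} \<in> sets ?M"
    by (intro sets.sets_Collect_finite_All borel_measurable_eq norm) auto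
  have 2: "{z \<in> space ?M. \<forall>j\<in>{..<n - 1}. Arg2pi (z j / z 0) < Arg2pi (z (j + 1) / z 0)} \<in> sets ?M"
    by (intro sets.sets_Collect_finite_All borel_measurable_less arg) auto
  have 3: "{z \<in> space ?M. Arg2pi (z (n - 1) / z 0) < 2 * Arg2pi (z 1 / z 0)} \<in> sets ?M"
    using assms by (intro borel_measurable_less borel_measurable_times arg) auto
  have 4: "{z \<in> space ?M. Arg2pi (z (n - 1) / z 0) + Arg2pi (z (n - 2) / z 0) < 2 * pi} \<in> sets ?M"
    using assms by (intro borel_measurable_less borel_measurable_add arg) auto
  have 5: "{z \<in> space ?M. \<forall>i\<in>{..<n}. Re (z i) \<noteq> Re (z ((i + 1) mod n))} \<in> sets ?M"
    using assms by (intro sets.sets_Collect_finite_All borel_measurable_neq Re) auto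
  have "{z \<in> space ?M. good_pts n z} = {z \<in> space ?M. (\<forall>i\<in>{..<n}. cmod (z i) = 1) \<and>
      (\<forall>j\<in>{..<n - 1}. Arg2pi (z j / z 0) < Arg2pi (z (j + 1) / z 0)) \<and>
      Arg2pi (z (n - 1) / z 0) < 2 * Arg2pi (z 1 / z 0) \<and>
      Arg2pi (z (n - 1) / z 0) + Arg2pi (z (n - 2) / z 0) < 2 * pi \<and>
      (\<forall>i\<in>{..<n}. Re (z i) \<noteq> Re (z ((i + 1) mod n)))}"
    unfolding good_pts_def lessThan_iff Ball_def less_diff_conv by simp
  also have "\<dots> \<in> sets ?M" by (intro sets.sets_Collect_conj 1 2 3 4 5)
  finally show ?thesis .
qed

text \<open>Integrating over coordinate \<open>i\<close> first: for fixed \<open>z j\<close> the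
  exceptional values of \<open>z i\<close> form a null set. This discards the bisectors through
  1.\<close>

lemma AE_PiM_uniform_circle_Re:
  assumes "finite I" "i \<in> I" "j \<in> I" "i \<noteq> j"
  shows "AE z in Pi\<^sub>M I (\<lambda>_. uniform_circle). Re (z i) \<noteq> Re (z j)"
proof -
  let ?J = "I - {i}" and ?M = "\<lambda>I. Pi\<^sub>M I (\<lambda>_. uniform_circle)"
  interpret prob_space uniform_circle by (rule prob_space_uniform_circle)
  interpret product_sigma_finite "\<lambda>_. uniform_circle"
    by (simp add: product_sigma_finite_def sigma_finite_measure_axioms)
  have I: "I = insert i ?J" using assms by auto
  have Re: "(\<lambda>z. Re (z l)) \<in> borel_measurable (?M I)" if "l \<in> I" for l
    using measurable_component_singleton[OF that, of "\<lambda>_. uniform_circle"]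
    by (intro measurable_compose[OF _ borel_measurable_Re]) (simp cong: measurable_cong_sets)
  define N where "N = {z \<in> space (?M I). Re (z i) = Re (z j)}"
  have N: "N \<in> sets (?M I)" unfolding N_def by (intro borel_measurable_eq Re assms)
  have "emeasure (?M I) N = (\<integral>\<^sup>+z. indicator N z \<partial>?M (insert i ?J))"
    using N I by simp
  also have "\<dots> = (\<integral>\<^sup>+x. \<integral>\<^sup>+y. indicator N (x(i := y)) \<partial>uniform_circle \<partial>?M ?J)"
    using N assms(1) I by (intro product_nn_integral_insert) auto
  also have "\<dots> = (\<integral>\<^sup>+x. 0 \<partial>?M ?J)"
  proof (rule nn_integral_cong)
    fix x assume "x \<in> space (?M ?J)"
    have "(\<integral>\<^sup>+y. indicator N (x(i := y)) \<partial>uniform_circle) \<le> (\<integral>\<^sup>+y. indicator {y. Re y = Re (x j)} y \<partial>uniform_circle)"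
      using assms by (intro nn_integral_mono) (auto simp: indicator_def N_def)
    also have "\<dots> = 0" using emeasure_uniform_circle_Re by (subst nn_integral_indicator) auto
    finally show "(\<integral>\<^sup>+y. indicator N (x(i := y)) \<partial>uniform_circle) = 0" by simp
  qed
  finally have "emeasure (?M I) N = 0" by simp
  then show ?thesis using N by (intro AE_I[of _ _ N]) (auto simp: N_def)
qed

lemma good_pts_iff_angle_simplex:
  assumes n: "3 \<le> n" and norm: "\<And>i. i < n \<Longrightarrow> cmod (z i) = 1"
    and Re: "\<And>i. i < n \<Longrightarrow> Re (z i) \<noteq> Re (z ((i + 1) mod n))"
  shows "good_pts n z \<longleftrightarrow> (\<lambda>j\<in>{1..<n}. Arg2pi (z j / z 0)) \<in> angle_simplex n"
proof -
  have "z 0 \<noteq> 0" using norm[of 0] n by auto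
  then have 0: "Arg2pi (z 0 / z 0) = 0" using Arg2pi_of_real[of 1] by simp
  let ?b = "\<lambda>j. Arg2pi (z j / z 0)"
  have chain: "(\<forall>j. j + 1 < n \<longrightarrow> ?b j < ?b (j + 1)) \<longleftrightarrow> (\<forall>j\<in>{1..<n - 1}. ?b j < ?b (j + 1))"
    if "?b (n - 1) < 2 * ?b 1"
  proof
    assume *: "\<forall>j\<in>{1..<n - 1}. ?b j < ?b (j + 1)"
    \<comment> \<open>The order of points 0 and 1 is recovered here: the last angle is nonnegative
      and below \<open>2 * ?b 1\<close>.\<close>
    have "0 < ?b 1" using that Arg2pi[of "z (n - 1) / z 0"] by linarith
    with * 0 show "\<forall>j. j + 1 < n \<longrightarrow> ?b j < ?b (j + 1)"
    proof (intro allI impI)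
      fix j assume "j + 1 < n"
      then show "?b j < ?b (j + 1)" using * 0 \<open>0 < ?b 1\<close> by (cases "j = 0") auto
    qed
  qed auto
  have "(\<lambda>j\<in>{1..<n}. ?b j) \<in> angle_simplex n \<longleftrightarrow>
      (\<forall>j\<in>{1..<n - 1}. ?b j < ?b (j + 1)) \<and> ?b (n - 1) < 2 * ?b 1 \<and> ?b (n - 1) + ?b (n - 2) < 2 * pi"
  proof -
    have "n - 1 \<in> {1..<n}" "n - 2 \<in> {1..<n}" "1 \<in> {1..<n}" using n by auto
    moreover have "j \<in> {1..<n}" "j + 1 \<in> {1..<n}" if "j \<in> {1..<n - 1}" for j using that by auto
    ultimately show ?thesis unfolding angle_simplex_def mem_Collect_eq by (simp only: restrict_apply' cong: ball_cong)
  qed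
  then show ?thesis unfolding good_pts_def using norm Re chain by blast
qed

text \<open>Point 0 is fixed at a value \<open>a\<close>. Whatever \<open>a\<close> of modulus 1 is,
  the angles of the other points measured from it are independent and uniform, so the inner integral
  is the constant simplex probability.\<close>

lemma emeasure_PiM_good_pts:
  assumes n: "3 \<le> n"
  shows "emeasure (Pi\<^sub>M {..<n} (\<lambda>_. uniform_circle)) {z \<in> space (Pi\<^sub>M {..<n} (\<lambda>_. borel)). good_pts n z} =
    ennreal (1 / (fact (n - 1) * (6 * 4 ^ (n - 3))))"
proof -
  let ?C = "\<lambda>I. Pi\<^sub>M I (\<lambda>_. uniform_circle)" and ?A = "Pi\<^sub>M {1..<n} (\<lambda>_. angle_measure)"
  interpret prob_space uniform_circle by (rule prob_space_uniform_circle)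
  interpret product_sigma_finite "\<lambda>_. uniform_circle"
    by (simp add: product_sigma_finite_def sigma_finite_measure_axioms)
  have ins: "{..<n} = insert 0 {1..<n}" using n by auto
  define G where "G = {z \<in> space (Pi\<^sub>M {..<n} (\<lambda>_. borel)). good_pts n z}"
  have setsC: "sets (?C {..<n}) = sets (Pi\<^sub>M {..<n} (\<lambda>_. borel))" by (intro sets_PiM_cong) auto
  have G: "G \<in> sets (?C {..<n})" unfolding G_def setsC by (rule good_pts_measurable[OF n])
  define T where "T = {x \<in> space (Pi\<^sub>M {1..<n} (\<lambda>_. lborel)). x \<in> angle_simplex n}"
  have "sets ?A = sets (Pi\<^sub>M {1..<n} (\<lambda>_. lborel))" by (intro sets_PiM_cong) auto
  then have T: "T \<in> sets ?A" unfolding T_def using angle_simplex_measurable[OF n] by simp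
  have spT: "(\<lambda>j\<in>{1..<n}. f j) \<in> T \<longleftrightarrow> (\<lambda>j\<in>{1..<n}. f j) \<in> angle_simplex n" for f
    by (auto simp: T_def space_PiM)
  have ae: "AE z in ?C {..<n}. indicator G z = (indicator T (\<lambda>j\<in>{1..<n}. Arg2pi (z j / z 0)) :: ennreal)"
  proof -
    have "AE z in ?C {..<n}. \<forall>i\<in>{..<n}. cmod (z i) = 1"
      by (intro AE_finite_allI AE_PiM_component prob_space_uniform_circle AE_uniform_circle_norm) auto
    moreover have "AE z in ?C {..<n}. \<forall>i\<in>{..<n}. Re (z i) \<noteq> Re (z ((i + 1) mod n))"
    proof (intro AE_finite_allI AE_PiM_uniform_circle_Re)
      fix i assume "i \<in> {..<n}"
      then show "i \<noteq> (i + 1) mod n" using n by (cases "i + 1 = n") auto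
    qed (use n in auto)
    moreover have "AE z in ?C {..<n}. z \<in> space (?C {..<n})" by simp
    ultimately show ?thesis
    proof eventually_elim
      fix z assume "\<forall>i\<in>{..<n}. cmod (z i) = 1" "\<forall>i\<in>{..<n}. Re (z i) \<noteq> Re (z ((i + 1) mod n))" "z \<in> space (?C {..<n})"
      then have "good_pts n z \<longleftrightarrow> (\<lambda>j\<in>{1..<n}. Arg2pi (z j / z 0)) \<in> angle_simplex n" "z \<in> space (Pi\<^sub>M {..<n} (\<lambda>_. borel))"
        using good_pts_iff_angle_simplex[OF n, of z] by (auto simp: space_PiM)
      then show "indicator G z = (indicator T (\<lambda>j\<in>{1..<n}. Arg2pi (z j / z 0)) :: ennreal)"
        unfolding indicator_def spT by (simp add: G_def)
    qed
  qed
  have comp: "(\<lambda>z. z j) \<in> borel_measurable (?C {..<n})" if "j \<in> {..<n}" for j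
    using measurable_component_singleton[OF that, of "\<lambda>_. uniform_circle"] by (simp cong: measurable_cong_sets)
  have "(\<lambda>z. \<lambda>j\<in>{1..<n}. Arg2pi (z j / z 0)) \<in> measurable (?C {..<n}) ?A"
  proof (rule measurable_restrict)
    fix j assume "j \<in> {1..<n}"
    then have "(\<lambda>z. Arg2pi (z j / z 0)) \<in> borel_measurable (?C {..<n})"
      using n by (intro measurable_compose[OF _ measurable_Arg2pi] borel_measurable_divide comp) auto
    then show "(\<lambda>z. Arg2pi (z j / z 0)) \<in> measurable (?C {..<n}) angle_measure"
      by (simp cong: measurable_cong_sets)
  qed
  then have meas: "(\<lambda>z. indicator T (\<lambda>j\<in>{1..<n}. Arg2pi (z j / z 0)) :: ennreal) \<in> borel_measurable (?C {..<n})"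
    by (rule measurable_compose[OF _ borel_measurable_indicator[OF T]])
  have inner: "(\<integral>\<^sup>+x. indicator T (\<lambda>j\<in>{1..<n}. Arg2pi ((x(0 := a)) j / (x(0 := a)) 0)) \<partial>?C {1..<n}) = emeasure ?A T"
    if a: "cmod a = 1" for a
  proof -
    let ?f = "\<lambda>z. Arg2pi (z / a)"
    have f: "?f \<in> measurable uniform_circle angle_measure"
    proof -
      have "?f \<in> borel_measurable borel" by measurable
      then show ?thesis by (simp cong: measurable_cong_sets)
    qed
    have "distr uniform_circle angle_measure ?f = distr uniform_circle borel ?f"
      by (rule distr_cong) auto
    then have D: "distr (?C {1..<n}) ?A (compose {1..<n} ?f) = ?A"
      using distr_PiM_finite_prob_space'[of "{1..<n}" "\<lambda>_. uniform_circle" "\<lambda>_. angle_measure" ?f]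
        prob_space_uniform_circle prob_space_angle_measure f distr_uniform_circle_Arg2pi[OF a] by simp
    have cf: "compose {1..<n} ?f \<in> measurable (?C {1..<n}) ?A"
      unfolding compose_def
    proof (rule measurable_restrict)
      fix j assume "j \<in> {1..<n}"
      then have "(\<lambda>x. x j) \<in> measurable (?C {1..<n}) uniform_circle" by (rule measurable_component_singleton)
      then show "(\<lambda>x. ?f (x j)) \<in> measurable (?C {1..<n}) angle_measure" by (rule measurable_compose[OF _ f])
    qed
    have "emeasure ?A T = (\<integral>\<^sup>+x. indicator T x \<partial>distr (?C {1..<n}) ?A (compose {1..<n} ?f))"
      unfolding D by (rule nn_integral_indicator[OF T, symmetric])
    also have "\<dots> = (\<integral>\<^sup>+x. indicator T (compose {1..<n} ?f x) \<partial>?C {1..<n})"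
      by (rule nn_integral_distr[OF cf]) (simp only: D borel_measurable_indicator[OF T])
    also have "\<dots> = (\<integral>\<^sup>+x. indicator T (\<lambda>j\<in>{1..<n}. Arg2pi ((x(0 := a)) j / (x(0 := a)) 0)) \<partial>?C {1..<n})"
      by (intro nn_integral_cong arg_cong[where f = "indicator T"]) (auto simp: compose_def restrict_def)
    finally show ?thesis ..
  qed
  have "emeasure (?C {..<n}) G = (\<integral>\<^sup>+z. indicator G z \<partial>?C {..<n})"
    using G by simp
  also have "\<dots> = (\<integral>\<^sup>+z. indicator T (\<lambda>j\<in>{1..<n}. Arg2pi (z j / z 0)) \<partial>?C {..<n})"
    by (rule nn_integral_cong_AE[OF ae])
  also have "\<dots> = (\<integral>\<^sup>+a. \<integral>\<^sup>+x. indicator T (\<lambda>j\<in>{1..<n}. Arg2pi ((x(0 := a)) j / (x(0 := a)) 0)) \<partial>?C {1..<n} \<partial>uniform_circle)"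
    unfolding ins by (rule product_nn_integral_insert_rev) (simp, simp, rule meas[unfolded ins])
  also have "\<dots> = (\<integral>\<^sup>+a. emeasure ?A T \<partial>uniform_circle)"
    by (rule nn_integral_cong_AE, rule AE_mp[OF AE_uniform_circle_norm], rule AE_I2) (use inner in blast)
  also have "\<dots> = emeasure ?A T" using emeasure_space_1 by simp
  finally show ?thesis unfolding G_def T_def emeasure_PiM_angle_simplex[OF n] .
qed

section \<open>Independent variables and the sum over labellings\<close>

context prob_space begin

text \<open>Independence concerns finite subfamilies, and an injective \<open>\<sigma>\<close>
  carries those of \<open>I\<close> to subfamilies of \<open>K\<close> without merging
  factors.\<close>

lemma indep_sets_reindex:
  assumes "indep_sets F K" "inj_on \<sigma> I" "\<sigma> ` I \<subseteq> K"
  shows "indep_sets (\<lambda>i. F (\<sigma> i)) I"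
proof (rule indep_setsI)
  show "F (\<sigma> i) \<subseteq> events" if "i \<in> I" for i using assms that by (auto simp: indep_sets_def)
next
  fix A J assume J: "J \<noteq> {}" "J \<subseteq> I" "finite J" and A: "\<forall>j\<in>J. A j \<in> F (\<sigma> j)"
  have inj: "inj_on \<sigma> J" using assms(2) J(2) by (rule inj_on_subset)
  define B where "B k = A (inv_into J \<sigma> k)" for k
  have B: "B (\<sigma> j) = A j" if "j \<in> J" for j using inj that by (simp add: B_def)
  have "\<sigma> ` J \<subseteq> K" using J(2) assms(3) by blast
  then have "prob (\<Inter>k\<in>\<sigma> ` J. B k) = (\<Prod>k\<in>\<sigma> ` J. prob (B k))"
    using J A B by (intro indep_setsD[OF assms(1)]) auto
  then show "prob (\<Inter>j\<in>J. A j) = (\<Prod>j\<in>J. prob (A j))"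
    using B by (simp add: prod.reindex[OF inj])
qed

lemma indep_vars_reindex:
  assumes "indep_vars (\<lambda>_. N) X K" "inj_on \<sigma> I" "\<sigma> ` I \<subseteq> K"
  shows "indep_vars (\<lambda>_. N) (\<lambda>i. X (\<sigma> i)) I"
  using assms indep_sets_reindex[OF _ assms(2,3), of "\<lambda>i. {X i -` A \<inter> space M | A. A \<in> sets N}"]
  by (auto simp: indep_vars_def2)

text \<open>Independence identifies the joint law with the product of uniform laws.\<close>

lemma prob_good_pts:
  assumes n: "3 \<le> n" and X: "indep_vars (\<lambda>_. borel) X {..<n}"
    and d: "\<And>i. i < n \<Longrightarrow> distr M borel (X i) = uniform_circle"
  shows "{\<omega> \<in> space M. good_pts n (\<lambda>i. X i \<omega>)} \<in> events"
    "prob {\<omega> \<in> space M. good_pts n (\<lambda>i. X i \<omega>)} = 1 / (fact (n - 1) * (6 * 4 ^ (n - 3)))"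
proof -
  let ?Y = "\<lambda>\<omega>. \<lambda>i\<in>{..<n}. X i \<omega>" and ?B = "Pi\<^sub>M {..<n} (\<lambda>_. borel :: complex measure)"
  define G where "G = {z \<in> space ?B. good_pts n z}"
  have rv: "random_variable borel (X i)" if "i \<in> {..<n}" for i
    using X that by (auto simp: indep_vars_def2)
  have Y: "?Y \<in> measurable M ?B" using rv by (rule measurable_restrict)
  have G: "G \<in> sets ?B" unfolding G_def by (rule good_pts_measurable[OF n])
  have "distr M ?B ?Y = Pi\<^sub>M {..<n} (\<lambda>i. distr M borel (X i))"
    using X n rv by (subst (asm) indep_vars_iff_distr_eq_PiM') (auto simp: lessThan_empty_iff)
  also have "\<dots> = Pi\<^sub>M {..<n} (\<lambda>_. uniform_circle)" using d by (intro PiM_cong) auto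
  finally have D: "distr M ?B ?Y = Pi\<^sub>M {..<n} (\<lambda>_. uniform_circle)" .
  have eq: "?Y -` G \<inter> space M = {\<omega> \<in> space M. good_pts n (\<lambda>i. X i \<omega>)}"
  proof -
    have "good_pts n (?Y \<omega>) = good_pts n (\<lambda>i. X i \<omega>)" for \<omega> by (rule good_pts_cong[OF n]) auto
    then show ?thesis using measurable_space[OF Y] by (auto simp: G_def)
  qed
  show "{\<omega> \<in> space M. good_pts n (\<lambda>i. X i \<omega>)} \<in> events"
    using measurable_sets[OF Y G] by (simp only: eq)
  have "emeasure M {\<omega> \<in> space M. good_pts n (\<lambda>i. X i \<omega>)} = emeasure (distr M ?B ?Y) G"
    using Y G by (simp only: emeasure_distr eq)
  also have "\<dots> = ennreal (1 / (fact (n - 1) * (6 * 4 ^ (n - 3))))"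
    unfolding D G_def by (rule emeasure_PiM_good_pts[OF n])
  finally show "prob {\<omega> \<in> space M. good_pts n (\<lambda>i. X i \<omega>)} = 1 / (fact (n - 1) * (6 * 4 ^ (n - 3)))"
    by (simp add: measure_def)
qed

end

theorem proposition6:
  fixes M :: "'a measure" and X :: "nat \<Rightarrow> 'a \<Rightarrow> complex" and n :: nat
  assumes "n \<ge> 3"
    and "prob_space M"
    and "prob_space.indep_vars M (\<lambda>_. borel) X {..<n}"
    and "\<And>i. i < n \<Longrightarrow> distr M borel (X i) = uniform_circle"
  shows "bracelet (bracelet_word n) \<in> realizable_bracelets n \<and>
    measure M {\<omega> \<in> space M.
        yields_bracelet n ((\<lambda>i. X i \<omega>) ` {..<n}) (bracelet (bracelet_word n))}
      = real n / (3 * 2 ^ (2 * n - 6))"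
proof -
  interpret prob_space M by fact
  note n = assms(1)
  \<comment> \<open>A pair consists of a relabelling and an orientation. Permuted and conjugated
    variables are again independent and uniform, so all events \<open>E s\<close> are equally
    likely.\<close>
  let ?S = "{\<sigma>. \<sigma> permutes {..<n}} \<times> {id, cnj}"
  define E where "E s = {\<omega> \<in> space M. good_pts n (\<lambda>i. snd s (X (fst s i) \<omega>))}" for s :: "(nat \<Rightarrow> nat) \<times> (complex \<Rightarrow> complex)"
  define Ev where "Ev = {\<omega> \<in> space M. yields_bracelet n ((\<lambda>i. X i \<omega>) ` {..<n}) (bracelet (bracelet_word n))}"
  have cnj[measurable]: "cnj \<in> borel_measurable borel"
    by (intro borel_measurable_continuous_onI continuous_intros)
  have E: "E s \<in> events" "prob (E s) = 1 / (fact (n - 1) * (6 * 4 ^ (n - 3)))" if S: "s \<in> ?S" for s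
  proof -
    obtain \<sigma> g where s: "s = (\<sigma>, g)" "\<sigma> permutes {..<n}" "g = id \<or> g = cnj" using S by auto
    have g: "g \<in> borel_measurable borel" "distr uniform_circle borel g = uniform_circle"
      using s(3) uniform_circle_cnj distr_id2[of borel uniform_circle] by (auto simp: id_def)
    have "indep_vars (\<lambda>_. borel) (\<lambda>i. X (\<sigma> i)) {..<n}"
      using permutes_inj_on[OF s(2)] permutes_image[OF s(2)] by (intro indep_vars_reindex[OF assms(3)]) auto
    then have iv: "indep_vars (\<lambda>_. borel) (\<lambda>i \<omega>. g (X (\<sigma> i) \<omega>)) {..<n}"
      by (rule indep_vars_compose2) (rule g)
    have "distr M borel (\<lambda>\<omega>. g (X (\<sigma> i) \<omega>)) = uniform_circle" if "i < n" for i
    proof -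
      have i: "\<sigma> i < n" using permutes_in_image[OF s(2), of i] that by simp
      then have "random_variable borel (X (\<sigma> i))" using assms(3) by (auto simp: indep_vars_def2)
      then have "distr M borel (\<lambda>\<omega>. g (X (\<sigma> i) \<omega>)) = distr (distr M borel (X (\<sigma> i))) borel g"
        using g(1) by (subst distr_distr) (auto simp: comp_def)
      then show ?thesis using assms(4)[OF i] g(2) by simp
    qed
    from prob_good_pts[OF n iv this] show "E s \<in> events" "prob (E s) = 1 / (fact (n - 1) * (6 * 4 ^ (n - 3)))"
      by (auto simp: E_def s(1))
  qed
  have Ev: "Ev = (\<Union>s\<in>?S. E s)"
    unfolding Ev_def yields_bracelet_iff_permutes[OF n] by (auto simp: E_def comp_def)
  have "disjoint_family_on E ?S"
  proof (unfold disjoint_family_on_def, intro ballI impI)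
    fix s t assume s: "s \<in> ?S" and t: "t \<in> ?S" and "s \<noteq> t"
    show "E s \<inter> E t = {}"
    proof (rule ccontr)
      assume "E s \<inter> E t \<noteq> {}"
      then obtain \<omega> where \<omega>: "good_pts n (\<lambda>i. snd s (X (fst s i) \<omega>))" "good_pts n (\<lambda>i. snd t (X (fst t i) \<omega>))"
        by (auto simp: E_def)
      let ?x = "\<lambda>i. X i \<omega>"
      have p: "fst s permutes {..<n}" "fst t permutes {..<n}" using s t by auto
      have "snd s = snd t"
      proof (rule ccontr)
        assume "snd s \<noteq> snd t"
        then consider "snd s = id" "snd t = cnj" | "snd s = cnj" "snd t = id" using s t by auto
        then show False
          using good_pts_permutes_chiral[OF n p, of ?x] good_pts_permutes_chiral[OF n p(2,1), of ?x] \<omega>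
          by cases (auto simp: comp_def)
      qed
      moreover have "fst s = fst t"
        using good_pts_permutes_unique[OF n p, of "\<lambda>i. snd s (?x i)"] \<omega> \<open>snd s = snd t\<close> by (simp add: comp_def)
      ultimately show False using \<open>s \<noteq> t\<close> by (simp add: prod_eq_iff)
    qed
  qed
  moreover have "finite ?S" by (simp add: finite_permutations)
  ultimately have "prob Ev = (\<Sum>s\<in>?S. prob (E s))"
    unfolding Ev using E(1) by (intro finite_measure_finite_Union) auto
  also have "\<dots> = real (card ?S) / (fact (n - 1) * (6 * 4 ^ (n - 3)))" using E(2) by simp
  also have "card ?S = fact n * 2"
  proof -
    have "Im (cnj \<i>) \<noteq> Im (id \<i>)" by simp
    then have "cnj \<noteq> id" by metis
    then show ?thesis by (simp add: card_cartesian_product card_permutations)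
  qed
  also have "real (fact n * 2) / (fact (n - 1) * (6 * 4 ^ (n - 3))) = real n / (3 * 2 ^ (2 * n - 6))"
  proof -
    have "fact n = (real n * fact (n - 1) :: real)" using n by (simp add: fact_reduce)
    moreover have "(4 :: real) ^ (n - 3) = 2 ^ (2 * n - 6)"
      using power_mult[of "2 :: real" 2 "n - 3"] by (simp add: diff_mult_distrib2)
    ultimately show ?thesis by (simp add: field_simps)
  qed
  finally have prob: "prob Ev = real n / (3 * 2 ^ (2 * n - 6))" .
  \<comment> \<open>Realizability comes without an explicit configuration: an event of positive
    probability is nonempty, and any outcome in it provides a realizable word.\<close>
  then have "prob Ev \<noteq> 0" using n by simp
  then have "Ev \<noteq> {}" by auto
  then obtain w where "realizable n w" "bracelet w = bracelet (bracelet_word n)"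
    by (auto simp: Ev_def yields_bracelet_def realizable_def)
  then have "bracelet (bracelet_word n) \<in> realizable_bracelets n"
    unfolding realizable_bracelets_def bracelet_def by (metis mem_Collect_eq quotientI)
  with prob show ?thesis by (simp add: Ev_def)
qed

end
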